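(* Let $\theta>0$, let $Y=U^{1/\theta}$ where $U$ is uniformly distributed on $[0,1]$, let $Y_1,Y_2,\dots$ be i.i.d. with the distribution of $Y$, and let $X_i=Y_1\cdots Y_i$. Let $J_1,J_2,\dots$ be fair coins with values in $\{0,1\}$ (each value having probability $\tfrac12$), independent of each other and of $\{Y_i\}$. Let $$Z=\sum_{i\ge1}J_iX_i.$$ Let $\nu^\theta_{\mathbf{y}}$ be the conditional distribution of $Z$ given the process $\{Y_i\}$ (with realization $\mathbf{y}=(y_1,y_2,\dots)$), and let $S^\theta_{\mathbf{y}}=\left\{\sum_{i=1}^\infty a_iX_i:\ a_i\in\{0,1\}\right\}$ be the support of $\nu^\theta_{\mathbf{y}}$. Then: (a) If $\theta>1/\log2$, then $\nu^\theta_{\mathbf{y}}$ is absolutely continuous with respect to Lebesgue measure $\mathcal{L}$ with a density in $L^2(\mathbb{R})$, hence $\mathcal{L}(S^\theta_{\mathbf{y}})>0$, for a.e. $\mathbf{y}$. (b) If $\theta>2/\log2$, then $\nu^\theta_{\mathbf{y}}$ is absolutely continuous with respect to $\mathcal{L}$ with a continuous density, hence $S^\theta_{\mathbf{y}}$ contains an interval, for a.e. $\mathbf{y}$. (c) If $\theta\in(0,1/\log2]$, then $\mathcal{L}(S^\theta_{\mathbf{y}})=0$ and $\dim_H(S^\theta_{\mathbf{y}})=\dim_H(\nu^\theta_{\mathbf{y}})=\theta\log2$ for a.e. $\mathbf{y}$.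
   Context: "A.e. $\mathbf{y}$" is with respect to the law of the i.i.d. sequence $(Y_i)_{i\ge1}$; in $S^\theta_{\mathbf{y}}$ the $X_i$ are evaluated at the realization, i.e. $X_i=y_1\cdots y_i$. $\log$ is the natural logarithm. For a set, $\dim_H$ is Hausdorff dimension; for a Borel measure $\nu$ on $\mathbb{R}$, $\dim_H(\nu)=\inf\{\dim_H(A): A\subset\mathbb{R},\ \nu(\mathbb{R}\setminus A)=0\}$. *)

theory Defs
  imports "HOL-Probability.Probability"
begin

(* "diameter" is only meaningful on bounded sets, whence the
   boundedness condition on covers; the case split below encodes diam({})^s = 0 and
   0^0 = 1 for nonempty sets (whereas 0 powr 0 = 0). *)

definition hausdorff_weight :: "real \<Rightarrow> 'a::metric_space set \<Rightarrow> ennreal" where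
  "hausdorff_weight s U =
     (if U = {} then 0 else if s = 0 then 1 else ennreal (diameter U powr s))"

definition hausdorff_premeasure :: "real \<Rightarrow> real \<Rightarrow> 'a::metric_space set \<Rightarrow> ennreal" where
  "hausdorff_premeasure s \<delta> A =
     (INF U \<in> {U :: nat \<Rightarrow> 'a set. A \<subseteq> (\<Union>n. U n) \<and> (\<forall>n. bounded (U n) \<and> diameter (U n) \<le> \<delta>)}.
        (\<Sum>n. hausdorff_weight s (U n)))"

definition hausdorff_measure :: "real \<Rightarrow> 'a::metric_space set \<Rightarrow> ennreal" where
  "hausdorff_measure s A = (SUP \<delta> \<in> {0<..}. hausdorff_premeasure s \<delta> A)"

definition hausdorff_dim :: "'a::metric_space set \<Rightarrow> ennreal" where
  "hausdorff_dim A = (INF s \<in> {s. 0 \<le> s \<and> hausdorff_measure s A = 0}. ennreal s)"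

(* For a Borel measure \<nu>: membership in null_sets, rather than emeasure \<nu> (- A) = 0, because
   emeasure is 0 on every non-measurable set. *)
definition hausdorff_dim_measure :: "'a::metric_space measure \<Rightarrow> ennreal" where
  "hausdorff_dim_measure \<nu> = (INF A \<in> {A. - A \<in> null_sets \<nu>}. hausdorff_dim A)"

definition topological_support :: "'a::topological_space measure \<Rightarrow> 'a set" where
  "topological_support \<nu> = {x. \<forall>U. open U \<longrightarrow> x \<in> U \<longrightarrow> emeasure \<nu> U > 0}"

(* K is a (regular) conditional distribution of the L-valued random variable Z given the
   N-valued random variable X. *)
definition is_cond_distr ::
  "'a measure \<Rightarrow> 'b measure \<Rightarrow> ('a \<Rightarrow> 'b) \<Rightarrow> 'c measure \<Rightarrow> ('a \<Rightarrow> 'c) \<Rightarrow> ('b \<Rightarrow> 'c measure) \<Rightarrow> bool"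
  where
  "is_cond_distr M N X L Z K \<longleftrightarrow>
     K \<in> N \<rightarrow>\<^sub>M prob_algebra L \<and>
     (\<forall>A\<in>sets N. \<forall>B\<in>sets L.
        emeasure M {\<omega> \<in> space M. X \<omega> \<in> A \<and> Z \<omega> \<in> B} =
          (\<integral>\<^sup>+x\<in>A. emeasure (K x) B \<partial>distr M N X))"

(* Sequences are indexed from 0, so that y i stands for y_(i+1), and
   partial_product y i = y_1 * ... * y_(i+1) for X_(i+1). *)

definition partial_product :: "(nat \<Rightarrow> real) \<Rightarrow> nat \<Rightarrow> real" where
  "partial_product y i = (\<Prod>j\<le>i. y j)"

definition subset_sums :: "(nat \<Rightarrow> real) \<Rightarrow> real set" where
  "subset_sums y =
     {(\<Sum>i. a i * partial_product y i) | a :: nat \<Rightarrow> real. \<forall>i. a i \<in> {0, 1}}"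

end

theory Submission imports Defs begin

text \<open>Write \<open>X\<^sub>k\<close> for the product of the first steps up to index \<open>k\<close>. Given the steps \<open>y\<close>, the variable \<open>Z\<close> is
  the sum of the \<open>X\<^sub>i\<close> with independent fair coins as coefficients; so the conditional law is the explicit
  measure \<open>masked_law UNIV y\<close>, and \<open>subset_sums y\<close> is the compact set of its values.
  Since \<open>- ln Y\<close> is exponential with mean \<open>1 / \<theta>\<close>, the product \<open>X\<^sub>k\<close> is \<open>exp (- k / \<theta>)\<close> up to factors that are
  subexponential in \<open>k\<close>. This set therefore resembles a Cantor set with \<open>2 ^ k\<close> pieces of size
  \<open>exp (- k / \<theta>)\<close>, of similarity dimension \<open>\<theta> * ln 2\<close>, and the three regimes compare this number with 1 and 2.

  The engine is an averaged transversality estimate, \<open>averaged_near_diagonal_mass\<close>. Let two coin sequences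
  first disagree at \<open>k\<close>. The difference of the two sums is \<open>X\<^sub>k * (d + y (k + 1) * w)\<close> with \<open>d\<close> equal to \<open>1\<close> or
  \<open>- 1\<close> and with \<open>w\<close> independent of the single step \<open>y (k + 1)\<close>. That step has a density, hence the difference is
  at most \<open>r\<close> with conditional probability \<open>O(r / X\<^sub>k)\<close>, so also \<open>O((r / X\<^sub>k) powr s)\<close> for every \<open>s\<close> in \<open>[0, 1]\<close>.
  Coins agree up to \<open>k\<close> with probability \<open>2 powr (- k)\<close>, and \<open>X\<^sub>k\<close> is at least \<open>\<delta> * exp (- a * k)\<close> on a set of steps whose
  probability tends to 1 as \<open>\<delta>\<close> tends to 0, for any \<open>a > 1 / \<theta>\<close>. Summation over \<open>k\<close> bounds the mass of pairs at
  distance at most \<open>r\<close>, averaged over these steps, by a multiple of \<open>r powr s\<close> as soon as \<open>a * s < ln 2\<close>; so all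
  \<open>s < \<theta> * ln 2\<close> with \<open>s \<le> 1\<close> are admissible, and \<open>s = 1\<close> if \<open>\<theta> > 1 / ln 2\<close>.

  If \<open>\<theta> > 1 / ln 2\<close>, the case \<open>s = 1\<close> bounds the averages of the conditional law over short windows in \<open>L\<^sup>2\<close>
  along a sequence of window lengths. This gives absolute continuity and, with Lebesgue differentiation and
  Fatou's lemma, a density in \<open>L\<^sup>2\<close> (\<open>L2_density_of_finite_energy\<close>).

  If \<open>\<theta> > 2 / ln 2\<close>, the same estimate holds for the coins of even index alone and for those of odd index
  alone, since half of the coins still agree with probability about \<open>2 powr (- k / 2)\<close>. Both characteristic
  functions are then square integrable, and their product, the characteristic function of the conditional
  law, is integrable; Fourier inversion yields a continuous density. The support contains every interval on which
  this density is positive.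

  If \<open>\<theta> \<le> 1 / ln 2\<close>, the set is covered by \<open>2 ^ n\<close> intervals whose length is the tail of the series. Counting
  them bounds the dimension by \<open>\<theta> * ln 2\<close>, and shows that the set is null if \<open>\<theta> < 1 / ln 2\<close>. For
  \<open>\<theta> = 1 / ln 2\<close> the logarithm of the total length is a centred random walk up to a stationary term. The central limit
  theorem and Kolmogorov's zero-one law make it unbounded below (\<open>critical_vanishing_covers\<close>). Conversely, the
  averaged estimate for \<open>s < \<theta> * ln 2\<close>, summed over dyadic radii, bounds the mass of small intervals around
  almost every point by a power of the radius, and the mass distribution principle bounds the dimension of every set
  of full measure from below.\<close>

section \<open>Partial products of powers of uniform variables\<close>

definition power_law :: "real \<Rightarrow> real measure" where
  "power_law \<theta> = distr (uniform_measure lborel {0..1}) borel (\<lambda>u. u powr (1 / \<theta>))"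

abbreviation (input) seq_borel :: "(nat \<Rightarrow> real) measure" where
  "seq_borel \<equiv> Pi\<^sub>M UNIV (\<lambda>_. borel)"

abbreviation step_law :: "real \<Rightarrow> (nat \<Rightarrow> real) measure" where
  "step_law \<theta> \<equiv> Pi\<^sub>M UNIV (\<lambda>_. power_law \<theta>)"

lemma sets_power_law [simp, measurable_cong]: "sets (power_law \<theta>) = sets borel"
  by (simp add: power_law_def)

lemma space_power_law [simp]: "space (power_law \<theta>) = UNIV"
  by (simp add: power_law_def)

lemma prob_space_uniform01: "prob_space (uniform_measure lborel {0..1::real})"
  by (rule prob_space_uniform_measure) auto

lemma prob_space_power_law: "prob_space (power_law \<theta>)"
  unfolding power_law_def
  by (rule prob_space.prob_space_distr[OF prob_space_uniform01]) measurable

lemma prob_space_step_law: "prob_space (step_law \<theta>)"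
  by (intro prob_space_PiM prob_space_power_law)

lemma sets_step_law [measurable_cong]: "sets (step_law \<theta>) = sets seq_borel"
  by (intro sets_PiM_cong) auto

lemma space_step_law [simp]: "space (step_law \<theta>) = UNIV"
  by (simp add: space_PiM)

lemma nn_integral_uniform01:
  assumes [measurable]: "f \<in> borel_measurable borel"
  shows "(\<integral>\<^sup>+u. f u \<partial>uniform_measure lborel {0..1::real}) = (\<integral>\<^sup>+u. f u * indicator {0..1} u \<partial>lborel)"
  by (subst nn_integral_uniform_measure) (auto simp: divide_ennreal_def)

lemma nn_integral_power_law:
  assumes [measurable]: "f \<in> borel_measurable borel"
  shows "(\<integral>\<^sup>+u. f u \<partial>power_law \<theta>) = (\<integral>\<^sup>+u. f (u powr (1 / \<theta>)) * indicator {0..1} u \<partial>lborel)"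
  unfolding power_law_def
  by (subst nn_integral_distr) (auto intro!: nn_integral_uniform01)

lemma AE_power_law:
  assumes "\<theta> > 0"
  shows "AE u in power_law \<theta>. 0 < u \<and> u \<le> 1"
proof -
  have "AE u in lborel. u \<noteq> (0::real)"
    by (rule AE_lborel_singleton)
  hence "AE u in lborel. u \<in> {0..1::real} \<longrightarrow> 0 < u powr (1/\<theta>) \<and> u powr (1/\<theta>) \<le> 1"
    by eventually_elim (use assms in \<open>auto intro: powr_le1\<close>)
  thus ?thesis unfolding power_law_def
    by (subst AE_distr_iff) (auto intro!: AE_uniform_measureI)
qed

lemma power_law_moment:
  assumes "\<theta> > 0" "s > - \<theta>"
  shows "(\<integral>\<^sup>+u. ennreal (u powr s) \<partial>power_law \<theta>) = ennreal (\<theta> / (\<theta> + s))"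
proof -
  have "(\<integral>\<^sup>+u. ennreal (u powr s) \<partial>power_law \<theta>)
      = (\<integral>\<^sup>+u. ennreal (u powr (s / \<theta>)) * indicator {0..1} u \<partial>lborel)"
    by (subst nn_integral_power_law) (auto simp: powr_powr)
  also have "\<dots> = ennreal (1 powr (s/\<theta>+1) / (s/\<theta>+1))"
  proof (rule nn_integral_has_integral_lebesgue'[where f="\<lambda>u. u powr (s/\<theta>)"])
    show "((\<lambda>u. u powr (s / \<theta>)) has_integral 1 powr (s / \<theta> + 1) / (s / \<theta> + 1)) {0..1}"
      using assms by (intro has_integral_powr_from_0) (auto simp: field_simps)
  qed auto
  also have "1 powr (s/\<theta>+1) / (s/\<theta>+1) = \<theta> / (\<theta> + s)"
    using assms by (simp add: field_simps)
  finally show ?thesis .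
qed

lemma measure_power_law_Icc:
  assumes "\<theta> > 0" "0 \<le> a" "a \<le> b"
  shows "emeasure (power_law \<theta>) {a..b} \<le> ennreal (b powr \<theta> - a powr \<theta>)"
proof -
  have "emeasure (power_law \<theta>) {a..b}
    = (\<integral>\<^sup>+u. indicator {a..b} (u powr (1/\<theta>)) * indicator {0..1} u \<partial>lborel)"
    by (subst nn_integral_power_law[symmetric]) (auto simp: nn_integral_indicator)
  also have "\<dots> \<le> (\<integral>\<^sup>+u. indicator {a powr \<theta>..b powr \<theta>} u \<partial>lborel)"
  proof (rule nn_integral_mono)
    fix u :: real
    have "u \<in> {a powr \<theta>..b powr \<theta>}" if "u \<ge> 0" "u powr (1/\<theta>) \<in> {a..b}"
    proof -
      have "(u powr (1/\<theta>)) powr \<theta> = u" using that assms by (simp add: powr_powr)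
      thus ?thesis
        using that assms powr_mono2[of \<theta> a "u powr (1/\<theta>)"] powr_mono2[of \<theta> "u powr (1/\<theta>)" b]
        by auto
    qed
    thus "indicator {a..b} (u powr (1/\<theta>)) * indicator {0..1} u
        \<le> (indicator {a powr \<theta>..b powr \<theta>} u :: ennreal)"
      by (auto simp: indicator_def)
  qed
  also have "\<dots> = ennreal (b powr \<theta> - a powr \<theta>)"
    using assms by (simp add: powr_mono2)
  finally show ?thesis .
qed

text \<open>The first summand comes from the mean value theorem for \<open>t powr \<theta>\<close> on \<open>[1/2, 3/2]\<close>; the additive 2
  makes the bound below trivial for radii above half of the constant term.\<close>

definition small_ball_const :: "real \<Rightarrow> real" where
  "small_ball_const \<theta> = 2 powr \<theta> * (2 * \<theta> * 2 powr \<bar>\<theta> - 1\<bar>) + 2"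

text \<open>The bound does not depend on the slope, although the density of the power law is unbounded near 0 if
  \<open>\<theta> < 1\<close>. For small \<open>r\<close>, only arguments close to \<open>\<bar>a\<bar> / \<bar>w\<bar>\<close> count; they are at most 1, so \<open>\<bar>w\<bar>\<close> is at least about
  \<open>\<bar>a\<bar>\<close>. Such arguments form an interval with endpoints in the ratio \<open>(1 + \<rho>) / (1 - \<rho>)\<close>, and the mass of an interval
  under the power law scales with \<open>\<bar>a / w\<bar> powr \<theta>\<close>, which is bounded.\<close>

lemma power_law_affine_small_ball:
  assumes "\<theta> > 0" "r > 0" "a \<noteq> 0"
  shows "emeasure (power_law \<theta>) {u. \<bar>a + u * w\<bar> \<le> r} \<le> ennreal (small_ball_const \<theta> * (r / \<bar>a\<bar>))"
proof -
  interpret prob_space "power_law \<theta>" by (rule prob_space_power_law)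
  define \<rho> where "\<rho> = r / \<bar>a\<bar>"
  have \<rho>: "\<rho> > 0" using assms by (simp add: \<rho>_def)
  have C2: "small_ball_const \<theta> \<ge> 2" using assms by (simp add: small_ball_const_def)
  show ?thesis
  proof (cases "\<rho> \<ge> 1/2")
    case True
    hence "1 \<le> small_ball_const \<theta> * \<rho>" using C2 mult_mono[of 2 "small_ball_const \<theta>" "1/2" \<rho>] by simp
    thus ?thesis
      using order_trans[OF emeasure_le_1 ennreal_leI[of 1, unfolded ennreal_1]] unfolding \<rho>_def by simp
  next
    case False
    \<comment> \<open>Whatever the signs of \<open>a\<close> and \<open>w\<close>, the condition on \<open>u > 0\<close> implies \<open>\<bar>1 - u * v\<bar> \<le> \<rho>\<close>.\<close>
    define v where "v = \<bar>w\<bar> / \<bar>a\<bar>"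
    have norm1: "\<bar>a + u * w\<bar> / \<bar>a\<bar> \<le> \<rho>" if "\<bar>a + u * w\<bar> \<le> r" for u
      using that assms by (simp add: \<rho>_def divide_right_mono)
    have uv: "1 - \<rho> \<le> u * v \<and> u * v \<le> 1 + \<rho>" if "\<bar>a + u * w\<bar> \<le> r" "0 < u" for u
    proof -
      have "\<bar>\<bar>a\<bar> - u * \<bar>w\<bar>\<bar> \<le> r"
        using that abs_triangle_ineq3[of a "-(u*w)"] by (simp add: abs_mult)
      hence "\<bar>\<bar>a\<bar> - u * \<bar>w\<bar>\<bar> / \<bar>a\<bar> \<le> \<rho>"
        using assms by (simp add: \<rho>_def divide_right_mono)
      moreover have "1 - u * v = (\<bar>a\<bar> - u * \<bar>w\<bar>) / \<bar>a\<bar>"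
        using assms by (simp add: v_def diff_divide_distrib)
      hence "\<bar>\<bar>a\<bar> - u * \<bar>w\<bar>\<bar> / \<bar>a\<bar> = \<bar>1 - u * v\<bar>"
        by (simp only: abs_divide abs_abs)
      ultimately show ?thesis by linarith
    qed
    show ?thesis
    proof (cases "v \<ge> 1/2")
      case v: True
      have "AE u in power_law \<theta>. 0 < u \<and> u \<le> 1" by (rule AE_power_law[OF assms(1)])
      hence "AE u in power_law \<theta>. u \<in> {u. \<bar>a + u * w\<bar> \<le> r} \<longrightarrow> u \<in> {(1-\<rho>)/v .. (1+\<rho>)/v}"
        by eventually_elim (use uv v in \<open>auto simp: field_simps\<close>)
      hence "emeasure (power_law \<theta>) {u. \<bar>a + u * w\<bar> \<le> r} \<le> emeasure (power_law \<theta>) {(1-\<rho>)/v .. (1+\<rho>)/v}"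
        by (rule emeasure_mono_AE) auto
      also have "\<dots> \<le> ennreal (((1+\<rho>)/v) powr \<theta> - ((1-\<rho>)/v) powr \<theta>)"
        using assms \<rho> False v by (intro measure_power_law_Icc) (auto simp: divide_right_mono)
      also have "((1+\<rho>)/v) powr \<theta> - ((1-\<rho>)/v) powr \<theta> \<le> small_ball_const \<theta> * \<rho>"
      proof -
        have "\<exists>z. 1-\<rho> < z \<and> z < 1+\<rho> \<and>
            (1+\<rho>) powr \<theta> - (1-\<rho>) powr \<theta> = ((1+\<rho>) - (1-\<rho>)) * (\<theta> * z powr (\<theta> - 1))"
          using \<rho> False by (intro MVT2) (auto intro!: derivative_eq_intros simp: field_simps powr_diff)
        then obtain z where z: "1-\<rho> < z" "z < 1+\<rho>"
            "(1+\<rho>) powr \<theta> - (1-\<rho>) powr \<theta> = 2 * \<rho> * (\<theta> * z powr (\<theta> - 1))" by auto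
        have zb: "1/2 \<le> z" "z \<le> 2" using z False by auto
        have "z powr (\<theta> - 1) \<le> 2 powr \<bar>\<theta> - 1\<bar>"
        proof (cases "\<theta> \<ge> 1")
          case True thus ?thesis using powr_mono2[of "\<theta>-1" z 2] zb by auto
        next
          case False
          have "z powr (\<theta>-1) \<le> (1/2) powr (\<theta>-1)"
            using False zb by (intro powr_mono2') auto
          also have "(1/2) powr (\<theta>-1) = 2 powr (-(\<theta>-1))"
            unfolding powr_minus by (simp only: powr_divide powr_one_eq_one inverse_eq_divide zero_le_numeral zero_le_one)
          also have "-(\<theta>-1) = \<bar>\<theta> - 1\<bar>" using False by simp
          finally show ?thesis .
        qed
        hence 1: "(1+\<rho>) powr \<theta> - (1-\<rho>) powr \<theta> \<le> 2 * \<rho> * (\<theta> * 2 powr \<bar>\<theta> - 1\<bar>)"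
          unfolding z(3) using assms \<rho> by (intro mult_left_mono) auto
        have "(1/v) powr \<theta> \<le> 2 powr \<theta>" using v assms by (intro powr_mono2) (auto simp: field_simps)
        hence "(1/v) powr \<theta> * ((1+\<rho>) powr \<theta> - (1-\<rho>) powr \<theta>) \<le> 2 powr \<theta> * (2 * \<rho> * (\<theta> * 2 powr \<bar>\<theta> - 1\<bar>))"
          using 1 \<rho> False assms by (intro mult_mono) (auto intro: powr_mono2)
        also have "\<dots> \<le> small_ball_const \<theta> * \<rho>" using \<rho> by (simp add: small_ball_const_def algebra_simps)
        also have "(1/v) powr \<theta> * ((1+\<rho>) powr \<theta> - (1-\<rho>) powr \<theta>) = ((1+\<rho>)/v) powr \<theta> - ((1-\<rho>)/v) powr \<theta>"
          using v \<rho> False by (simp add: powr_divide right_diff_distrib)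
        finally show ?thesis .
      qed
      finally show ?thesis by (simp add: \<rho>_def ennreal_leI)
    next
      case v: False
      have "AE u in power_law \<theta>. 0 < u \<and> u \<le> 1" by (rule AE_power_law[OF assms(1)])
      hence "AE u in power_law \<theta>. u \<notin> {u. \<bar>a + u * w\<bar> \<le> r}"
      proof eventually_elim
        case (elim u)
        have "u * v \<le> 1 * v" using elim by (intro mult_right_mono) (auto simp: v_def)
        thus ?case using uv[of u] elim v False by auto
      qed
      hence "emeasure (power_law \<theta>) {u. \<bar>a + u * w\<bar> \<le> r} = 0"
        using emeasure_eq_0_AE[of "\<lambda>u. \<bar>a + u * w\<bar> \<le> r" "power_law \<theta>"] by simp
      thus ?thesis by simp
    qed
  qed
qed

lemma power_law_affine_small_ball_powr:
  assumes "\<theta> > 0" "r > 0" "a \<noteq> 0" "0 \<le> s" "s \<le> 1"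
  shows "emeasure (power_law \<theta>) {u. \<bar>a + u * w\<bar> \<le> r} \<le> ennreal (small_ball_const \<theta> * (r / \<bar>a\<bar>) powr s)"
proof -
  interpret prob_space "power_law \<theta>" by (rule prob_space_power_law)
  have C2: "small_ball_const \<theta> \<ge> 2" using assms by (simp add: small_ball_const_def)
  have p: "r / \<bar>a\<bar> > 0" using assms by simp
  show ?thesis
  proof (cases "r / \<bar>a\<bar> \<le> 1")
    case True
    hence "r / \<bar>a\<bar> \<le> (r / \<bar>a\<bar>) powr s"
      using powr_mono'[of s 1 "r / \<bar>a\<bar>"] p assms by simp
    hence "small_ball_const \<theta> * (r / \<bar>a\<bar>) \<le> small_ball_const \<theta> * (r / \<bar>a\<bar>) powr s"
      using C2 by (intro mult_left_mono) auto
    thus ?thesis using power_law_affine_small_ball[OF assms(1-3), of w]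
      by (meson ennreal_leI order_trans)
  next
    case False
    hence "1 \<le> (r / \<bar>a\<bar>) powr s" using assms by (intro ge_one_powr_ge_zero) auto
    hence "1 \<le> small_ball_const \<theta> * (r / \<bar>a\<bar>) powr s" 
      using C2 mult_mono[of 1 "small_ball_const \<theta>" 1 "(r / \<bar>a\<bar>) powr s"] by simp
    thus ?thesis
      by (rule order_trans[OF emeasure_le_1 ennreal_leI[of 1, unfolded ennreal_1]])
  qed
qed

text \<open>Replacing one coordinate of an independent identically distributed sequence by a fresh copy does not
  change the law. All conditioning on "the other steps" below takes this form.\<close>

lemma nn_integral_PiM_resample:
  fixes M :: "'b measure"
  assumes "prob_space M" and [measurable]: "f \<in> borel_measurable (Pi\<^sub>M UNIV (\<lambda>_. M))"
  shows "(\<integral>\<^sup>+y. f y \<partial>Pi\<^sub>M UNIV (\<lambda>_. M))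
       = (\<integral>\<^sup>+y. (\<integral>\<^sup>+u. f (y(j := u)) \<partial>M) \<partial>Pi\<^sub>M UNIV (\<lambda>_. M))"
proof -
  interpret M: prob_space M by fact
  interpret P: prob_space "Pi\<^sub>M UNIV (\<lambda>_. M)" by (intro prob_space_PiM assms)
  interpret pair_sigma_finite M "Pi\<^sub>M UNIV (\<lambda>_. M)" ..
  have [measurable]: "(\<lambda>(u, y). y(j := u)) \<in> M \<Otimes>\<^sub>M Pi\<^sub>M UNIV (\<lambda>_. M) \<rightarrow>\<^sub>M Pi\<^sub>M UNIV (\<lambda>_. M)"
    unfolding split_beta' by (rule measurable_fun_upd[where J=UNIV]) auto
  have "Pi\<^sub>M UNIV (\<lambda>_. M) = distr (M \<Otimes>\<^sub>M Pi\<^sub>M UNIV (\<lambda>_. M)) (Pi\<^sub>M UNIV (\<lambda>_. M)) (\<lambda>(u, y). y(j := u))"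
    using distr_pair_PiM_eq_PiM[of UNIV "\<lambda>_. M" j] assms by simp
  hence "(\<integral>\<^sup>+y. f y \<partial>Pi\<^sub>M UNIV (\<lambda>_. M)) = (\<integral>\<^sup>+y. f y \<partial>distr (M \<Otimes>\<^sub>M Pi\<^sub>M UNIV (\<lambda>_. M)) (Pi\<^sub>M UNIV (\<lambda>_. M)) (\<lambda>(u, y). y(j := u)))"
    by simp
  also have "\<dots> = (\<integral>\<^sup>+z. f ((snd z)(j := fst z)) \<partial>(M \<Otimes>\<^sub>M Pi\<^sub>M UNIV (\<lambda>_. M)))"
    by (subst nn_integral_distr) (auto simp: split_beta')
  also have "\<dots> = (\<integral>\<^sup>+y. (\<integral>\<^sup>+u. f (y(j := u)) \<partial>M) \<partial>Pi\<^sub>M UNIV (\<lambda>_. M))"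
    by (subst nn_integral_snd[symmetric]) (auto simp: split_beta')
  finally show ?thesis .
qed

lemma partial_product_measurable [measurable]:
  "(\<lambda>y. partial_product y n) \<in> borel_measurable seq_borel"
  unfolding partial_product_def by measurable

lemma partial_product_0 [simp]: "partial_product y 0 = y 0"
  by (simp add: partial_product_def)

lemma partial_product_Suc: "partial_product y (Suc n) = partial_product y n * y (Suc n)"
  by (simp add: partial_product_def)

lemma partial_product_upd: "n < j \<Longrightarrow> partial_product (y(j := u)) n = partial_product y n"
  by (auto simp: partial_product_def intro!: prod.cong)

lemma partial_product_moment:
  assumes "\<theta> > 0" "s > - \<theta>"
  shows "(\<integral>\<^sup>+y. ennreal (\<bar>partial_product y n\<bar> powr s) \<partial>step_law \<theta>) = ennreal ((\<theta> / (\<theta> + s)) ^ Suc n)"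
proof -
  have absm: "(\<integral>\<^sup>+u. ennreal (\<bar>u\<bar> powr s) \<partial>power_law \<theta>) = ennreal (\<theta> / (\<theta> + s))"
    unfolding power_law_moment[OF assms, symmetric]
    by (rule nn_integral_cong_AE, rule AE_mp[OF AE_power_law[OF assms(1)]]) auto
  interpret P: prob_space "step_law \<theta>" by (rule prob_space_step_law)
  show ?thesis
  proof (induction n)
    case 0
    show ?case using absm P.emeasure_space_1
      by (subst nn_integral_PiM_resample[where j=0]) (auto simp: prob_space_power_law)
  next
    case (Suc n)
    have "(\<integral>\<^sup>+y. ennreal (\<bar>partial_product y (Suc n)\<bar> powr s) \<partial>step_law \<theta>)
       = (\<integral>\<^sup>+y. (\<integral>\<^sup>+u. ennreal (\<bar>partial_product y n\<bar> powr s) * ennreal (\<bar>u\<bar> powr s) \<partial>power_law \<theta>) \<partial>step_law \<theta>)"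
      by (subst nn_integral_PiM_resample[where j="Suc n"])
         (auto simp: prob_space_power_law partial_product_Suc partial_product_upd powr_mult abs_mult ennreal_mult
               intro!: nn_integral_cong)
    also have "\<dots> = (\<integral>\<^sup>+y. ennreal (\<bar>partial_product y n\<bar> powr s) * ennreal (\<theta> / (\<theta> + s)) \<partial>step_law \<theta>)"
      by (simp add: nn_integral_cmult absm)
    also have "\<dots> = ennreal ((\<theta> / (\<theta> + s)) ^ Suc (Suc n))"
      using assms by (subst nn_integral_multc) (auto simp: Suc ennreal_mult[symmetric] mult_ac)
    finally show ?case .
  qed
qed

text \<open>A bound of Chernoff type. The series of the expectations converges, so the series itself converges almost
  surely; the sign of \<open>s\<close> decides whether this limits the products from above or from below.\<close>

lemma AE_partial_product_tendsto_0:
  assumes "\<theta> > 0" "s > - \<theta>" and lt: "exp (c * s) * (\<theta> / (\<theta> + s)) < 1"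
  shows "AE y in step_law \<theta>. (\<lambda>n. (exp (c * real n) * \<bar>partial_product y n\<bar>) powr s) \<longlonglongrightarrow> 0"
proof -
  define q where "q = exp (c * s) * (\<theta> / (\<theta> + s))"
  have q: "0 \<le> q" "q < 1" using lt assms by (auto simp: q_def)
  have "(\<integral>\<^sup>+y. (\<Sum>n. ennreal ((exp (c * real n) * \<bar>partial_product y n\<bar>) powr s)) \<partial>step_law \<theta>)
      = (\<Sum>n. (\<integral>\<^sup>+y. ennreal ((exp (c * real n) * \<bar>partial_product y n\<bar>) powr s) \<partial>step_law \<theta>))"
    by (rule nn_integral_suminf) measurable
  also have "\<dots> = (\<Sum>n. ennreal (q ^ n * (\<theta> / (\<theta> + s))))"
  proof (intro suminf_cong)
    fix n
    have "(\<integral>\<^sup>+y. ennreal ((exp (c * real n) * \<bar>partial_product y n\<bar>) powr s) \<partial>step_law \<theta>)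
      = (\<integral>\<^sup>+y. ennreal (exp (c * s * n)) * ennreal (\<bar>partial_product y n\<bar> powr s) \<partial>step_law \<theta>)"
      by (intro nn_integral_cong) (simp add: powr_mult ennreal_mult exp_powr_real mult_ac)
    also have "\<dots> = ennreal (exp (c * s * n)) * ennreal ((\<theta> / (\<theta> + s)) ^ Suc n)"
      by (subst nn_integral_cmult) (auto simp: partial_product_moment[OF assms(1,2)])
    also have "\<dots> = ennreal (q ^ n * (\<theta> / (\<theta> + s)))"
    proof -
      have "exp (c * s * n) = exp (c * s) ^ n"
        by (simp add: exp_of_nat_mult[symmetric] mult_ac)
      thus ?thesis using assms by (simp add: q_def ennreal_mult[symmetric] power_mult_distrib power_divide mult_ac)
    qed
    finally show "(\<integral>\<^sup>+y. ennreal ((exp (c * real n) * \<bar>partial_product y n\<bar>) powr s) \<partial>step_law \<theta>) = ennreal (q ^ n * (\<theta> / (\<theta> + s)))" .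
  qed
  also have "\<dots> < \<infinity>"
  proof -
    have "summable (\<lambda>n. q ^ n * (\<theta> / (\<theta> + s)))" using q by (intro summable_mult2 summable_geometric) auto
    thus ?thesis using q assms by (subst suminf_ennreal2) auto
  qed
  finally have "AE y in step_law \<theta>. (\<Sum>n. ennreal ((exp (c * real n) * \<bar>partial_product y n\<bar>) powr s)) \<noteq> \<infinity>"
    by (intro nn_integral_PInf_AE) (auto simp: less_top)
  thus ?thesis
  proof eventually_elim
    case (elim y)
    hence "summable (\<lambda>n. (exp (c * real n) * \<bar>partial_product y n\<bar>) powr s)"
      by (intro summable_suminf_not_top) auto
    thus ?case by (rule summable_LIMSEQ_zero)
  qed
qed


text \<open>Almost every sequence of steps is regular, and all pointwise arguments about one sequence of steps use
  only this.\<close>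

definition regular_steps :: "(nat \<Rightarrow> real) \<Rightarrow> bool" where
  "regular_steps y \<longleftrightarrow> (\<forall>i. 0 < y i \<and> y i \<le> 1) \<and> summable (partial_product y)"

lemma measurable_partial_product [measurable (raw)]:
  "f \<in> M \<rightarrow>\<^sub>M seq_borel \<Longrightarrow> (\<lambda>x. partial_product (f x) n) \<in> borel_measurable M"
  by (rule measurable_compose[OF _ partial_product_measurable])

lemma measurable_summable [measurable (raw)]:
  fixes f :: "nat \<Rightarrow> 'a \<Rightarrow> real"
  assumes [measurable]: "\<And>i. f i \<in> borel_measurable M"
  shows "Measurable.pred M (\<lambda>x. summable (\<lambda>i. f i x))"
  unfolding summable_iff_convergent Cauchy_convergent_iff[symmetric] Cauchy_iff2 by measurable

lemma regular_steps_pred [measurable]: "Measurable.pred seq_borel regular_steps"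
  unfolding regular_steps_def by measurable

lemma partial_product_pos: "(\<And>i. 0 < y i) \<Longrightarrow> 0 < partial_product y n"
  by (simp add: partial_product_def prod_pos)

lemma AE_steps_range:
  assumes "\<theta> > 0" shows "AE y in step_law \<theta>. \<forall>i. 0 < y i \<and> y i \<le> 1"
proof -
  interpret product_prob_space "\<lambda>_. power_law \<theta>" "UNIV :: nat set"
    by (intro product_prob_spaceI prob_space_power_law)
  show ?thesis
    unfolding AE_all_countable
    by (intro allI AE_component[of _ "\<lambda>u. 0 < u \<and> u \<le> 1"] AE_power_law assms UNIV_I)
qed

text \<open>The exponent \<open>- s\<close> works for every small \<open>s > 0\<close>, because \<open>exp (a * s) * (1 - s / \<theta>)\<close> has the derivative
  \<open>a - 1 / \<theta> > 0\<close> at \<open>s = 0\<close>; the chosen \<open>s\<close> is half of the zero of the quadratic lower bound for its excess over 1.\<close>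

lemma AE_partial_product_lower:
  assumes "\<theta> > 0" "a > 1 / \<theta>"
  shows "AE y in step_law \<theta>. \<exists>\<delta>>0. \<forall>n. \<delta> * exp (- a * real n) \<le> partial_product y n"
proof -
  have a: "a > 0" "a * \<theta> > 1" using assms by (auto simp: field_simps intro: less_trans[of 0 "1/\<theta>"])
  \<comment> \<open>This choice gives \<open>a * \<theta> - 1 - a * s = (a * \<theta> - 1) / 2 > 0\<close>.\<close>
  define s where "s = (a * \<theta> - 1) / (2 * a)"
  have s: "s > 0" "s < \<theta>" using a assms by (auto simp: s_def field_simps)
  have "AE y in step_law \<theta>. (\<lambda>n. (exp (a * real n) * \<bar>partial_product y n\<bar>) powr (-s)) \<longlonglongrightarrow> 0"
  proof (rule AE_partial_product_tendsto_0)
    have "1 < (1 + a * s) * (1 - s / \<theta>)"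
    proof -
      have "(1 + a * s) * (1 - s / \<theta>) = 1 + s * (a * \<theta> - 1 - a * s) / \<theta>"
        using assms by (simp add: field_simps)
      moreover have "a * \<theta> - 1 - a * s = (a * \<theta> - 1) / 2" using a by (simp add: s_def field_simps)
      ultimately show ?thesis using a s assms by simp
    qed
    also have "\<dots> \<le> exp (a * s) * (1 - s / \<theta>)"
      using s assms by (intro mult_right_mono) (auto simp: field_simps)
    finally show "exp (a * - s) * (\<theta> / (\<theta> + - s)) < 1"
      using s assms by (simp add: exp_minus field_simps)
  qed (use s assms in auto)
  thus ?thesis using AE_steps_range[OF assms(1)]
  proof eventually_elim
    case (elim y)
    define f where "f n = exp (a * real n) * partial_product y n" for n
    have pos: "0 < partial_product y n" for n using elim by (intro partial_product_pos) auto
    hence fpos: "f n > 0" for n by (simp add: f_def)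
    have "eventually (\<lambda>n. (exp (a * real n) * \<bar>partial_product y n\<bar>) powr (-s) < 1) sequentially"
      using elim(1) by (rule order_tendstoD) simp
    then obtain N where N: "\<And>n. n \<ge> N \<Longrightarrow> (f n) powr (-s) < 1"
      by (auto simp: eventually_sequentially f_def abs_of_pos[OF pos])
    have N': "f n \<ge> 1" if "n \<ge> N" for n
    proof (rule ccontr)
      assume "\<not> f n \<ge> 1"
      hence "1 \<le> f n powr (-s)" using fpos[of n] s powr_mono2'[of "-s" "f n" 1] by simp
      thus False using N[OF that] by simp
    qed
    define \<delta> where "\<delta> = Min (insert 1 (f ` {..N}))"
    have "\<delta> > 0" using fpos by (simp add: \<delta>_def)
    moreover have "\<delta> \<le> f n" for n
    proof (cases "n \<le> N")
      case True thus ?thesis unfolding \<delta>_def by (intro Min_le) auto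
    next
      case False
      have "\<delta> \<le> 1" by (simp add: \<delta>_def)
      thus ?thesis using N'[of n] False by simp
    qed
    hence "\<delta> * exp (- a * real n) \<le> partial_product y n" for n
      by (simp add: f_def exp_minus field_simps)
    ultimately show ?case by blast
  qed
qed

text \<open>The mirror image of the lower bound, with a positive exponent and \<open>1 - b * s \<le> exp (- b * s)\<close>.\<close>

lemma AE_partial_product_upper:
  assumes "\<theta> > 0" "0 < b" "b < 1 / \<theta>"
  shows "AE y in step_law \<theta>. \<exists>C>0. \<forall>n. partial_product y n \<le> C * exp (- b * real n)"
proof -
  have b: "b * \<theta> < 1" using assms by (auto simp: field_simps)
  define s where "s = (1 - b * \<theta>) / (2 * b)"
  have "b * s = (1 - b * \<theta>) / 2" using assms by (simp add: s_def)
  moreover have "- 1 < b * \<theta>" using mult_pos_pos[of b \<theta>] assms(1,2) by linarith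
  ultimately have s: "s > 0" "b * s < 1" using assms b by (simp_all add: s_def)
  have "AE y in step_law \<theta>. (\<lambda>n. (exp (b * real n) * \<bar>partial_product y n\<bar>) powr s) \<longlonglongrightarrow> 0"
  proof (rule AE_partial_product_tendsto_0)
    have "1 < (1 - b * s) * (1 + s / \<theta>)"
    proof -
      have "(1 - b * s) * (1 + s / \<theta>) = 1 + s * (1 - b * \<theta> - b * s) / \<theta>"
        using assms by (simp add: field_simps)
      moreover have "1 - b * \<theta> - b * s = (1 - b * \<theta>) / 2" using assms by (simp add: s_def field_simps)
      ultimately show ?thesis using b s assms by simp
    qed
    also have "\<dots> \<le> exp (- (b * s)) * (1 + s / \<theta>)"
      using s assms exp_ge_add_one_self[of "- (b * s)"] by (intro mult_right_mono) (auto simp: field_simps)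
    finally show "exp (b * s) * (\<theta> / (\<theta> + s)) < 1"
      using s assms by (simp add: exp_minus field_simps)
  qed (use s assms in auto)
  thus ?thesis using AE_steps_range[OF assms(1)]
  proof eventually_elim
    case (elim y)
    define f where "f n = exp (b * real n) * partial_product y n" for n
    have pos: "0 < partial_product y n" for n using elim by (intro partial_product_pos) auto
    hence fpos: "f n > 0" for n by (simp add: f_def)
    have "eventually (\<lambda>n. (exp (b * real n) * \<bar>partial_product y n\<bar>) powr s < 1) sequentially"
      using elim(1) by (rule order_tendstoD) simp
    then obtain N where N: "\<And>n. n \<ge> N \<Longrightarrow> (f n) powr s < 1"
      by (auto simp: eventually_sequentially f_def abs_of_pos[OF pos])
    have N': "f n \<le> 1" if "n \<ge> N" for n
    proof (rule ccontr)
      assume "\<not> f n \<le> 1"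
      hence "1 \<le> f n powr s" using s by (intro ge_one_powr_ge_zero) auto
      thus False using N[OF that] by simp
    qed
    define C where "C = Max (insert 1 (f ` {..N}))"
    have C1: "C \<ge> 1" by (simp add: C_def)
    moreover have "f n \<le> C" for n
    proof (cases "n \<le> N")
      case True thus ?thesis unfolding C_def by (intro Max_ge) auto
    next
      case False
      thus ?thesis using N'[of n] C1 by simp
    qed
    hence "partial_product y n \<le> C * exp (- b * real n)" for n
      by (simp add: f_def exp_minus field_simps)
    ultimately show ?case by (intro exI[of _ C]) auto
  qed
qed

lemma exp_decay_sums:
  assumes "b > 0"
  shows "(\<lambda>i. C * exp (- b * real (i + n))) sums (C / (1 - exp (-b)) * exp (- b * real n))"
proof -
  have "(\<lambda>i. (C * exp (- b * real n)) * exp (-b) ^ i) sums ((C * exp (- b * real n)) * (1 / (1 - exp (-b))))"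
    using assms by (intro sums_mult geometric_sums) auto
  moreover have "(\<lambda>i. (C * exp (- b * real n)) * exp (-b) ^ i) = (\<lambda>i. C * exp (- b * real (i + n)))"
    by (simp add: exp_of_nat_mult[symmetric] mult.assoc exp_add[symmetric] ring_distribs fun_eq_iff mult_ac add.commute)
  ultimately have "(\<lambda>i. C * exp (- b * real (i + n))) sums ((C * exp (- b * real n)) * (1 / (1 - exp (-b))))"
    by (simp only:)
  thus ?thesis by (simp only: times_divide_eq_right times_divide_eq_left mult_1_right)
qed

lemma AE_regular_steps:
  assumes "\<theta> > 0"
  shows "AE y in step_law \<theta>. regular_steps y"
proof -
  have "0 < 1 / (2 * \<theta>)" "1 / (2 * \<theta>) < 1 / \<theta>" using assms by (auto simp: field_simps)
  from AE_partial_product_upper[OF assms this] AE_steps_range[OF assms]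
  show ?thesis
  proof eventually_elim
    case (elim y)
    then obtain C where C: "\<And>n. partial_product y n \<le> C * exp (- (1/(2*\<theta>)) * real n)" by auto
    have pos: "0 < partial_product y n" for n using elim by (intro partial_product_pos) auto
    have "summable (\<lambda>n. C * exp (- (1/(2*\<theta>)) * real n))"
      using exp_decay_sums[of "1/(2*\<theta>)" C 0] assms by (auto simp: sums_iff)
    hence "summable (partial_product y)"
      using C pos by (elim summable_comparison_test'[of _ 0]) (auto simp: less_imp_le)
    thus ?case using elim by (simp add: regular_steps_def)
  qed
qed

section \<open>Fair coins and masked random sums\<close>

definition fair_coin :: "real measure" where
  "fair_coin = distr (measure_pmf (pmf_of_set {0, 1})) borel (\<lambda>x. x)"

abbreviation coin_law :: "(nat \<Rightarrow> real) measure" where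
  "coin_law \<equiv> Pi\<^sub>M UNIV (\<lambda>_. fair_coin)"

lemma sets_fair_coin [simp, measurable_cong]: "sets fair_coin = sets borel"
  and space_fair_coin [simp]: "space fair_coin = UNIV"
  by (simp_all add: fair_coin_def)

lemma prob_space_fair_coin: "prob_space fair_coin"
  unfolding fair_coin_def by (rule measure_pmf.prob_space_distr) simp

lemma prob_space_coin_law: "prob_space coin_law"
  by (intro prob_space_PiM prob_space_fair_coin)

lemma sets_coin_law [measurable_cong]: "sets coin_law = sets seq_borel"
  by (intro sets_PiM_cong) auto

lemma space_coin_law [simp]: "space coin_law = UNIV"
  by (simp add: space_PiM)

lemma emeasure_fair_coin:
  assumes "A \<in> sets borel"
  shows "emeasure fair_coin A = ennreal ((indicator A 0 + indicator A 1) / 2)"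
proof -
  have "card ({0, 1::real} \<inter> A) = indicator A 0 + indicator A (1::real)"
    by (auto simp: indicator_def Int_insert_left)
  thus ?thesis using assms unfolding fair_coin_def
    by (subst emeasure_distr) (auto simp: emeasure_pmf_of_set ennreal_indicator split: split_indicator)
qed

lemma emeasure_fair_coin_singleton_le: "emeasure fair_coin {x} \<le> ennreal (1/2)"
  by (auto simp: emeasure_fair_coin indicator_def)

lemma AE_fair_coin: "AE x in fair_coin. x \<in> {0, 1}"
  by (rule AE_I'[of "- {0, 1}"]) (auto simp: null_sets_def emeasure_fair_coin intro!: borel_open)

lemma AE_coin_law: "AE c in coin_law. \<forall>i. c i \<in> {0, 1}"
proof -
  interpret product_prob_space "\<lambda>_. fair_coin" "UNIV :: nat set"
    by (intro product_prob_spaceI prob_space_fair_coin)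
  show ?thesis
    unfolding AE_all_countable
    by (intro allI AE_component[of _ "\<lambda>u. u \<in> {0, 1}"] AE_fair_coin UNIV_I)
qed

lemma emeasure_coin_law_cylinder:
  assumes "finite F"
  shows "emeasure coin_law {c. \<forall>i\<in>F. c i = c' i} = (\<Prod>i\<in>F. emeasure fair_coin {c' i})"
proof -
  interpret product_prob_space "\<lambda>_. fair_coin" "UNIV :: nat set"
    by (intro product_prob_spaceI prob_space_fair_coin)
  show ?thesis
    using emeasure_PiM_Collect[of F "\<lambda>i. {c' i}"] assms by simp
qed

lemma emeasure_coin_law_cylinder_le:
  assumes "finite F"
  shows "emeasure coin_law {c. \<forall>i\<in>F. c i = c' i} \<le> ennreal ((1/2) ^ card F)"
proof -
  have "emeasure coin_law {c. \<forall>i\<in>F. c i = c' i} \<le> (\<Prod>i\<in>F. ennreal (1/2))"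
    unfolding emeasure_coin_law_cylinder[OF assms]
    by (intro prod_mono_ennreal emeasure_fair_coin_singleton_le)
  also have "\<dots> = ennreal ((1/2) ^ card F)"
    by (subst prod_constant, rule ennreal_power) simp
  finally show ?thesis .
qed

text \<open>The random sum restricted to the coins with index in \<open>I\<close>. The full sum has \<open>I = UNIV\<close>; the parity classes serve
  to write its law as a convolution.\<close>

definition masked_sum :: "nat set \<Rightarrow> (nat \<Rightarrow> real) \<Rightarrow> (nat \<Rightarrow> real) \<Rightarrow> real" where
  "masked_sum I y c = (\<Sum>i. indicator I i * c i * partial_product y i)"

lemma measurable_masked_sum [measurable (raw)]:
  assumes [measurable]: "f \<in> M \<rightarrow>\<^sub>M seq_borel" "g \<in> M \<rightarrow>\<^sub>M seq_borel"
  shows "(\<lambda>x. masked_sum I (f x) (g x)) \<in> borel_measurable M"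
  unfolding masked_sum_def by measurable

lemma borel_measurable_masked_sum [measurable]:
  "masked_sum I y \<in> borel_measurable seq_borel"
  unfolding masked_sum_def by measurable

definition masked_law :: "nat set \<Rightarrow> (nat \<Rightarrow> real) \<Rightarrow> real measure" where
  "masked_law I y = distr coin_law borel (masked_sum I y)"

lemma sets_masked_law [simp, measurable_cong]: "sets (masked_law I y) = sets borel"
  by (simp add: masked_law_def)

lemma space_masked_law [simp]: "space (masked_law I y) = UNIV"
  by (simp add: masked_law_def)

lemma prob_space_masked_law: "prob_space (masked_law I y)"
  unfolding masked_law_def by (rule prob_space.prob_space_distr[OF prob_space_coin_law]) measurable

lemma summable_masked:
  assumes "regular_steps y" "\<And>i. \<bar>d i\<bar> \<le> 1"
  shows "summable (\<lambda>i. d i * partial_product y i)"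
proof (rule summable_comparison_test'[of "partial_product y" 0])
  fix n
  have "\<bar>d n\<bar> * \<bar>partial_product y n\<bar> \<le> 1 * partial_product y n"
    using assms partial_product_pos[of y n] by (intro mult_mono) (auto simp: regular_steps_def)
  thus "norm (d n * partial_product y n) \<le> partial_product y n" by (simp add: abs_mult)
qed (use assms in \<open>auto simp: regular_steps_def\<close>)

text \<open>The case of fixed coins, \<open>d\<close> being the difference of two coin sequences that first disagree at \<open>k\<close>. The step
  with index \<open>Suc k\<close> is resampled: it is a factor of every later product and of no earlier one, so the sum is an
  affine function of it, with constant term \<open>d k * partial_product y k\<close>.\<close>

lemma small_difference_given_first_disagreement:
  assumes \<theta>: "\<theta> > 0" and r: "r > 0" and s: "0 \<le> s" "s \<le> 1" and \<delta>: "\<delta> > 0"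
    and d: "\<And>i. i < k \<Longrightarrow> d i = 0" "\<bar>d k\<bar> = 1"
  shows "(\<integral>\<^sup>+y. indicator {y. summable (\<lambda>i. d i * partial_product y i) \<and> \<delta> \<le> partial_product y k \<and>
             \<bar>\<Sum>i. d i * partial_product y i\<bar> \<le> r} y \<partial>step_law \<theta>)
         \<le> ennreal (small_ball_const \<theta> * (r / \<delta>) powr s)"
proof -
  interpret P: prob_space "step_law \<theta>" by (rule prob_space_step_law)
  let ?E = "{y. summable (\<lambda>i. d i * partial_product y i) \<and> \<delta> \<le> partial_product y k \<and>
             \<bar>\<Sum>i. d i * partial_product y i\<bar> \<le> r}"
  have [measurable]: "?E \<in> sets (step_law \<theta>)"
  proof -
    have "Measurable.pred seq_borel (\<lambda>y. summable (\<lambda>i. d i * partial_product y i)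
        \<and> \<delta> \<le> partial_product y k \<and> \<bar>\<Sum>i. d i * partial_product y i\<bar> \<le> r)"
      by measurable
    thus ?thesis unfolding sets_step_law by (simp add: pred_def space_PiM)
  qed
  have "(\<integral>\<^sup>+y. indicator ?E y \<partial>step_law \<theta>) 
      = (\<integral>\<^sup>+y. (\<integral>\<^sup>+u. indicator ?E (y(Suc k := u)) \<partial>power_law \<theta>) \<partial>step_law \<theta>)"
    by (rule nn_integral_PiM_resample) (auto simp: prob_space_power_law)
  also have "\<dots> \<le> (\<integral>\<^sup>+y. ennreal (small_ball_const \<theta> * (r / \<delta>) powr s) \<partial>step_law \<theta>)"
  proof (rule nn_integral_mono)
    fix y :: "nat \<Rightarrow> real"
    let ?X = "\<lambda>u. partial_product (y(Suc k := u))"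
    have scale: "?X u (i + Suc k) = u * ?X 1 (i + Suc k)" for u i
    proof (induction i)
      case 0
      have "?X v (Suc k) = partial_product y k * v" for v
        using partial_product_Suc[of "y(Suc k := v)" k] by (simp add: partial_product_upd del: fun_upd_apply)
           (simp add: fun_upd_apply)
      from this[of u] this[of 1] show ?case by (simp add: fun_upd_def)
    next
      case (Suc i) 
      have "?X u (Suc i + Suc k) = ?X u (i + Suc k) * y (Suc i + Suc k)"
        using partial_product_Suc[of "y(Suc k := u)" "i + Suc k"] by simp
      moreover have "?X 1 (Suc i + Suc k) = ?X 1 (i + Suc k) * y (Suc i + Suc k)"
        using partial_product_Suc[of "y(Suc k := 1)" "i + Suc k"] by simp
      ultimately show ?case using Suc by (simp add: fun_upd_def)
    qed
    define w where "w = (\<Sum>i. d (i + Suc k) * ?X 1 (i + Suc k))"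
    have affine: "(\<Sum>i. d i * ?X u i) = d k * partial_product y k + u * w"
      if "u \<noteq> 0" "summable (\<lambda>i. d i * ?X u i)" for u
    proof -
      have s1: "summable (\<lambda>i. u * (d (i + Suc k) * ?X 1 (i + Suc k)))"
        using summable_ignore_initial_segment[OF that(2), of "Suc k"] scale[of u]
        by (simp add: mult_ac)
      hence s2: "summable (\<lambda>i. d (i + Suc k) * ?X 1 (i + Suc k))"
        using that(1) by simp
      have "(\<Sum>i. d i * ?X u i) = (\<Sum>i. d (i + Suc k) * ?X u (i + Suc k)) + (\<Sum>i<Suc k. d i * ?X u i)"
        by (rule suminf_split_initial_segment[OF that(2)])
      also have "(\<Sum>i<Suc k. d i * ?X u i) = d k * partial_product y k"
        using d by (simp add: partial_product_upd)
      also have "(\<Sum>i. d (i + Suc k) * ?X u (i + Suc k)) = u * w"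
        unfolding w_def suminf_mult[OF s2, symmetric] by (subst scale) (simp add: mult_ac)
      finally show ?thesis by (simp add: fun_upd_def)
    qed
    show "(\<integral>\<^sup>+u. indicator ?E (y(Suc k := u)) \<partial>power_law \<theta>) \<le> ennreal (small_ball_const \<theta> * (r / \<delta>) powr s)"
    proof (cases "\<delta> \<le> partial_product y k")
      case True
      have dk: "d k * partial_product y k \<noteq> 0" using True \<delta> d by auto
      have "(\<integral>\<^sup>+u. indicator ?E (y(Suc k := u)) \<partial>power_law \<theta>)
         \<le> (\<integral>\<^sup>+u. indicator {u. \<bar>d k * partial_product y k + u * w\<bar> \<le> r} u \<partial>power_law \<theta>)"
        by (rule nn_integral_mono_AE, rule AE_mp[OF AE_power_law[OF \<theta>]])
           (use affine in \<open>auto simp: indicator_def\<close>)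
      also have "\<dots> = emeasure (power_law \<theta>) {u. \<bar>d k * partial_product y k + u * w\<bar> \<le> r}"
        by (rule nn_integral_indicator) measurable
      also have "\<dots> \<le> ennreal (small_ball_const \<theta> * (r / \<bar>d k * partial_product y k\<bar>) powr s)"
        by (rule power_law_affine_small_ball_powr[OF \<theta> r dk s])
      also have "\<dots> \<le> ennreal (small_ball_const \<theta> * (r / \<delta>) powr s)"
        using True \<delta> d r s \<theta>
        by (intro ennreal_leI mult_left_mono powr_mono2)
           (auto simp: abs_mult small_ball_const_def intro!: divide_left_mono mult_pos_pos)
      finally show ?thesis .
    next
      case False
      thus ?thesis by (simp add: partial_product_upd)
    qed
  qed
  also have "\<dots> = ennreal (small_ball_const \<theta> * (r / \<delta>) powr s)"
    using P.emeasure_space_1 by simp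
  finally show ?thesis .
qed


section \<open>Averaged mass near the diagonal\<close>

text \<open>The expectation of \<open>g\<close> at the difference of two independent points with law \<open>\<mu>\<close>. Indicators of intervals
  around 0 measure the mass near the diagonal; Gaussian kernels link it to the characteristic function.\<close>

definition pair_energy :: "(real \<Rightarrow> ennreal) \<Rightarrow> real measure \<Rightarrow> ennreal" where
  "pair_energy g \<mu> = (\<integral>\<^sup>+x. (\<integral>\<^sup>+x'. g (x - x') \<partial>\<mu>) \<partial>\<mu>)"

lemma nn_integral_masked_law:
  assumes [measurable]: "g \<in> borel_measurable borel"
  shows "(\<integral>\<^sup>+x. g x \<partial>masked_law I y) = (\<integral>\<^sup>+c. g (masked_sum I y c) \<partial>coin_law)"
  unfolding masked_law_def by (rule nn_integral_distr) measurable

lemma pair_energy_masked_law: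
  assumes [measurable]: "g \<in> borel_measurable borel"
  shows "pair_energy g (masked_law I y)
    = (\<integral>\<^sup>+c. (\<integral>\<^sup>+c'. g (masked_sum I y c - masked_sum I y c') \<partial>coin_law) \<partial>coin_law)"
proof -
  interpret L: prob_space "masked_law I y" by (rule prob_space_masked_law)
  have "pair_energy g (masked_law I y)
      = (\<integral>\<^sup>+c. (\<integral>\<^sup>+x'. g (masked_sum I y c - x') \<partial>masked_law I y) \<partial>coin_law)"
    unfolding pair_energy_def by (rule nn_integral_masked_law) measurable
  also have "\<dots> = (\<integral>\<^sup>+c. (\<integral>\<^sup>+c'. g (masked_sum I y c - masked_sum I y c') \<partial>coin_law) \<partial>coin_law)"
    by (intro nn_integral_cong nn_integral_masked_law) measurable
  finally show ?thesis .
qed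

lemma borel_measurable_pair_energy_masked_law [measurable]:
  assumes [measurable]: "g \<in> borel_measurable borel"
  shows "(\<lambda>y. pair_energy g (masked_law I y)) \<in> borel_measurable seq_borel"
proof -
  interpret prob_space coin_law by (rule prob_space_coin_law)
  show ?thesis unfolding pair_energy_masked_law[OF assms] by measurable
qed

text \<open>By \<open>AE_partial_product_lower\<close>, almost every sequence of steps satisfies this for some \<open>\<delta> > 0\<close> if \<open>a > 1 / \<theta>\<close>.
  Restriction to a fixed \<open>\<delta>\<close> is essential: the expectation of \<open>X\<^sub>k powr (- s)\<close> without it grows too fast to reach
  the sharp thresholds.\<close>

definition slow_decay :: "real \<Rightarrow> real \<Rightarrow> (nat \<Rightarrow> real) \<Rightarrow> bool" where
  "slow_decay a \<delta> y \<longleftrightarrow> regular_steps y \<and> (\<forall>n. \<delta> * exp (- a * real n) \<le> partial_product y n)"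

lemma slow_decay_pred [measurable]: "Measurable.pred seq_borel (slow_decay a \<delta>)"
  unfolding slow_decay_def by measurable

lemma slow_decay_sets [measurable]: "{y. slow_decay a \<delta> y} \<in> sets seq_borel"
  using slow_decay_pred[of a \<delta>] by (simp add: pred_def space_PiM)

text \<open>The sum over \<open>k\<close> on the right dominates the term with the first index of disagreement. It is
  larger than necessary, but its coin probabilities are those of plain cylinder sets.\<close>

lemma near_collision_given_coins:
  assumes \<theta>: "\<theta> > 0" and r: "r > 0" and s: "0 \<le> s" "s \<le> 1" and \<delta>: "\<delta> > 0"
    and c: "\<And>i. c i \<in> {0, 1}" "\<And>i. c' i \<in> {0, 1}" and ne: "\<exists>i\<in>I. c i \<noteq> c' i"
  shows "(\<integral>\<^sup>+y. indicator {y. slow_decay a \<delta> y} y * indicator {-r..r} (masked_sum I y c - masked_sum I y c') \<partial>step_law \<theta>)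
     \<le> (\<Sum>k. ennreal (small_ball_const \<theta> * (r / \<delta>) powr s * exp (a * s * real k)) * 
            indicator {c'. \<forall>i\<in>I \<inter> {..<k}. c' i = c i} c')"
proof -
  \<comment> \<open>Indices outside \<open>I\<close> do not enter the sum, so the first disagreement is taken within \<open>I\<close>.\<close>
  define k where "k = (LEAST k. k \<in> I \<and> c k \<noteq> c' k)"
  have k: "k \<in> I" "c k \<noteq> c' k" using LeastI_ex[of "\<lambda>k. k \<in> I \<and> c k \<noteq> c' k"] ne by (auto simp: k_def)
  have lt: "c i = c' i" if "i \<in> I" "i < k" for i
    using not_less_Least[of i "\<lambda>k. k \<in> I \<and> c k \<noteq> c' k"] that by (auto simp: k_def)
  define d where "d i = indicator I i * (c i - c' i)" for i
  have c01: "c i = 0 \<or> c i = 1" "c' i = 0 \<or> c' i = 1" for i using c by auto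
  have d1: "\<bar>d i\<bar> \<le> 1" for i using c01[of i] by (auto simp: d_def indicator_def)
  have d2: "i < k \<Longrightarrow> d i = 0" for i using lt[of i] by (auto simp: d_def indicator_def)
  have d3: "\<bar>d k\<bar> = 1" using k c01[of k] by (auto simp: d_def)
  define \<delta>' where "\<delta>' = \<delta> * exp (- a * real k)"
  have \<delta>': "\<delta>' > 0" using \<delta> by (simp add: \<delta>'_def)
  have diff: "masked_sum I y c - masked_sum I y c' = (\<Sum>i. d i * partial_product y i)"
    if "regular_steps y" for y
  proof -
    have b: "\<bar>indicator I i * c i\<bar> \<le> 1" "\<bar>indicator I i * c' i\<bar> \<le> 1" for i
      using c01[of i] by (auto simp: indicator_def)
    have "summable (\<lambda>i. indicator I i * c i * partial_product y i)"
         "summable (\<lambda>i. indicator I i * c' i * partial_product y i)"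
      by (rule summable_masked[OF that], rule b)+
    from suminf_diff[OF this] show ?thesis
      unfolding masked_sum_def d_def by (simp only: right_diff_distrib left_diff_distrib)
  qed
  have "(\<integral>\<^sup>+y. indicator {y. slow_decay a \<delta> y} y * indicator {-r..r} (masked_sum I y c - masked_sum I y c') \<partial>step_law \<theta>)
    \<le> (\<integral>\<^sup>+y. indicator {y. summable (\<lambda>i. d i * partial_product y i) \<and> \<delta>' \<le> partial_product y k \<and>
             \<bar>\<Sum>i. d i * partial_product y i\<bar> \<le> r} y \<partial>step_law \<theta>)"
  proof (rule nn_integral_mono)
    fix y
    show "indicator {y. slow_decay a \<delta> y} y * indicator {-r..r} (masked_sum I y c - masked_sum I y c')
      \<le> (indicator {y. summable (\<lambda>i. d i * partial_product y i) \<and> \<delta>' \<le> partial_product y k \<and>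
             \<bar>\<Sum>i. d i * partial_product y i\<bar> \<le> r} y :: ennreal)"
      using diff[of y] summable_masked[OF _ d1, of y]
      by (auto simp: slow_decay_def \<delta>'_def indicator_def)
  qed
  also have "\<dots> \<le> ennreal (small_ball_const \<theta> * (r / \<delta>') powr s)"
    by (rule small_difference_given_first_disagreement[where d=d, OF \<theta> r s \<delta>' _ d3]) (rule d2)
  also have "(r / \<delta>') powr s = (r / \<delta>) powr s * exp (a * s * real k)"
  proof -
    have "r / \<delta>' = (r / \<delta>) * exp (a * real k)" by (simp add: \<delta>'_def exp_minus field_simps)
    hence "(r / \<delta>') powr s = (r / \<delta>) powr s * exp (a * real k) powr s"
      using r \<delta> by (simp only: powr_mult)
    thus ?thesis by (simp add: exp_powr_real mult_ac)
  qed
  also have "ennreal (small_ball_const \<theta> * ((r / \<delta>) powr s * exp (a * s * real k)))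
      = (\<Sum>k\<in>{k}. ennreal (small_ball_const \<theta> * (r / \<delta>) powr s * exp (a * s * real k)) * 
            indicator {c'. \<forall>i\<in>I \<inter> {..<k}. c' i = c i} c')"
    using lt by (simp add: mult.assoc indicator_def)
  also have "\<dots> \<le> (\<Sum>k. ennreal (small_ball_const \<theta> * (r / \<delta>) powr s * exp (a * s * real k)) * 
            indicator {c'. \<forall>i\<in>I \<inter> {..<k}. c' i = c i} c')"
    by (rule sum_le_suminf) auto
  finally show ?thesis .
qed

lemma coin_cylinder_sets [measurable]: "{c'. \<forall>i\<in>F. c' i = c i} \<in> sets coin_law"
proof -
  have "Measurable.pred seq_borel (\<lambda>c'. \<forall>i. i \<in> F \<longrightarrow> c' i = c i)" by measurable
  thus ?thesis unfolding sets_coin_law by (simp add: pred_def space_PiM Ball_def)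
qed

text \<open>Summability of the agreement probabilities forces \<open>I\<close> to be infinite.\<close>

lemma AE_coins_disagree:
  assumes "0 \<le> a" and lim: "summable (\<lambda>k. (1/2) ^ card (I \<inter> {..<k}) * exp (a * real k))"
  shows "AE c' in coin_law. \<exists>i\<in>I. c i \<noteq> c' i"
proof -
  have le: "emeasure coin_law {c'. \<forall>i\<in>I. c' i = c i} \<le> ennreal ((1/2) ^ card (I \<inter> {..<k}) * exp (a * real k))" for k
  proof -
    have "emeasure coin_law {c'. \<forall>i\<in>I. c' i = c i} \<le> emeasure coin_law {c'. \<forall>i\<in>I \<inter> {..<k}. c' i = c i}"
      by (intro emeasure_mono coin_cylinder_sets) auto
    also have "\<dots> \<le> ennreal ((1/2) ^ card (I \<inter> {..<k}))"
      by (rule emeasure_coin_law_cylinder_le) simp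
    also have "\<dots> \<le> ennreal ((1/2) ^ card (I \<inter> {..<k}) * exp (a * real k))"
      using assms by (intro ennreal_leI) simp
    finally show ?thesis .
  qed
  have "(\<lambda>k. ennreal ((1/2) ^ card (I \<inter> {..<k}) * exp (a * real k))) \<longlonglongrightarrow> ennreal 0"
    by (intro tendsto_ennrealI summable_LIMSEQ_zero lim)
  hence "emeasure coin_law {c'. \<forall>i\<in>I. c' i = c i} \<le> ennreal 0"
    by (rule LIMSEQ_le_const) (use le in auto)
  hence "{c'. \<forall>i\<in>I. c' i = c i} \<in> null_sets coin_law"
    by (auto simp: null_sets_def coin_cylinder_sets)
  thus ?thesis by (rule AE_I') auto
qed

text \<open>The averaged transversality estimate. Tonelli's theorem moves the integral over the steps inside, where the
  coins are fixed; then the probability that two coin sequences agree on \<open>I\<close> up to \<open>k\<close> competes with the growth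
  \<open>exp (a * s * k)\<close> of \<open>X\<^sub>k powr (- s)\<close>.\<close>

proposition averaged_near_diagonal_mass:
  assumes \<theta>: "\<theta> > 0" and s: "0 \<le> s" "s \<le> 1" and \<delta>: "\<delta> > 0" and a: "a \<ge> 0"
    and sm: "summable (\<lambda>k. (1/2) ^ card (I \<inter> {..<k}) * exp (a * s * real k))"
  shows "\<exists>C\<ge>0. \<forall>r>0. (\<integral>\<^sup>+y. indicator {y. slow_decay a \<delta> y} y * pair_energy (indicator {-r..r}) (masked_law I y) \<partial>step_law \<theta>)
        \<le> ennreal (C * r powr s)"
proof -
  interpret P: prob_space "step_law \<theta>" by (rule prob_space_step_law)
  interpret Q: prob_space coin_law by (rule prob_space_coin_law)
  interpret PQ: pair_sigma_finite coin_law "step_law \<theta>" ..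
  define \<Sigma> where "\<Sigma> = (\<Sum>k. (1/2) ^ card (I \<inter> {..<k}) * exp (a * s * real k))"
  have "\<Sigma> \<ge> 0" unfolding \<Sigma>_def by (intro suminf_nonneg sm) simp
  define C where "C = small_ball_const \<theta> * \<Sigma> / \<delta> powr s"
  have "C \<ge> 0" using \<open>\<Sigma> \<ge> 0\<close> \<theta> by (simp add: C_def small_ball_const_def)
  moreover have "(\<integral>\<^sup>+y. indicator {y. slow_decay a \<delta> y} y * pair_energy (indicator {-r..r}) (masked_law I y) \<partial>step_law \<theta>)
        \<le> ennreal (C * r powr s)" if r: "r > 0" for r
  proof -
    let ?G = "{y. slow_decay a \<delta> y}"
    let ?f = "\<lambda>y c c'. indicator ?G y * indicator {-r..r} (masked_sum I y c - masked_sum I y c') :: ennreal"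
    let ?K = "small_ball_const \<theta> * (r / \<delta>) powr s"
    have "(\<integral>\<^sup>+y. indicator ?G y * pair_energy (indicator {-r..r}) (masked_law I y) \<partial>step_law \<theta>)
      = (\<integral>\<^sup>+y. (\<integral>\<^sup>+c. (\<integral>\<^sup>+c'. ?f y c c' \<partial>coin_law) \<partial>coin_law) \<partial>step_law \<theta>)"
      by (simp add: pair_energy_masked_law nn_integral_cmult)
    also have "\<dots> = (\<integral>\<^sup>+c. (\<integral>\<^sup>+y. (\<integral>\<^sup>+c'. ?f y c c' \<partial>coin_law) \<partial>step_law \<theta>) \<partial>coin_law)"
      by (rule PQ.Fubini') measurable
    also have "\<dots> = (\<integral>\<^sup>+c. (\<integral>\<^sup>+c'. (\<integral>\<^sup>+y. ?f y c c' \<partial>step_law \<theta>) \<partial>coin_law) \<partial>coin_law)"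
    proof (intro nn_integral_cong PQ.Fubini')
      fix c :: "nat \<Rightarrow> real"
      have [measurable]: "(\<lambda>z. masked_sum I (snd z) c) \<in> borel_measurable (coin_law \<Otimes>\<^sub>M step_law \<theta>)"
        unfolding masked_sum_def by measurable
      have [measurable]: "(\<lambda>z. masked_sum I (snd z) (fst z)) \<in> borel_measurable (coin_law \<Otimes>\<^sub>M step_law \<theta>)"
        unfolding masked_sum_def by measurable
      show "(\<lambda>(c', y). ?f y c c') \<in> borel_measurable (coin_law \<Otimes>\<^sub>M step_law \<theta>)"
        unfolding split_beta' by measurable
    qed
    also have "\<dots> \<le> (\<integral>\<^sup>+c. ennreal (C * r powr s) \<partial>coin_law)"
    proof (rule nn_integral_mono_AE, rule AE_mp[OF AE_coin_law], rule AE_I2, rule impI)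
      fix c :: "nat \<Rightarrow> real" assume c: "\<forall>i. c i \<in> {0, 1}"
      let ?A = "\<lambda>k. {c'. \<forall>i\<in>I \<inter> {..<k}. c' i = c i}"
      have "AE c' in coin_law. \<exists>i\<in>I. c i \<noteq> c' i"
        using sm a s by (intro AE_coins_disagree[of "a * s"]) auto
      with AE_coin_law have "AE c' in coin_law. (\<integral>\<^sup>+y. ?f y c c' \<partial>step_law \<theta>)
          \<le> (\<Sum>k. ennreal (?K * exp (a * s * real k)) * indicator (?A k) c')"
        by eventually_elim (rule near_collision_given_coins[OF \<theta> r s \<delta>], use c in auto)
      hence "(\<integral>\<^sup>+c'. (\<integral>\<^sup>+y. ?f y c c' \<partial>step_law \<theta>) \<partial>coin_law)
        \<le> (\<integral>\<^sup>+c'. (\<Sum>k. ennreal (?K * exp (a * s * real k)) * indicator (?A k) c') \<partial>coin_law)"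
        by (rule nn_integral_mono_AE)
      also have "\<dots> = (\<Sum>k. ennreal (?K * exp (a * s * real k)) * emeasure coin_law (?A k))"
        by (subst nn_integral_suminf) (auto simp: nn_integral_cmult)
      also have "\<dots> \<le> (\<Sum>k. ennreal (?K * ((1/2) ^ card (I \<inter> {..<k}) * exp (a * s * real k))))"
      proof (rule suminf_le)
        fix k
        have "ennreal (?K * exp (a * s * real k)) * emeasure coin_law (?A k)
           \<le> ennreal (?K * exp (a * s * real k)) * ennreal ((1/2) ^ card (I \<inter> {..<k}))"
          by (intro mult_left_mono emeasure_coin_law_cylinder_le) auto
        thus "ennreal (?K * exp (a * s * real k)) * emeasure coin_law (?A k)
          \<le> ennreal (?K * ((1/2) ^ card (I \<inter> {..<k}) * exp (a * s * real k)))"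
          using \<theta> by (simp add: ennreal_mult[symmetric] small_ball_const_def mult_ac)
      qed auto
      also have "\<dots> = ennreal (\<Sum>k. ?K * ((1/2) ^ card (I \<inter> {..<k}) * exp (a * s * real k)))"
        using \<theta> sm by (intro suminf_ennreal2 summable_mult) (auto simp: small_ball_const_def)
      also have "(\<Sum>k. ?K * ((1/2) ^ card (I \<inter> {..<k}) * exp (a * s * real k))) = C * r powr s"
        unfolding C_def \<Sigma>_def using sm r \<delta> by (subst suminf_mult) (auto simp: powr_divide)
      finally show "(\<integral>\<^sup>+c'. (\<integral>\<^sup>+y. ?f y c c' \<partial>step_law \<theta>) \<partial>coin_law) \<le> ennreal (C * r powr s)" .
    qed
    also have "\<dots> = ennreal (C * r powr s)" using Q.emeasure_space_1 by simp
    finally show ?thesis .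
  qed
  ultimately show ?thesis by blast
qed

lemma AE_slow_decayI:
  assumes \<theta>: "\<theta> > 0" and a: "a > 1 / \<theta>"
    and "\<And>\<delta>. \<delta> > 0 \<Longrightarrow> AE y in step_law \<theta>. slow_decay a \<delta> y \<longrightarrow> Q y"
  shows "AE y in step_law \<theta>. Q y"
proof -
  have "AE y in step_law \<theta>. \<forall>m. slow_decay a (inverse (real (Suc m))) y \<longrightarrow> Q y"
    unfolding AE_all_countable using assms(3) by simp
  thus ?thesis using AE_partial_product_lower[OF \<theta> a] AE_regular_steps[OF \<theta>]
  proof eventually_elim
    case (elim y)
    then obtain \<delta> where \<delta>: "\<delta> > 0" "\<And>n. \<delta> * exp (- a * real n) \<le> partial_product y n" by auto
    obtain m where m: "inverse (real (Suc m)) < \<delta>" using reals_Archimedean[OF \<delta>(1)] by auto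
    have "slow_decay a (inverse (real (Suc m))) y"
      unfolding slow_decay_def
    proof (intro conjI allI elim)
      fix n
      show "inverse (real (Suc m)) * exp (- a * real n) \<le> partial_product y n"
        using m by (intro order_trans[OF mult_right_mono \<delta>(2)]) auto
    qed
    thus ?case using elim(1) by blast
  qed
qed

lemma AE_of_finite_integral_on_slow_decay:
  assumes [measurable]: "F \<in> borel_measurable seq_borel"
    and "(\<integral>\<^sup>+y. indicator {y. slow_decay a \<delta> y} y * F y \<partial>step_law \<theta>) < \<infinity>"
  shows "AE y in step_law \<theta>. slow_decay a \<delta> y \<longrightarrow> F y < \<infinity>"
proof -
  have "AE y in step_law \<theta>. indicator {y. slow_decay a \<delta> y} y * F y \<noteq> \<infinity>"
    using assms(2) by (intro nn_integral_PInf_AE) auto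
  thus ?thesis by eventually_elim (auto simp: less_top)
qed

definition gaussian_kernel :: "real \<Rightarrow> real \<Rightarrow> ennreal" where
  "gaussian_kernel \<epsilon> u = ennreal (exp (- (u / \<epsilon>)\<^sup>2 / 2) / \<epsilon>)"

lemma gaussian_kernel_measurable [measurable]: "gaussian_kernel \<epsilon> \<in> borel_measurable borel"
  unfolding gaussian_kernel_def by measurable

text \<open>The function \<open>exp (- v\<^sup>2 / 2)\<close> is at most \<open>exp (1/2 - \<bar>v\<bar>)\<close>, so the kernel is at most a series of boxes of
  radius \<open>Suc m\<close> times \<open>\<epsilon>\<close> with geometric weights. Bounds for boxes, linear in the radius, pass to the kernel.\<close>

lemma gaussian_kernel_le_boxes:
  assumes "\<epsilon> > 0"
  shows "gaussian_kernel \<epsilon> u \<le> (\<Sum>m. ennreal (2 * exp (- real m) / \<epsilon>) * indicator {- (real (Suc m) * \<epsilon>)..real (Suc m) * \<epsilon>} u)"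
proof -
  define v where "v = \<bar>u\<bar> / \<epsilon>"
  define m where "m = nat \<lfloor>v\<rfloor>"
  have v: "v \<ge> 0" using assms by (simp add: v_def)
  have m: "real m \<le> v" "v \<le> real (Suc m)" using v unfolding m_def by linarith+
  have "- (u / \<epsilon>)\<^sup>2 / 2 = - v\<^sup>2 / 2" using assms by (simp add: v_def power_divide)
  also have "\<dots> \<le> 1/2 - v" using zero_le_power2[of "v - 1"] by (simp add: power2_eq_square algebra_simps)
  also have "\<dots> \<le> 1/2 - real m" using m by simp
  finally have "exp (- (u / \<epsilon>)\<^sup>2 / 2) \<le> exp (1/2) * exp (- real m)" by (simp add: exp_add[symmetric])
  also have "\<dots> \<le> 2 * exp (- real m)" using exp_half_le2 by (intro mult_right_mono) auto
  finally have "gaussian_kernel \<epsilon> u \<le> ennreal (2 * exp (- real m) / \<epsilon>)"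
    unfolding gaussian_kernel_def using assms by (intro ennreal_leI divide_right_mono) auto
  also have "\<bar>u\<bar> \<le> real (Suc m) * \<epsilon>" using m(2) assms by (simp add: v_def field_simps)
  hence "ennreal (2 * exp (- real m) / \<epsilon>) = (\<Sum>m\<in>{m}. ennreal (2 * exp (- real m) / \<epsilon>) * indicator {- (real (Suc m) * \<epsilon>)..real (Suc m) * \<epsilon>} u)"
    by (auto simp: indicator_def abs_le_iff)
  also have "\<dots> \<le> (\<Sum>m. ennreal (2 * exp (- real m) / \<epsilon>) * indicator {- (real (Suc m) * \<epsilon>)..real (Suc m) * \<epsilon>} u)"
    by (rule sum_le_suminf) auto
  finally show ?thesis .
qed

lemma pair_energy_mono:
  assumes "\<And>u. g u \<le> h u" shows "pair_energy g \<mu> \<le> pair_energy h \<mu>"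
  unfolding pair_energy_def by (intro nn_integral_mono assms)

lemma pair_energy_suminf:
  assumes [measurable]: "\<And>n. g n \<in> borel_measurable borel"
  shows "pair_energy (\<lambda>u. \<Sum>n. ennreal (w n) * g n u) (masked_law I y)
     = (\<Sum>n. ennreal (w n) * pair_energy (g n) (masked_law I y))"
proof -
  interpret prob_space "masked_law I y" by (rule prob_space_masked_law)
  show ?thesis unfolding pair_energy_def
    by (simp add: nn_integral_suminf nn_integral_cmult)
qed

abbreviation (input) finite_energy :: "real measure \<Rightarrow> bool" where
  "finite_energy \<mu> \<equiv> liminf (\<lambda>n. pair_energy (gaussian_kernel ((1/2) ^ n)) \<mu>) < \<infinity>"

text \<open>The averaged estimate with \<open>s = 1\<close> bounds the mean of the Gaussian energy uniformly in the
  bandwidth; Fatou's lemma then makes the lower limit finite for almost every sequence of steps.\<close>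

proposition AE_finite_energy:
  assumes \<theta>: "\<theta> > 0" and a: "a > 1 / \<theta>"
    and sm: "summable (\<lambda>k. (1/2) ^ card (I \<inter> {..<k}) * exp (a * real k))"
  shows "AE y in step_law \<theta>. finite_energy (masked_law I y)"
proof (rule AE_slow_decayI[OF \<theta> a], rule AE_of_finite_integral_on_slow_decay)
  fix \<delta> :: real assume \<delta>: "\<delta> > 0"
  interpret P: prob_space "step_law \<theta>" by (rule prob_space_step_law)
  have "0 < 1 / \<theta>" using \<theta> by simp
  hence a0: "a \<ge> 0" using a by linarith
  let ?G = "{y. slow_decay a \<delta> y}"
  obtain C where C: "C \<ge> 0" "\<And>r. r > 0 \<Longrightarrow> (\<integral>\<^sup>+y. indicator ?G y * pair_energy (indicator {-r..r}) (masked_law I y) \<partial>step_law \<theta>)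
        \<le> ennreal (C * r)"
    using averaged_near_diagonal_mass[OF \<theta> _ _ \<delta> a0, of 1 I] sm by auto
  have sm2: "summable (\<lambda>m. 2 * C * (real (Suc m) * exp (- real m)))"
  proof -
    have "summable (\<lambda>m. 2 * exp (-(1/2)) ^ m :: real)"
      by (intro summable_mult summable_geometric) simp
    moreover have "real (Suc m) * exp (- real m) \<le> 2 * exp (-(1/2)) ^ m" for m
    proof -
      have "real (Suc m) \<le> 2 * exp (real m / 2)"
        using exp_ge_add_one_self[of "real m / 2"] of_nat_Suc[of m, where ?'a=real] by linarith
      hence "real (Suc m) * exp (- real m) \<le> 2 * exp (real m / 2) * exp (- real m)"
        by (rule mult_right_mono) simp
      also have "\<dots> = 2 * exp (-(1/2)) ^ m"
        by (simp add: exp_of_nat_mult[symmetric] mult.assoc exp_add[symmetric])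
      finally show ?thesis .
    qed
    ultimately have "summable (\<lambda>m. real (Suc m) * exp (- real m))"
      by - (rule summable_comparison_test'[where N=0 and g="\<lambda>m. 2 * exp (-(1/2)) ^ m"], auto)
    thus ?thesis by (rule summable_mult)
  qed
  have bound: "(\<integral>\<^sup>+y. indicator ?G y * pair_energy (gaussian_kernel \<epsilon>) (masked_law I y) \<partial>step_law \<theta>)
      \<le> ennreal (\<Sum>m. 2 * C * (real (Suc m) * exp (- real m)))" if \<epsilon>: "\<epsilon> > 0" for \<epsilon> :: real
  proof -
    let ?B = "\<lambda>m. indicator {- (real (Suc m) * \<epsilon>)..real (Suc m) * \<epsilon>} :: real \<Rightarrow> ennreal"
    have "pair_energy (gaussian_kernel \<epsilon>) (masked_law I y)
        \<le> pair_energy (\<lambda>u. \<Sum>m. ennreal (2 * exp (- real m) / \<epsilon>) * ?B m u) (masked_law I y)" for y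
      by (intro pair_energy_mono gaussian_kernel_le_boxes \<epsilon>)
    also have "pair_energy (\<lambda>u. \<Sum>m. ennreal (2 * exp (- real m) / \<epsilon>) * ?B m u) (masked_law I y)
       = (\<Sum>m. ennreal (2 * exp (- real m) / \<epsilon>) * pair_energy (?B m) (masked_law I y))" for y
      by (rule pair_energy_suminf) simp
    finally have "(\<integral>\<^sup>+y. indicator ?G y * pair_energy (gaussian_kernel \<epsilon>) (masked_law I y) \<partial>step_law \<theta>)
      \<le> (\<integral>\<^sup>+y. indicator ?G y * (\<Sum>m. ennreal (2 * exp (- real m) / \<epsilon>) * pair_energy (?B m) (masked_law I y)) \<partial>step_law \<theta>)"
      by (intro nn_integral_mono mult_left_mono) auto
    also have "\<dots> = (\<integral>\<^sup>+y. (\<Sum>m. ennreal (2 * exp (- real m) / \<epsilon>) * (indicator ?G y * pair_energy (?B m) (masked_law I y))) \<partial>step_law \<theta>)"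
      by (intro nn_integral_cong) (subst ennreal_suminf_cmult[symmetric], simp only: mult.left_commute)
    also have "\<dots> = (\<Sum>m. ennreal (2 * exp (- real m) / \<epsilon>) * (\<integral>\<^sup>+y. indicator ?G y * pair_energy (?B m) (masked_law I y) \<partial>step_law \<theta>))"
      by (subst nn_integral_suminf) (auto simp: nn_integral_cmult)
    also have "\<dots> \<le> (\<Sum>m. ennreal (2 * C * (real (Suc m) * exp (- real m))))"
    proof (rule suminf_le)
      fix m
      have "ennreal (2 * exp (- real m) / \<epsilon>) * (\<integral>\<^sup>+y. indicator ?G y * pair_energy (?B m) (masked_law I y) \<partial>step_law \<theta>)
        \<le> ennreal (2 * exp (- real m) / \<epsilon>) * ennreal (C * (real (Suc m) * \<epsilon>))"
        using \<epsilon> by (intro mult_left_mono C) auto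
      also have "\<dots> = ennreal (2 * C * (real (Suc m) * exp (- real m)))"
      proof -
        have "2 * C * (real (Suc m) * exp (- real m)) = (2 * exp (- real m) / \<epsilon>) * (C * (real (Suc m) * \<epsilon>))"
          using \<epsilon> by (simp add: field_simps)
        thus ?thesis using \<epsilon> C(1) by (simp only:) (rule ennreal_mult[symmetric], auto)
      qed
      finally show "ennreal (2 * exp (- real m) / \<epsilon>) * (\<integral>\<^sup>+y. indicator ?G y * pair_energy (?B m) (masked_law I y) \<partial>step_law \<theta>)
        \<le> ennreal (2 * C * (real (Suc m) * exp (- real m)))" .
    qed auto
    also have "\<dots> = ennreal (\<Sum>m. 2 * C * (real (Suc m) * exp (- real m)))"
      using sm2 C(1) by (intro suminf_ennreal2) auto
    finally show ?thesis .
  qed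
  show [measurable]: "(\<lambda>y. liminf (\<lambda>n. pair_energy (gaussian_kernel ((1/2) ^ n)) (masked_law I y)))
      \<in> borel_measurable seq_borel"
    by measurable
  have "(\<integral>\<^sup>+y. indicator ?G y * liminf (\<lambda>n. pair_energy (gaussian_kernel ((1/2) ^ n)) (masked_law I y)) \<partial>step_law \<theta>)
     \<le> (\<integral>\<^sup>+y. liminf (\<lambda>n. indicator ?G y * pair_energy (gaussian_kernel ((1/2) ^ n)) (masked_law I y)) \<partial>step_law \<theta>)"
    by (intro nn_integral_mono) (auto simp: indicator_def)
  also have "\<dots> \<le> liminf (\<lambda>n. (\<integral>\<^sup>+y. indicator ?G y * pair_energy (gaussian_kernel ((1/2) ^ n)) (masked_law I y) \<partial>step_law \<theta>))"
    by (rule nn_integral_liminf) measurable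
  also have "\<dots> \<le> liminf (\<lambda>n. ennreal (\<Sum>m. 2 * C * (real (Suc m) * exp (- real m))))"
    by (intro Liminf_mono always_eventually allI bound) simp
  also have "\<dots> < \<infinity>" by (simp add: Liminf_const)
  finally show "(\<integral>\<^sup>+y. indicator ?G y * liminf (\<lambda>n. pair_energy (gaussian_kernel ((1/2) ^ n)) (masked_law I y)) \<partial>step_law \<theta>) < \<infinity>" .
qed

abbreviation (input) dyadic_box :: "nat \<Rightarrow> real \<Rightarrow> ennreal" where
  "dyadic_box n \<equiv> indicator {- ((1/2) ^ n)..(1/2) ^ n}"

lemma half_power_powr: "((1/2) ^ n) powr t = 2 powr (- t * real n)" for t :: real
proof -
  have "(1/2) ^ n = 2 powr (- real n)"
    by (simp add: powr_minus powr_realpow power_one_over inverse_eq_divide)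
  thus ?thesis by (simp only: powr_powr) (simp add: mult.commute)
qed

text \<open>An exponent \<open>s'\<close> strictly between \<open>s\<close> and \<open>min 1 (\<theta> * ln 2)\<close> leaves a geometric factor
  \<open>2 powr (s - s')\<close> in the averaged estimate, which makes the series over dyadic radii converge.\<close>

proposition AE_summable_near_diagonal_mass:
  assumes \<theta>: "\<theta> > 0" and s: "0 \<le> s" "s < 1" "s < \<theta> * ln 2"
  shows "AE y in step_law \<theta>. (\<Sum>n. ennreal (2 powr (s * real n)) * 
            pair_energy (dyadic_box n) (masked_law UNIV y)) < \<infinity>"
proof -
  \<comment> \<open>Strictly between \<open>s\<close> and the largest exponent for which the averaged estimate is available.\<close>
  define s' where "s' = (s + min 1 (\<theta> * ln 2)) / 2"
  have s': "s < s'" "s' \<le> 1" "s' < \<theta> * ln 2" "0 \<le> s'" using s by (auto simp: s'_def min_def)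
  define a where "a = (1 / \<theta> + ln 2 / s') / 2"
  have "1 / \<theta> < ln 2 / s'" using s' s \<theta> by (simp add: field_simps)
  hence a: "1 / \<theta> < a" "a < ln 2 / s'"
    unfolding a_def by (rule less_half_sum[unfolded one_add_one], rule gt_half_sum[unfolded one_add_one])
  have as: "a * s' < ln 2" using a s' s by (simp add: field_simps)
  have "0 < 1 / \<theta>" using \<theta> by simp
  hence a0: "a \<ge> 0" using a by linarith
  have sm: "summable (\<lambda>k. (1/2) ^ card (UNIV \<inter> {..<k}) * exp (a * s' * real k))"
  proof -
    have "summable (\<lambda>k. (exp (a * s') / 2) ^ k)"
      using as exp_less_mono[OF as] by (intro summable_geometric) (auto simp: exp_ln)
    moreover have "(exp (a * s') / 2) ^ k = (1/2) ^ card (UNIV \<inter> {..<k}) * exp (a * s' * real k)" for k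
      by (simp add: power_divide exp_of_nat_mult[symmetric] mult_ac)
    ultimately show ?thesis by (simp only:)
  qed
  show ?thesis
  proof (rule AE_slow_decayI[OF \<theta> a(1)], rule AE_of_finite_integral_on_slow_decay)
    fix \<delta> :: real assume \<delta>: "\<delta> > 0"
    let ?G = "{y. slow_decay a \<delta> y}"
    let ?E = "\<lambda>n y. pair_energy (dyadic_box n) (masked_law UNIV y)"
    show "(\<lambda>y. \<Sum>n. ennreal (2 powr (s * real n)) * ?E n y) \<in> borel_measurable seq_borel"
      by measurable
    obtain C where C: "C \<ge> 0" "\<And>r. r > 0 \<Longrightarrow> (\<integral>\<^sup>+y. indicator ?G y * pair_energy (indicator {-r..r}) (masked_law UNIV y) \<partial>step_law \<theta>)
        \<le> ennreal (C * r powr s')"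
      using averaged_near_diagonal_mass[OF \<theta> s'(4,2) \<delta> a0 sm] by auto
    have "(\<integral>\<^sup>+y. indicator ?G y * (\<Sum>n. ennreal (2 powr (s * real n)) * ?E n y) \<partial>step_law \<theta>)
        = (\<integral>\<^sup>+y. (\<Sum>n. ennreal (2 powr (s * real n)) * (indicator ?G y * ?E n y)) \<partial>step_law \<theta>)"
      by (intro nn_integral_cong) (subst ennreal_suminf_cmult[symmetric], simp only: mult.left_commute)
    also have "\<dots> = (\<Sum>n. ennreal (2 powr (s * real n)) * (\<integral>\<^sup>+y. indicator ?G y * ?E n y \<partial>step_law \<theta>))"
      by (subst nn_integral_suminf) (auto simp: nn_integral_cmult)
    also have "\<dots> \<le> (\<Sum>n. ennreal (C * (2 powr (s - s')) ^ n))"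
    proof (rule suminf_le)
      fix n
      have "ennreal (2 powr (s * real n)) * (\<integral>\<^sup>+y. indicator ?G y * ?E n y \<partial>step_law \<theta>)
         \<le> ennreal (2 powr (s * real n)) * ennreal (C * ((1/2) ^ n) powr s')"
        by (intro mult_left_mono C) auto
      also have "\<dots> = ennreal (C * (2 powr (s - s')) ^ n)"
      proof -
        have "2 powr (s * real n) * ((1/2) ^ n) powr s' = (2 powr (s - s')) ^ n"
        proof -
          have "2 powr (s * real n) * ((1/2) ^ n) powr s' = 2 powr ((s - s') * real n)"
            by (simp add: half_power_powr powr_add[symmetric] algebra_simps)
          also have "\<dots> = (2 powr (s - s')) ^ n"
            by (simp add: powr_powr[symmetric] powr_realpow)
          finally show ?thesis .
        qed
        thus ?thesis using C by (subst ennreal_mult[symmetric]) (auto simp: mult_ac)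
      qed
      finally show "ennreal (2 powr (s * real n)) * (\<integral>\<^sup>+y. indicator ?G y * ?E n y \<partial>step_law \<theta>)
         \<le> ennreal (C * (2 powr (s - s')) ^ n)" .
    qed auto
    also have "\<dots> < \<infinity>"
    proof -
      have "2 powr (s - s') < 2 powr 0" using s' by (intro powr_less_mono) auto
      hence "summable (\<lambda>n. C * (2 powr (s - s')) ^ n)"
        by (intro summable_mult summable_geometric) auto
      thus ?thesis using C by (subst suminf_ennreal2) auto
    qed
    finally show "(\<integral>\<^sup>+y. indicator ?G y * (\<Sum>n. ennreal (2 powr (s * real n)) * ?E n y) \<partial>step_law \<theta>) < \<infinity>" .
  qed
qed


section \<open>Densities of measures of finite energy\<close>

lemma box_le_gaussian_kernel:
  assumes "r > 0"
  shows "indicator {-r..r} u \<le> ennreal (2 * r) * gaussian_kernel r u"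
proof (cases "u \<in> {-r..r}")
  case True
  hence "\<bar>u / r\<bar> \<le> 1" using assms by (simp add: abs_le_iff field_simps)
  hence "(u / r)\<^sup>2 \<le> 1" using abs_square_le_1 by blast
  hence "1/2 \<le> exp (- (u / r)\<^sup>2 / 2)"
    using exp_ge_add_one_self[of "- (u / r)\<^sup>2 / 2"] by linarith
  hence "1 \<le> 2 * r * (exp (- (u / r)\<^sup>2 / 2) / r)" using assms by simp
  hence "ennreal 1 \<le> ennreal (2 * r * (exp (- (u / r)\<^sup>2 / 2) / r))" by (rule ennreal_leI)
  thus ?thesis using True assms by (simp only: gaussian_kernel_def) (subst ennreal_mult[symmetric], auto)
qed simp

lemma pair_energy_cmult:
  assumes [measurable_cong, simp]: "sets \<mu> = sets borel" and "prob_space \<mu>"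
    and [measurable]: "g \<in> borel_measurable borel"
  shows "pair_energy (\<lambda>u. c * g u) \<mu> = c * pair_energy g \<mu>"
proof -
  interpret prob_space \<mu> by fact
  show ?thesis unfolding pair_energy_def by (simp add: nn_integral_cmult)
qed

lemma pair_energy_box_le_gaussian:
  assumes "sets \<mu> = sets borel" "prob_space \<mu>" "r > 0"
  shows "pair_energy (indicator {-r..r}) \<mu> \<le> ennreal (2 * r) * pair_energy (gaussian_kernel r) \<mu>"
proof -
  have "pair_energy (indicator {-r..r}) \<mu> \<le> pair_energy (\<lambda>u. ennreal (2 * r) * gaussian_kernel r u) \<mu>"
    by (intro pair_energy_mono box_le_gaussian_kernel assms)
  thus ?thesis using assms by (simp add: pair_energy_cmult)
qed

lemma emeasure_window_eq:
  assumes "sets \<mu> = sets borel"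
  shows "emeasure \<mu> {x..x + r :: real} = (\<integral>\<^sup>+u. indicator {u - r..u} x \<partial>\<mu>)"
proof -
  have "emeasure \<mu> {x..x + r} = (\<integral>\<^sup>+u. indicator {x..x + r} u \<partial>\<mu>)"
    using assms by (intro nn_integral_indicator[symmetric]) simp
  also have "\<dots> = (\<integral>\<^sup>+u. indicator {u - r..u} x \<partial>\<mu>)"
    by (intro nn_integral_cong) (auto simp: indicator_def)
  finally show ?thesis .
qed

lemma window_indicator_measurable [measurable (raw)]:
  fixes r :: real
  assumes [measurable]: "f \<in> borel_measurable N" "g \<in> borel_measurable N"
  shows "(\<lambda>z. indicator {g z - r..g z} (f z) :: ennreal) \<in> borel_measurable N"
proof -
  have "(\<lambda>z. indicator {(x, u). u - r \<le> x \<and> x \<le> u} (f z, g z) :: ennreal) \<in> borel_measurable N"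
    by measurable
  thus ?thesis by (simp add: indicator_def)
qed

lemma emeasure_window_measurable:
  assumes "sets \<mu> = sets borel" "prob_space \<mu>"
  shows "(\<lambda>x. emeasure \<mu> {x..x + r :: real}) \<in> borel_measurable borel"
proof -
  interpret prob_space \<mu> by fact
  note assms(1)[measurable_cong]
  show ?thesis unfolding emeasure_window_eq[OF assms(1)] by measurable
qed

text \<open>For two points \<open>u\<close> and \<open>v\<close>, the starting points of windows of length \<open>r\<close> that contain both have measure at most
  \<open>r\<close>, and there are none unless \<open>\<bar>u - v\<bar> \<le> r\<close>.\<close>

lemma nn_integral_window_square_le:
  fixes \<mu> :: "real measure"
  assumes S: "sets \<mu> = sets borel" and "prob_space \<mu>" and r: "r > 0"
  shows "(\<integral>\<^sup>+x. (emeasure \<mu> {x..x + r}) ^ 2 \<partial>lborel) \<le> ennreal r * pair_energy (indicator {-r..r}) \<mu>"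
proof -
  interpret prob_space \<mu> by fact
  note S[measurable_cong]
  interpret PL: pair_sigma_finite \<mu> lborel ..
  let ?h = "\<lambda>x u. indicator {u - r..u} x :: ennreal"
  have "(emeasure \<mu> {x..x + r}) ^ 2 = (\<integral>\<^sup>+u. (\<integral>\<^sup>+v. ?h x u * ?h x v \<partial>\<mu>) \<partial>\<mu>)" for x
    by (simp add: power2_eq_square emeasure_window_eq[OF S] nn_integral_cmult nn_integral_multc)
  hence "(\<integral>\<^sup>+x. (emeasure \<mu> {x..x + r}) ^ 2 \<partial>lborel) = (\<integral>\<^sup>+x. (\<integral>\<^sup>+u. (\<integral>\<^sup>+v. ?h x u * ?h x v \<partial>\<mu>) \<partial>\<mu>) \<partial>lborel)"
    by simp
  also have "\<dots> = (\<integral>\<^sup>+u. (\<integral>\<^sup>+x. (\<integral>\<^sup>+v. ?h x u * ?h x v \<partial>\<mu>) \<partial>lborel) \<partial>\<mu>)"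
    by (rule PL.Fubini') measurable
  also have "\<dots> = (\<integral>\<^sup>+u. (\<integral>\<^sup>+v. (\<integral>\<^sup>+x. ?h x u * ?h x v \<partial>lborel) \<partial>\<mu>) \<partial>\<mu>)"
    by (intro nn_integral_cong PL.Fubini') measurable
  also have "\<dots> \<le> (\<integral>\<^sup>+u. (\<integral>\<^sup>+v. ennreal r * indicator {-r..r} (u - v) \<partial>\<mu>) \<partial>\<mu>)"
  proof (intro nn_integral_mono)
    fix u v :: real
    have "(\<integral>\<^sup>+x. ?h x u * ?h x v \<partial>lborel) \<le> (\<integral>\<^sup>+x. indicator {-r..r} (u - v) * indicator {u - r..u} x \<partial>lborel)"
      by (intro nn_integral_mono) (auto simp: indicator_def)
    also have "\<dots> = ennreal r * indicator {-r..r} (u - v)"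
      using r by (subst nn_integral_cmult) (auto simp: mult.commute)
    finally show "(\<integral>\<^sup>+x. ?h x u * ?h x v \<partial>lborel) \<le> ennreal r * indicator {-r..r} (u - v)" .
  qed
  also have "\<dots> = ennreal r * pair_energy (indicator {-r..r}) \<mu>"
    unfolding pair_energy_def by (simp add: nn_integral_cmult)
  finally show ?thesis .
qed

lemma nn_integral_window_average_square_le:
  fixes \<mu> :: "real measure"
  assumes S: "sets \<mu> = sets borel" and "prob_space \<mu>" and r: "r > 0"
  shows "(\<integral>\<^sup>+x. ennreal ((measure \<mu> {x..x + r} / r)\<^sup>2) \<partial>lborel) \<le> ennreal 2 * pair_energy (gaussian_kernel r) \<mu>"
proof -
  interpret prob_space \<mu> by fact
  have "(\<integral>\<^sup>+x. ennreal ((measure \<mu> {x..x + r} / r)\<^sup>2) \<partial>lborel)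
      = (\<integral>\<^sup>+x. ennreal (1 / r\<^sup>2) * (emeasure \<mu> {x..x + r}) ^ 2 \<partial>lborel)"
    by (intro nn_integral_cong)
       (simp add: emeasure_eq_measure ennreal_power ennreal_mult[symmetric] power_divide)
  also have "\<dots> = ennreal (1 / r\<^sup>2) * (\<integral>\<^sup>+x. (emeasure \<mu> {x..x + r}) ^ 2 \<partial>lborel)"
  proof -
    note emeasure_window_measurable[OF assms(1,2), of r, measurable]
    show ?thesis by (intro nn_integral_cmult) measurable
  qed
  also have "\<dots> \<le> ennreal (1 / r\<^sup>2) * (ennreal r * (ennreal (2 * r) * pair_energy (gaussian_kernel r) \<mu>))"
    by (intro mult_left_mono order_trans[OF nn_integral_window_square_le[OF assms]] pair_energy_box_le_gaussian assms) auto
  also have "\<dots> = ennreal 2 * pair_energy (gaussian_kernel r) \<mu>"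
    using r by (simp add: mult.assoc[symmetric] ennreal_mult[symmetric] power2_eq_square del: ennreal_numeral)
  finally show ?thesis .
qed

text \<open>The mass of the part of \<open>U\<close> at distance more than \<open>r\<close> from the complement is at most the integral over \<open>U\<close> of the
  window average, since every window of length \<open>r\<close> that contains such a point starts in \<open>U\<close>. The elementary inequality
  \<open>m \<le> l + m\<^sup>2 / l\<close> then replaces the Cauchy-Schwarz inequality, with \<open>l\<close> left free for the
  application to sets of small measure.\<close>

lemma emeasure_open_le_energy:
  fixes \<mu> :: "real measure"
  assumes S: "sets \<mu> = sets borel" and P: "prob_space \<mu>" and "open U" and l: "l > 0"
    and fin: "liminf (\<lambda>n. pair_energy (gaussian_kernel ((1/2) ^ n)) \<mu>) < ennreal K" and K: "K \<ge> 0"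
  shows "emeasure \<mu> U \<le> ennreal l * emeasure lborel U + ennreal (2 * K / l)"
proof (cases "U = UNIV")
  case True
  thus ?thesis using l by (simp add: ennreal_mult_top)
next
  case False
  interpret prob_space \<mu> by fact
  interpret PL: pair_sigma_finite \<mu> lborel ..
  note S[measurable_cong]
  have [measurable]: "U \<in> sets borel" using \<open>open U\<close> by simp
  \<comment> \<open>The points that are deep inside \<open>U\<close>; the strict inequality keeps all points at distance \<open>(1/2) ^ n\<close> inside \<open>U\<close>.\<close>
  define W where "W n = {u. (1/2) ^ n < infdist u (- U)}" for n :: nat
  have Wo: "open (W n)" for n unfolding W_def by (intro open_Collect_less continuous_intros)
  have [measurable]: "W n \<in> sets borel" for n using Wo by simp
  have UW: "U = (\<Union>n. W n)"
  proof (intro equalityI subsetI)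
    fix u assume "u \<in> U"
    hence "infdist u (- U) > 0"
      using \<open>open U\<close> False by (subst infdist_pos_not_in_closed) auto
    then obtain n where "(1/2) ^ n < infdist u (- U)" using real_arch_pow_inv[of _ "1/2"] by force
    thus "u \<in> (\<Union>n. W n)" by (auto simp: W_def)
  next
    fix u assume "u \<in> (\<Union>n. W n)"
    then obtain n where "(1/2) ^ n < infdist u (- U)" by (auto simp: W_def)
    hence "infdist u (- U) \<noteq> 0" using zero_less_power[of "1/2::real" n] by linarith
    thus "u \<in> U" using infdist_zero[of u "- U"] by blast
  qed
  have Wmono: "W m \<subseteq> W n" if "m \<le> n" for m n
    unfolding W_def using power_decreasing[OF that, of "1/2::real"]
    by (intro Collect_mono impI) (rule order_le_less_trans, auto)
  have core: "emeasure \<mu> (W n) \<le> ennreal l * emeasure lborel U + ennreal (1 / l) * (ennreal 2 * pair_energy (gaussian_kernel ((1/2) ^ n)) \<mu>)" for n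
  proof -
    define r :: real where "r = (1/2) ^ n"
    have r: "r > 0" by (simp add: r_def)
    let ?h = "\<lambda>x u. indicator {u - r..u} x :: ennreal"
    have "ennreal r * emeasure \<mu> (W n) = (\<integral>\<^sup>+u. indicator (W n) u * (\<integral>\<^sup>+x. ?h x u \<partial>lborel) \<partial>\<mu>)"
    proof -
      have "(\<integral>\<^sup>+u. indicator (W n) u * (\<integral>\<^sup>+x. ?h x u \<partial>lborel) \<partial>\<mu>) = (\<integral>\<^sup>+u. ennreal r * indicator (W n) u \<partial>\<mu>)"
        using r by (simp add: mult.commute)
      thus ?thesis by (simp add: nn_integral_cmult_indicator)
    qed
    also have "\<dots> \<le> (\<integral>\<^sup>+u. (\<integral>\<^sup>+x. indicator U x * ?h x u \<partial>lborel) \<partial>\<mu>)"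
    proof (subst nn_integral_cmult[symmetric], measurable, intro nn_integral_mono)
      fix u x :: real
      have "x \<in> U" if "u \<in> W n" "x \<in> {u - r..u}"
      proof (rule ccontr)
        assume "x \<notin> U"
        hence "infdist u (- U) \<le> dist u x" by (intro infdist_le) auto
        thus False using that by (auto simp: W_def r_def dist_real_def)
      qed
      thus "indicator (W n) u * ?h x u \<le> indicator U x * ?h x u" by (auto simp: indicator_def)
    qed
    also have "\<dots> = (\<integral>\<^sup>+x. (\<integral>\<^sup>+u. indicator U x * ?h x u \<partial>\<mu>) \<partial>lborel)"
      by (rule PL.Fubini'[symmetric]) measurable
    also have "\<dots> = (\<integral>\<^sup>+x. indicator U x * emeasure \<mu> {x..x + r} \<partial>lborel)"
      by (simp add: nn_integral_cmult emeasure_window_eq[OF S])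
    also have "\<dots> \<le> (\<integral>\<^sup>+x. ennreal r * (ennreal l * indicator U x + ennreal (1 / l) * ennreal ((measure \<mu> {x..x + r} / r)\<^sup>2)) \<partial>lborel)"
    proof (rule nn_integral_mono)
      fix x
      define m where "m = measure \<mu> {x..x + r} / r"
      have m: "m \<ge> 0" using r by (simp add: m_def)
      have "m \<le> l + 1 / l * m\<^sup>2"
      proof (cases "m \<le> l")
        case True thus ?thesis using l by (simp add: add_increasing2)
      next
        case False
        hence "m * l \<le> m * m" using m by (intro mult_left_mono) auto
        hence "m \<le> 1 / l * m\<^sup>2" using l by (simp add: field_simps power2_eq_square)
        thus ?thesis using l by simp
      qed
      hence "r * m \<le> r * (l + 1 / l * m\<^sup>2)" using r by simp
      hence "ennreal (r * m) \<le> ennreal r * (ennreal l + ennreal (1 / l) * ennreal (m\<^sup>2))"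
        using r l m by (simp add: ennreal_mult[symmetric] ennreal_plus[symmetric] del: ennreal_plus)
      moreover have "emeasure \<mu> {x..x + r} = ennreal (r * m)" using r by (simp add: m_def emeasure_eq_measure)
      ultimately show "indicator U x * emeasure \<mu> {x..x + r} \<le> ennreal r * (ennreal l * indicator U x + ennreal (1 / l) * ennreal ((measure \<mu> {x..x + r} / r)\<^sup>2))"
        unfolding m_def[symmetric] by (auto simp: indicator_def)
    qed
    also have "\<dots> = ennreal r * (ennreal l * emeasure lborel U + ennreal (1 / l) * (\<integral>\<^sup>+x. ennreal ((measure \<mu> {x..x + r} / r)\<^sup>2) \<partial>lborel))"
    proof -
      have [measurable]: "(\<lambda>x. measure \<mu> {x..x + r}) \<in> borel_measurable borel"
        using emeasure_window_measurable[OF S P, of r] unfolding measure_def by measurable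
      show ?thesis by (simp add: nn_integral_cmult nn_integral_add)
    qed
    also have "\<dots> \<le> ennreal r * (ennreal l * emeasure lborel U + ennreal (1 / l) * (ennreal 2 * pair_energy (gaussian_kernel r) \<mu>))"
      by (intro mult_left_mono add_left_mono nn_integral_window_average_square_le[OF S P r]) auto
    finally have "ennreal r * emeasure \<mu> (W n) \<le> \<dots>" .
    hence "ennreal (1/r) * (ennreal r * emeasure \<mu> (W n)) \<le> ennreal (1/r) * (ennreal r * (ennreal l * emeasure lborel U + ennreal (1 / l) * (ennreal 2 * pair_energy (gaussian_kernel r) \<mu>)))"
      by (rule mult_left_mono) simp
    moreover have "ennreal (1/r) * (ennreal r * z) = z" for z
      using r by (simp add: mult.assoc[symmetric] ennreal_mult[symmetric])
    ultimately show ?thesis by (simp only: r_def)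
  qed
  \<comment> \<open>The energy is below \<open>K\<close> only along a subsequence; monotonicity of \<open>W\<close> bridges the gaps.\<close>
  have freq: "\<exists>n\<ge>m. pair_energy (gaussian_kernel ((1/2) ^ n)) \<mu> < ennreal K" for m
  proof (rule ccontr)
    assume "\<not> ?thesis"
    hence "eventually (\<lambda>n. ennreal K \<le> pair_energy (gaussian_kernel ((1/2) ^ n)) \<mu>) sequentially"
      unfolding eventually_sequentially by (metis not_less)
    hence "ennreal K \<le> liminf (\<lambda>n. pair_energy (gaussian_kernel ((1/2) ^ n)) \<mu>)"
      by (intro Liminf_bounded)
    thus False using fin by simp
  qed
  have "emeasure \<mu> (W m) \<le> ennreal l * emeasure lborel U + ennreal (2 * K / l)" for m
  proof -
    obtain n where n: "n \<ge> m" "pair_energy (gaussian_kernel ((1/2) ^ n)) \<mu> < ennreal K" using freq by blast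
    have "emeasure \<mu> (W m) \<le> emeasure \<mu> (W n)" using Wmono[OF n(1)] by (intro emeasure_mono) auto
    also note core[of n]
    also have "ennreal (1 / l) * (ennreal 2 * pair_energy (gaussian_kernel ((1/2) ^ n)) \<mu>) \<le> ennreal (1/l) * (ennreal 2 * ennreal K)"
      using n(2) by (intro mult_left_mono) auto
    also have "\<dots> = ennreal (2 * K / l)" using l K by (simp add: ennreal_mult[symmetric] del: ennreal_numeral)
    finally show ?thesis by (simp add: add_left_mono)
  qed
  hence "(SUP m. emeasure \<mu> (W m)) \<le> ennreal l * emeasure lborel U + ennreal (2 * K / l)"
    by (intro SUP_least)
  also have "(SUP m. emeasure \<mu> (W m)) = emeasure \<mu> U"
    unfolding UW using Wmono by (intro SUP_emeasure_incseq) (auto simp: incseq_def)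
  finally show ?thesis .
qed

text \<open>A null set lies in open sets of arbitrarily small measure; the free parameter of the bound for open
  sets is balanced against that measure.\<close>

lemma absolutely_continuous_of_finite_energy:
  fixes \<mu> :: "real measure"
  assumes S: "sets \<mu> = sets borel" and P: "prob_space \<mu>"
    and fin: "finite_energy \<mu>"
  shows "absolutely_continuous lborel \<mu>"
  unfolding absolutely_continuous_def
proof
  fix N :: "real set" assume N: "N \<in> null_sets lborel"
  obtain K where K: "liminf (\<lambda>n. pair_energy (gaussian_kernel ((1/2) ^ n)) \<mu>) = ennreal K" "K \<ge> 0"
    using fin by (cases "liminf (\<lambda>n. pair_energy (gaussian_kernel ((1/2) ^ n)) \<mu>)") auto
  have lt: "liminf (\<lambda>n. pair_energy (gaussian_kernel ((1/2) ^ n)) \<mu>) < ennreal (K + 1)"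
    using K by (simp add: ennreal_less_iff)
  have "emeasure \<mu> N \<le> 0 + ennreal e" if e: "e > 0" for e :: real
  proof -
    \<comment> \<open>With \<open>emeasure lborel U \<le> 1 / l\<^sup>2\<close>, the two terms of the bound add up to \<open>e\<close>.\<close>
    define l where "l = (2 * (K + 1) + 1) / e"
    have l: "l > 0" using K e by (simp add: l_def)
    obtain U where U: "open U" "N \<subseteq> U" "emeasure lborel (U - N) < ennreal (1 / l\<^sup>2)"
      using outer_regular_lborel[of N "1 / l\<^sup>2"] N l by (auto simp: null_sets_def)
    have "emeasure lborel U = emeasure lborel (U - N)" using N U by (intro emeasure_Diff_null_set[symmetric]) auto
    hence U3: "emeasure lborel U \<le> ennreal (1 / l\<^sup>2)" using U by simp
    have "emeasure \<mu> N \<le> emeasure \<mu> U" using U S N by (intro emeasure_mono) auto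
    also have "\<dots> \<le> ennreal l * emeasure lborel U + ennreal (2 * (K + 1) / l)"
      using emeasure_open_le_energy[OF S P U(1) l lt] K by simp
    also have "\<dots> \<le> ennreal l * ennreal (1 / l\<^sup>2) + ennreal (2 * (K + 1) / l)"
      by (intro add_mono mult_left_mono U3) auto
    also have "\<dots> = ennreal (l * (1 / l\<^sup>2) + 2 * (K + 1) / l)"
    proof -
      have "ennreal (l * (1 / l\<^sup>2)) = ennreal l * ennreal (1 / l\<^sup>2)" using l by (intro ennreal_mult) auto
      moreover have "ennreal (l * (1 / l\<^sup>2) + 2 * (K + 1) / l) = ennreal (l * (1 / l\<^sup>2)) + ennreal (2 * (K + 1) / l)"
        using l K by (intro ennreal_plus) auto
      ultimately show ?thesis by (simp only:)
    qed
    also have "l * (1 / l\<^sup>2) + 2 * (K + 1) / l = (2 * (K + 1) + 1) / l"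
      using l by (simp add: power2_eq_square field_simps)
    also have "\<dots> = e" using K e by (simp add: l_def)
    finally show ?thesis by simp
  qed
  hence "emeasure \<mu> N \<le> 0" by (rule ennreal_le_epsilon)
  thus "N \<in> null_sets \<mu>" using N S by (auto simp: null_sets_def)
qed

text \<open>The window averages converge to the density at almost every point by Lebesgue differentiation, and their
  \<open>L\<^sup>2\<close> norms are bounded by the energy; Fatou's lemma transfers the bound to the density.\<close>

proposition L2_density_of_finite_energy:
  fixes \<mu> :: "real measure"
  assumes S: "sets \<mu> = sets borel" and P: "prob_space \<mu>"
    and fin: "finite_energy \<mu>"
  shows "\<exists>f :: real \<Rightarrow> real. f \<in> borel_measurable lborel \<and> (\<forall>x. 0 \<le> f x) \<and>
           \<mu> = density lborel (\<lambda>x. ennreal (f x)) \<and> integrable lborel (\<lambda>x. (f x)\<^sup>2)"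
proof -
  interpret prob_space \<mu> by fact
  have ac: "absolutely_continuous lborel \<mu>" by (rule absolutely_continuous_of_finite_energy[OF assms])
  have S': "sets \<mu> = sets lborel" using S by simp
  obtain f where f: "f \<in> borel_measurable lborel" "AE x in lborel. RN_deriv lborel \<mu> x = ennreal (f x)"
     "\<And>x. 0 \<le> f x"
    using sigma_finite_measure.real_RN_deriv[OF lborel.sigma_finite_measure_axioms finite_measure_axioms ac S'] by blast
  note f(1)[measurable]
  have "density lborel (RN_deriv lborel \<mu>) = \<mu>"
    using ac S by (intro sigma_finite_measure.density_RN_deriv[OF lborel.sigma_finite_measure_axioms]) auto
  moreover have "density lborel (RN_deriv lborel \<mu>) = density lborel (\<lambda>x. ennreal (f x))"
    using f(2) by (intro density_cong) auto
  ultimately have dens: "\<mu> = density lborel (\<lambda>x. ennreal (f x))" by simp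
  have "(\<integral>\<^sup>+x. ennreal (f x) \<partial>lborel) = emeasure \<mu> UNIV"
    by (subst dens) (simp add: emeasure_density)
  also have "\<dots> = 1" using emeasure_space_1 sets_eq_imp_space_eq[OF S] by simp
  finally have int: "integrable lborel f" using f(3) by (intro integrableI_nonneg) auto
  have win: "integral (cbox x (x + r)) f = measure \<mu> {x..x + r}" for x r
  proof -
    have si: "set_integrable lborel {x..x+r} f"
      using int unfolding set_integrable_def by (intro integrable_mult_indicator) auto
    have "emeasure \<mu> {x..x + r} = (\<integral>\<^sup>+t. ennreal (indicator {x..x+r} t *\<^sub>R f t) \<partial>lborel)"
      by (subst dens) (auto simp: emeasure_density indicator_def intro!: nn_integral_cong)
    also have "\<dots> = ennreal (LINT t:{x..x+r}|lborel. f t)"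
      using si f(3) unfolding set_lebesgue_integral_def set_integrable_def
      by (intro nn_integral_eq_integral) auto
    also have "(LINT t:{x..x+r}|lborel. f t) = integral {x..x+r} f"
      by (rule set_borel_integral_eq_integral(2)[OF si])
    finally have "ennreal (measure \<mu> {x..x + r}) = ennreal (integral {x..x+r} f)"
      by (simp add: emeasure_eq_measure)
    moreover have "integral {x..x+r} f \<ge> 0"
      using f(3) by (intro integral_nonneg set_borel_integral_eq_integral(1)[OF si]) auto
    ultimately show ?thesis by (simp add: cbox_interval)
  qed
  have io: "f integrable_on cbox a b" for a b
  proof -
    have "set_integrable lborel (cbox a b) f"
      using int unfolding set_integrable_def by (intro integrable_mult_indicator) auto
    thus ?thesis by (rule set_borel_integral_eq_integral(1))
  qed
  obtain N where N: "negligible N" and lim: "\<And>x e. \<lbrakk>x \<notin> N; 0 < e\<rbrakk> \<Longrightarrow>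
     \<exists>d>0. \<forall>h. 0 < h \<and> h < d \<longrightarrow> norm (integral (cbox x (x + h *\<^sub>R One)) f /\<^sub>R h ^ DIM(real) - f x) < e"
    using integrable_ccontinuous_explicit[of f] io by blast
  have conv: "(\<lambda>n. measure \<mu> {x..x + (1/2) ^ n} / (1/2) ^ n) \<longlonglongrightarrow> f x" if "x \<notin> N" for x
  proof (rule LIMSEQ_I)
    fix e :: real assume "0 < e"
    then obtain d where d: "d > 0" "\<And>h. 0 < h \<Longrightarrow> h < d \<Longrightarrow> norm (integral (cbox x (x + h *\<^sub>R One)) f /\<^sub>R h ^ DIM(real) - f x) < e"
      using lim[OF \<open>x \<notin> N\<close>, of e] by blast
    obtain n0 where n0: "(1/2) ^ n0 < d" using real_arch_pow_inv[OF d(1), of "1/2"] by auto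
    show "\<exists>no. \<forall>n\<ge>no. norm (measure \<mu> {x..x + (1/2) ^ n} / (1/2) ^ n - f x) < e"
    proof (intro exI[of _ n0] allI impI)
      fix n assume "n \<ge> n0"
      hence "(1/2::real) ^ n \<le> (1/2) ^ n0" by (intro power_decreasing) auto
      hence "(1/2::real) ^ n < d" using n0 by (rule order_le_less_trans)
      moreover have "integral (cbox x (x + h *\<^sub>R One)) f /\<^sub>R h ^ DIM(real) = measure \<mu> {x..x + h} / h" for h
        using win[of x h] by (simp add: divide_inverse mult.commute)
      ultimately show "norm (measure \<mu> {x..x + (1/2) ^ n} / (1/2) ^ n - f x) < e"
        using d(2)[of "(1/2) ^ n"] by (simp only: zero_less_power zero_less_divide_iff zero_less_one zero_less_numeral simp_thms)
    qed
  qed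
  have "AE x in lebesgue. x \<notin> N"
    using N by (intro AE_not_in) (simp add: negligible_iff_null_sets)
  hence "AE x in lborel. x \<notin> N" by (simp only: AE_completion_iff)
  hence "AE x in lborel. (\<lambda>n. measure \<mu> {x..x + (1/2) ^ n} / (1/2) ^ n) \<longlonglongrightarrow> f x"
    by (rule eventually_mono) (rule conv)
  hence "(\<integral>\<^sup>+x. ennreal ((f x)\<^sup>2) \<partial>lborel)
     \<le> (\<integral>\<^sup>+x. liminf (\<lambda>n. ennreal ((measure \<mu> {x..x + (1/2) ^ n} / (1/2) ^ n)\<^sup>2)) \<partial>lborel)"
  proof (intro nn_integral_mono_AE, eventually_elim)
    case (elim x)
    hence "(\<lambda>n. ennreal ((measure \<mu> {x..x + (1/2) ^ n} / (1/2) ^ n)\<^sup>2)) \<longlonglongrightarrow> ennreal ((f x)\<^sup>2)"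
      by (intro tendsto_ennrealI tendsto_power)
    from lim_imp_Liminf[OF _ this] show ?case by simp
  qed
  also have "\<dots> \<le> liminf (\<lambda>n. (\<integral>\<^sup>+x. ennreal ((measure \<mu> {x..x + (1/2) ^ n} / (1/2) ^ n)\<^sup>2) \<partial>lborel))"
  proof (rule nn_integral_liminf)
    fix n
    have [measurable]: "(\<lambda>x. measure \<mu> {x..x + (1/2) ^ n}) \<in> borel_measurable borel"
      using emeasure_window_measurable[OF S P, of "(1/2) ^ n"] unfolding measure_def by measurable
    show "(\<lambda>x. ennreal ((measure \<mu> {x..x + (1/2) ^ n} / (1/2) ^ n)\<^sup>2)) \<in> borel_measurable lborel" by measurable
  qed
  also have "\<dots> \<le> liminf (\<lambda>n. ennreal 2 * pair_energy (gaussian_kernel ((1/2) ^ n)) \<mu>)"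
    by (intro Liminf_mono always_eventually allI nn_integral_window_average_square_le[OF S P]) simp
  also have "\<dots> = ennreal 2 * liminf (\<lambda>n. pair_energy (gaussian_kernel ((1/2) ^ n)) \<mu>)"
    by (rule Liminf_compose_continuous_mono[where f="\<lambda>x. ennreal 2 * x"])
       (auto intro!: ennreal_continuous_on_cmult continuous_on_id mult_left_mono simp: mono_def)
  also have "\<dots> < \<infinity>" using fin by (simp add: ennreal_mult_less_top del: ennreal_numeral)
  finally have "integrable lborel (\<lambda>x. (f x)\<^sup>2)" by (intro integrableI_nonneg) auto
  thus ?thesis using f dens by blast
qed


section \<open>Characteristic functions and continuous densities\<close>

lemma integral_gaussian_iexp:
  assumes e: "\<epsilon> > 0"
  shows "(CLBINT t. std_normal_density (\<epsilon> * t) *\<^sub>R iexp (t * u)) = complex_of_real (exp (- (u / \<epsilon>)\<^sup>2 / 2) / \<epsilon>)"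
proof -
  define I where "I = (CLBINT t. std_normal_density (\<epsilon> * t) *\<^sub>R iexp (t * u))"
  have "complex_of_real (exp (- (u / \<epsilon>)\<^sup>2 / 2)) = char std_normal_distribution (u / \<epsilon>)"
    by (simp add: char_std_normal_distribution)
  also have "\<dots> = (CLBINT t. std_normal_density t *\<^sub>R iexp (u / \<epsilon> * t))"
    unfolding char_def by (subst integral_density) auto
  also have "\<dots> = \<bar>\<epsilon>\<bar> *\<^sub>R (CLBINT t. std_normal_density (0 + \<epsilon> * t) *\<^sub>R iexp (u / \<epsilon> * (0 + \<epsilon> * t)))"
    using e by (intro lborel_integral_real_affine) auto
  also have "(\<lambda>t. std_normal_density (0 + \<epsilon> * t) *\<^sub>R iexp (u / \<epsilon> * (0 + \<epsilon> * t))) = (\<lambda>t. std_normal_density (\<epsilon> * t) *\<^sub>R iexp (t * u))"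
    using e by (auto simp: fun_eq_iff mult.commute)
  finally have "complex_of_real (exp (- (u / \<epsilon>)\<^sup>2 / 2)) = \<epsilon> *\<^sub>R I" using e by (simp add: I_def)
  thus ?thesis unfolding I_def[symmetric] using e by (simp add: scaleR_conv_of_real field_simps)
qed

lemma integrable_std_normal_scaled:
  assumes "\<epsilon> > 0" shows "integrable lborel (\<lambda>t. std_normal_density (\<epsilon> * t))"
proof -
  have "integrable lborel std_normal_density" by simp
  from lborel_integrable_real_affine[OF this, of \<epsilon> 0] assms show ?thesis by simp
qed

lemma char_measurable [measurable]:
  assumes "real_distribution \<mu>" shows "char \<mu> \<in> borel_measurable borel"
  using real_distribution.char_measurable[OF assms] by simp

text \<open>Parseval's identity with a Gaussian weight: \<open>(cmod (char \<mu> t))\<^sup>2\<close> is the expectation of \<open>exp (\<i> t (x - x'))\<close> for two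
  independent points, and the Gaussian is its own Fourier transform.\<close>

lemma gaussian_weighted_char_square:
  assumes S: "sets \<mu> = sets borel" and P: "prob_space \<mu>" and e: "\<epsilon> > 0"
  shows "(\<integral>\<^sup>+t. ennreal ((cmod (char \<mu> t))\<^sup>2 * std_normal_density (\<epsilon> * t)) \<partial>lborel) = pair_energy (gaussian_kernel \<epsilon>) \<mu>"
proof -
  interpret prob_space \<mu> by fact
  interpret real_distribution \<mu> by unfold_locales (simp add: S)
  interpret N: pair_prob_space \<mu> \<mu> ..
  note S[measurable_cong]
  let ?N = "\<mu> \<Otimes>\<^sub>M \<mu>"
  interpret LN: pair_sigma_finite lborel ?N ..
  have sN[measurable_cong]: "sets ?N = sets (borel \<Otimes>\<^sub>M borel)" using S by (intro sets_pair_measure_cong) auto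
  have cm[measurable]: "char \<mu> \<in> borel_measurable borel" by simp
  have sq: "complex_of_real ((cmod (char \<mu> t))\<^sup>2) = (CLINT z|?N. iexp (t * (fst z - snd z)))" for t
  proof -
    have "integrable ?N (\<lambda>z. iexp (t * (fst z - snd z)))"
      by (intro N.integrable_const_bound[of _ 1]) (auto simp: norm_exp_i_times)
    moreover have "iexp (t * (x - x')) = iexp (t * x) * cnj (iexp (t * x'))" for x x' :: real
    proof -
      have "cnj (iexp (t * x')) = exp (- (\<i> * complex_of_real (t * x')))"
        by (subst exp_cnj) simp
      thus ?thesis by (simp add: exp_add[symmetric] algebra_simps)
    qed
    ultimately have "(CLINT z|?N. iexp (t * (fst z - snd z))) = (CLINT x|\<mu>. CLINT x'|\<mu>. iexp (t * x) * cnj (iexp (t * x')))"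
      using N.integral_fst'[of "\<lambda>z. iexp (t * (fst z - snd z))"] by simp
    also have "\<dots> = char \<mu> t * cnj (char \<mu> t)"
      unfolding char_def integral_cnj[symmetric] by simp
    also have "\<dots> = complex_of_real ((cmod (char \<mu> t))\<^sup>2)"
      by (rule complex_norm_square[symmetric])
    finally show ?thesis ..
  qed
  have int2: "integrable (lborel \<Otimes>\<^sub>M ?N) (\<lambda>(t, z). std_normal_density (\<epsilon> * t) *\<^sub>R iexp (t * (fst z - snd z)))"
  proof (rule LN.Fubini_integrable)
    show "integrable lborel (\<lambda>t. \<integral>z. norm (case (t, z) of (t, z) \<Rightarrow> std_normal_density (\<epsilon> * t) *\<^sub>R iexp (t * (fst z - snd z))) \<partial>?N)"
      using integrable_std_normal_scaled[OF e] by (simp add: norm_exp_i_times N.prob_space)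
    show "AE t in lborel. integrable ?N (\<lambda>z. case (t, z) of (t, z) \<Rightarrow> std_normal_density (\<epsilon> * t) *\<^sub>R iexp (t * (fst z - snd z)))"
    proof (intro AE_I2)
      fix t
      show "integrable ?N (\<lambda>z. case (t, z) of (t, z) \<Rightarrow> std_normal_density (\<epsilon> * t) *\<^sub>R iexp (t * (fst z - snd z)))"
        by (intro N.integrable_const_bound[of _ "std_normal_density (\<epsilon> * t)"]) (auto simp: norm_exp_i_times)
    qed
  qed measurable
  have intc: "integrable lborel (\<lambda>t. (cmod (char \<mu> t))\<^sup>2 * std_normal_density (\<epsilon> * t))"
  proof (rule Bochner_Integration.integrable_bound[OF integrable_std_normal_scaled[OF e]])
    show "AE t in lborel. norm ((cmod (char \<mu> t))\<^sup>2 * std_normal_density (\<epsilon> * t)) \<le> norm (std_normal_density (\<epsilon> * t))"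
      using cmod_char_le_1 by (intro AE_I2) (auto simp: abs_mult power_le_one mult_left_le_one_le)
  qed measurable
  have "complex_of_real (LBINT t. (cmod (char \<mu> t))\<^sup>2 * std_normal_density (\<epsilon> * t))
      = (CLBINT t. std_normal_density (\<epsilon> * t) *\<^sub>R (CLINT z|?N. iexp (t * (fst z - snd z))))"
    unfolding sq[symmetric] integral_complex_of_real[symmetric] by (simp add: scaleR_conv_of_real mult.commute)
  also have "\<dots> = (CLBINT t. (CLINT z|?N. std_normal_density (\<epsilon> * t) *\<^sub>R iexp (t * (fst z - snd z))))"
    by simp
  also have "\<dots> = (CLINT z|?N. (CLBINT t. std_normal_density (\<epsilon> * t) *\<^sub>R iexp (t * (fst z - snd z))))"
    by (rule LN.Fubini_integral[symmetric]) (use int2 in simp)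
  also have "\<dots> = complex_of_real (LINT z|?N. exp (- ((fst z - snd z) / \<epsilon>)\<^sup>2 / 2) / \<epsilon>)"
    by (simp only: integral_gaussian_iexp[OF e] integral_complex_of_real)
  finally have eq: "(LBINT t. (cmod (char \<mu> t))\<^sup>2 * std_normal_density (\<epsilon> * t)) = (LINT z|?N. exp (- ((fst z - snd z) / \<epsilon>)\<^sup>2 / 2) / \<epsilon>)"
    by (simp only: of_real_eq_iff)
  have "(\<integral>\<^sup>+t. ennreal ((cmod (char \<mu> t))\<^sup>2 * std_normal_density (\<epsilon> * t)) \<partial>lborel)
      = ennreal (LBINT t. (cmod (char \<mu> t))\<^sup>2 * std_normal_density (\<epsilon> * t))"
    by (intro nn_integral_eq_integral intc) auto
  also have "\<dots> = (\<integral>\<^sup>+z. ennreal (exp (- ((fst z - snd z) / \<epsilon>)\<^sup>2 / 2) / \<epsilon>) \<partial>?N)"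
    unfolding eq using e
    by (intro nn_integral_eq_integral[symmetric] N.integrable_const_bound[of _ "1/\<epsilon>"]) (auto simp: divide_right_mono)
  also have "\<dots> = pair_energy (gaussian_kernel \<epsilon>) \<mu>"
    unfolding pair_energy_def gaussian_kernel_def
    by (subst nn_integral_fst[symmetric]) auto
  finally show ?thesis .
qed

text \<open>As the bandwidth tends to 0, the Gaussian weights converge to a positive constant, so that Fatou's lemma
  removes them.\<close>

lemma char_square_integrable_of_finite_energy:
  assumes S: "sets \<mu> = sets borel" and P: "prob_space \<mu>"
    and fin: "finite_energy \<mu>"
  shows "integrable lborel (\<lambda>t. (cmod (char \<mu> t))\<^sup>2)"
proof -
  interpret prob_space \<mu> by fact
  interpret real_distribution \<mu> by unfold_locales (simp add: S)
  have cm[measurable]: "char \<mu> \<in> borel_measurable borel" by simp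
  let ?w = "std_normal_density 0"
  have w: "?w > 0" by (simp add: normal_density_pos)
  have lim: "(\<lambda>n. std_normal_density ((1/2) ^ n * t)) \<longlonglongrightarrow> ?w" for t
  proof -
    have "(\<lambda>n. (1/2) ^ n * t) \<longlonglongrightarrow> 0 * t" by (intro tendsto_mult LIMSEQ_realpow_zero tendsto_const) auto
    moreover have "isCont std_normal_density 0" unfolding std_normal_density_def by (intro continuous_intros) auto
    ultimately show ?thesis by (intro isCont_tendsto_compose[of 0 std_normal_density]) auto
  qed
  have "(\<integral>\<^sup>+t. ennreal ((cmod (char \<mu> t))\<^sup>2 * ?w) \<partial>lborel)
     \<le> (\<integral>\<^sup>+t. liminf (\<lambda>n. ennreal ((cmod (char \<mu> t))\<^sup>2 * std_normal_density ((1/2) ^ n * t))) \<partial>lborel)"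
  proof (rule nn_integral_mono)
    fix t
    have "(\<lambda>n. ennreal ((cmod (char \<mu> t))\<^sup>2 * std_normal_density ((1/2) ^ n * t))) \<longlonglongrightarrow> ennreal ((cmod (char \<mu> t))\<^sup>2 * ?w)"
      by (intro tendsto_ennrealI tendsto_mult tendsto_const lim)
    from lim_imp_Liminf[OF _ this]
    show "ennreal ((cmod (char \<mu> t))\<^sup>2 * ?w) \<le> liminf (\<lambda>n. ennreal ((cmod (char \<mu> t))\<^sup>2 * std_normal_density ((1/2) ^ n * t)))"
      by simp
  qed
  also have "\<dots> \<le> liminf (\<lambda>n. \<integral>\<^sup>+t. ennreal ((cmod (char \<mu> t))\<^sup>2 * std_normal_density ((1/2) ^ n * t)) \<partial>lborel)"
    by (rule nn_integral_liminf) measurable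
  also have "\<dots> = liminf (\<lambda>n. pair_energy (gaussian_kernel ((1/2) ^ n)) \<mu>)"
    by (subst gaussian_weighted_char_square[OF S P]) auto
  also have "\<dots> < \<infinity>" by (rule fin)
  finally have "integrable lborel (\<lambda>t. (cmod (char \<mu> t))\<^sup>2 * ?w)"
    using w by (intro integrableI_nonneg) auto
  hence "integrable lborel (\<lambda>t. (cmod (char \<mu> t))\<^sup>2 * ?w * inverse ?w)" by (rule integrable_mult_left)
  thus ?thesis using w by (simp add: mult.assoc)
qed

text \<open>The inversion formula of Levy, in which integrability of the characteristic function turns the
  limit of truncated integrals into an integral, and \<open>(exp (- \<i> t a) - exp (- \<i> t b)) / (\<i> t)\<close> is written as the integral of
  \<open>exp (- \<i> t x)\<close> over \<open>[a, b]\<close> in order to exchange the order of integration.\<close>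

lemma interval_mass_by_fourier_inversion:
  assumes "real_distribution \<mu>" and int: "integrable lborel (char \<mu>)"
    and atoms: "\<And>x. measure \<mu> {x} = 0" and ab: "a \<le> b"
  shows "measure \<mu> {a<..b} = (LBINT x. indicator {a..b} x * (1 / (2 * pi) * Re (CLBINT t. iexp (- (t * x)) * char \<mu> t)))"
    and "integrable lborel (\<lambda>x. indicator {a..b} x * (1 / (2 * pi) * Re (CLBINT t. iexp (- (t * x)) * char \<mu> t)))"
proof -
  interpret real_distribution \<mu> by fact
  have cm[measurable]: "char \<mu> \<in> borel_measurable borel" by simp
  let ?\<phi> = "char \<mu>"
  define h where "h t = (iexp (- (t * a)) - iexp (- (t * b))) / (\<i> * t) * ?\<phi> t" for t
  define G where "G x = (CLBINT t. iexp (- (t * x)) * ?\<phi> t)" for x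
  have [measurable]: "h \<in> borel_measurable borel" unfolding h_def by measurable
  have nh: "norm (h t) \<le> (b - a) * norm (?\<phi> t)" for t
  proof (cases "t = 0")
    case True thus ?thesis using ab by (simp add: h_def)
  next
    case False
    have "cmod ((iexp (- t * b) - iexp (- t * a)) / (\<i> * (- t))) \<le> b - a"
      using Levy_Inversion_aux2[OF ab, of "- t"] False by simp
    also have "(iexp (- t * b) - iexp (- t * a)) / (\<i> * (- t)) = (iexp (- (t * a)) - iexp (- (t * b))) / (\<i> * t)"
      by (simp add: minus_divide_left[symmetric] divide_simps)
    finally show ?thesis unfolding h_def norm_mult by (intro mult_right_mono) auto
  qed
  have inth: "integrable lborel h"
    by (rule Bochner_Integration.integrable_bound[of _ "\<lambda>t. (b - a) * norm (?\<phi> t)"])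
       (use int nh ab in \<open>auto simp: abs_mult\<close>)
  have fin: "integrable (lborel \<Otimes>\<^sub>M lborel) (\<lambda>(t, x). indicator {a..b} x *\<^sub>R (iexp (- (t * x)) * ?\<phi> t))"
  proof (rule lborel_pair.Fubini_integrable)
    have "(\<integral>x. norm (indicator {a..b} x *\<^sub>R (iexp (- (t * x)) * ?\<phi> t)) \<partial>lborel) = (b - a) * norm (?\<phi> t)" for t
    proof -
      have *: "norm (indicator {a..b} x *\<^sub>R (iexp (- (t * x)) * ?\<phi> t)) = indicator {a..b} x * norm (?\<phi> t)" for x
        using norm_exp_i_times[of "- (t * x)"] by (simp add: norm_mult indicator_def)
      show ?thesis unfolding * using ab by simp
    qed
    thus "integrable lborel (\<lambda>t. \<integral>x. norm (case (t, x) of (t, x) \<Rightarrow> indicator {a..b} x *\<^sub>R (iexp (- (t * x)) * ?\<phi> t)) \<partial>lborel)"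
      using int by simp
    have "integrable lborel (\<lambda>x. indicator {a..b} x *\<^sub>R (iexp (- (t * x)) * ?\<phi> t))" for t
      by (intro borel_integrable_compact[unfolded set_integrable_def] continuous_intros) auto
    thus "AE t in lborel. integrable lborel (\<lambda>x. case (t, x) of (t, x) \<Rightarrow> indicator {a..b} x *\<^sub>R (iexp (- (t * x)) * ?\<phi> t))"
      by simp
  qed measurable
  have inner: "(CLBINT x. indicator {a..b} x *\<^sub>R (iexp (- (t * x)) * ?\<phi> t)) = h t" if "t \<noteq> 0" for t
  proof -
    have "(CLBINT x. indicator {a..b} x *\<^sub>R iexp (- (t * x))) = iexp (- (t * b)) / (- (\<i> * t)) - iexp (- (t * a)) / (- (\<i> * t))"
    proof (rule integral_FTC_Icc[OF ab])
      fix x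
      show "((\<lambda>x. iexp (- (t * x)) / (- (\<i> * t))) has_vector_derivative iexp (- (t * x))) (at x within {a..b})"
        using that by (auto intro!: derivative_eq_intros has_vector_derivative_real_field simp: field_simps)
    qed (intro continuous_intros)
    also have "\<dots> = (iexp (- (t * a)) - iexp (- (t * b))) / (\<i> * t)" using that by (simp add: field_simps)
    finally have "(CLBINT x. indicator {a..b} x *\<^sub>R iexp (- (t * x))) * ?\<phi> t = h t" by (simp add: h_def)
    thus ?thesis by (simp add: scaleR_conv_of_real mult.assoc[symmetric])
  qed
  have hint: "(CLBINT t. h t) = (CLBINT x. indicator {a..b} x *\<^sub>R G x)"
  proof -
    have "(CLBINT t. h t) = (CLBINT t. (CLBINT x. indicator {a..b} x *\<^sub>R (iexp (- (t * x)) * ?\<phi> t)))"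
    proof (intro integral_cong_AE)
      show "AE t in lborel. h t = (CLBINT x. indicator {a..b} x *\<^sub>R (iexp (- (t * x)) * ?\<phi> t))"
        using AE_lborel_singleton[of 0] by eventually_elim (rule inner[symmetric])
    qed measurable
    also have "\<dots> = (CLBINT x. (CLBINT t. indicator {a..b} x *\<^sub>R (iexp (- (t * x)) * ?\<phi> t)))"
      by (rule lborel_pair.Fubini_integral[symmetric]) (use fin in simp)
    finally show ?thesis by (simp add: G_def)
  qed
  have intG: "integrable lborel (\<lambda>x. indicator {a..b} x *\<^sub>R G x)"
    using lborel_pair.integrable_snd[of "\<lambda>t x. indicator {a..b} x *\<^sub>R (iexp (- (t * x)) * ?\<phi> t)"] fin by (simp add: G_def)
  have "(\<lambda>T. 1 / (2 * pi) * (CLBINT t=-real T..real T. h t)) \<longlonglongrightarrow> complex_of_real (measure \<mu> {a<..b})"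
    unfolding h_def using Levy_Inversion[OF ab atoms atoms] by simp
  moreover have "(\<lambda>T. 1 / (2 * pi) * (CLBINT t=-real T..real T. h t)) \<longlonglongrightarrow> 1 / (2 * pi) * (CLBINT t. h t)"
  proof (intro tendsto_mult tendsto_const)
    have "(CLBINT t=-real T..real T. h t) = (CLBINT t. indicator {- real T<..<real T} t *\<^sub>R h t)" for T
      by (simp add: interval_lebesgue_integral_def set_lebesgue_integral_def)
    moreover have "(\<lambda>T. (CLBINT t. indicator {- real T<..<real T} t *\<^sub>R h t)) \<longlonglongrightarrow> (CLBINT t. h t)"
    proof (rule integral_dominated_convergence[where w="\<lambda>t. norm (h t)"])
      show "AE t in lborel. (\<lambda>T. indicator {- real T<..<real T} t *\<^sub>R h t) \<longlonglongrightarrow> h t"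
      proof (intro AE_I2 tendsto_eventually)
        fix t :: real
        obtain n where n: "\<bar>t\<bar> < real n" using reals_Archimedean2 by blast
        show "\<forall>\<^sub>F T in sequentially. indicator {- real T<..<real T} t *\<^sub>R h t = h t"
          unfolding eventually_sequentially
        proof (intro exI[of _ n] allI impI)
          fix T assume "n \<le> T"
          hence "real n \<le> real T" by simp
          hence "t \<in> {- real T<..<real T}" using n by auto
          thus "indicator {- real T<..<real T} t *\<^sub>R h t = h t" by simp
        qed
      qed
      show "AE t in lborel. norm (indicator {- real T<..<real T} t *\<^sub>R h t) \<le> norm (h t)" for T
        by (intro AE_I2) (simp add: indicator_def)
    qed (use inth in auto)
    ultimately show "(\<lambda>T. CLBINT t=-real T..real T. h t) \<longlonglongrightarrow> (CLBINT t. h t)" by simp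
  qed
  ultimately have "complex_of_real (measure \<mu> {a<..b}) = 1 / (2 * pi) * (CLBINT t. h t)"
    by (rule LIMSEQ_unique)
  hence m: "measure \<mu> {a<..b} = Re (1 / (2 * pi) * (CLBINT x. indicator {a..b} x *\<^sub>R G x))"
    unfolding hint by (metis Re_complex_of_real)
  have i2: "integrable lborel (\<lambda>x. 1 / (2 * pi) * Re (indicator {a..b} x *\<^sub>R G x))"
    using intG by (intro integrable_mult_right integrable_Re)
  have "Re (1 / (2 * pi) * (CLBINT x. indicator {a..b} x *\<^sub>R G x)) = 1 / (2 * pi) * Re (CLBINT x. indicator {a..b} x *\<^sub>R G x)"
  proof -
    have "(1 / (2 * pi) :: complex) = complex_of_real (1 / (2 * pi))" by simp
    moreover have "Re (complex_of_real r * z) = r * Re z" for r z by simp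
    ultimately show ?thesis by (simp only:)
  qed
  also have "\<dots> = (LBINT x. 1 / (2 * pi) * Re (indicator {a..b} x *\<^sub>R G x))"
    using intG by (simp only: integral_Re[symmetric] integral_mult_right_zero)
  finally have m2: "measure \<mu> {a<..b} = (LBINT x. 1 / (2 * pi) * Re (indicator {a..b} x *\<^sub>R G x))" using m by simp
  have eq: "(\<lambda>x. 1 / (2 * pi) * Re (indicator {a..b} x *\<^sub>R G x)) = (\<lambda>x. indicator {a..b} x * (1 / (2 * pi) * Re (G x)))"
    by (simp add: fun_eq_iff)
  show "measure \<mu> {a<..b} = (LBINT x. indicator {a..b} x * (1 / (2 * pi) * Re (CLBINT t. iexp (- (t * x)) * ?\<phi> t)))"
    and "integrable lborel (\<lambda>x. indicator {a..b} x * (1 / (2 * pi) * Re (CLBINT t. iexp (- (t * x)) * ?\<phi> t)))"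
    using m2 i2 unfolding eq unfolding G_def by simp_all
qed

text \<open>The inverse Fourier transform is continuous by dominated convergence. It is nonnegative because its integral
  over every interval is the mass of that interval.\<close>

proposition continuous_density_of_integrable_char:
  assumes "real_distribution \<mu>" and int: "integrable lborel (char \<mu>)"
    and atoms: "\<And>x. measure \<mu> {x} = 0"
  shows "\<exists>f :: real \<Rightarrow> real. continuous_on UNIV f \<and> (\<forall>x. 0 \<le> f x) \<and> \<mu> = density lborel (\<lambda>x. ennreal (f x))"
proof -
  interpret real_distribution \<mu> by fact
  have cm[measurable]: "char \<mu> \<in> borel_measurable borel" by simp
  define f where "f x = 1 / (2 * pi) * Re (CLBINT t. iexp (- (t * x)) * char \<mu> t)" for x
  note mass = interval_mass_by_fourier_inversion[OF assms(1) int atoms, folded f_def]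
  have cont: "isCont f x" for x
  proof -
    have "isCont (\<lambda>x. CLBINT t. iexp (- (t * x)) * char \<mu> t) x"
    proof (rule continuous_at_sequentiallyI)
      fix X :: "nat \<Rightarrow> real" assume X: "X \<longlonglongrightarrow> x"
      show "(\<lambda>n. CLBINT t. iexp (- (t * X n)) * char \<mu> t) \<longlonglongrightarrow> (CLBINT t. iexp (- (t * x)) * char \<mu> t)"
      proof (rule integral_dominated_convergence[where w="\<lambda>t. norm (char \<mu> t)"])
        show "AE t in lborel. (\<lambda>n. iexp (- (t * X n)) * char \<mu> t) \<longlonglongrightarrow> iexp (- (t * x)) * char \<mu> t"
          by (intro AE_I2 tendsto_intros X)
        show "AE t in lborel. norm (iexp (- (t * X n)) * char \<mu> t) \<le> norm (char \<mu> t)" for n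
          unfolding norm_mult norm_exp_i_times by simp
      qed (use int in auto)
    qed
    thus ?thesis unfolding f_def by (intro continuous_mult continuous_const continuous_Re)
  qed
  hence contU: "continuous_on UNIV f" by (simp add: continuous_on_eq_continuous_at)
  hence [measurable]: "f \<in> borel_measurable borel" by (rule borel_measurable_continuous_onI)
  have nonneg: "0 \<le> f x" for x
  proof (rule ccontr)
    assume neg: "\<not> 0 \<le> f x"
    define e where "e = - f x / 2"
    have e: "e > 0" using neg by (simp add: e_def)
    obtain d where d: "d > 0" "\<And>z. dist z x < d \<Longrightarrow> dist (f z) (f x) < e"
      using cont[of x] e unfolding continuous_at_eps_delta by blast
    have lt: "f z \<le> - e" if "z \<in> {x..x + d/2}" for z
    proof -
      have "dist (f z) (f x) < e" using that d(1) by (intro d(2)) (auto simp: dist_real_def)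
      thus ?thesis by (auto simp: dist_real_def e_def)
    qed
    have "measure \<mu> {x<..x + d/2} = (LBINT z. indicator {x..x + d/2} z * f z)"
      using d(1) by (intro mass(1)) simp
    also have "\<dots> \<le> (LBINT z. indicator {x..x + d/2} z * (- e))"
    proof (rule integral_mono)
      show "integrable lborel (\<lambda>z. indicator {x..x + d/2} z * f z)" using d(1) by (intro mass(2)) simp
      show "integrable lborel (\<lambda>z. indicator {x..x + d/2} z * (- e))"
        by (intro integrable_mult_left integrable_real_indicator) (auto simp: emeasure_lborel_Icc_eq)
      show "indicator {x..x + d/2} z * f z \<le> indicator {x..x + d/2} z * (- e)" for z
        using lt by (simp add: indicator_def)
    qed
    also have "\<dots> = - (d/2 * e)" using d(1) by simp
    also have "\<dots> < 0" using d(1) e by simp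
    finally show False using measure_nonneg[of \<mu> "{x<..x + d/2}"] by linarith
  qed
  have Ioc: "emeasure \<mu> {a<..b} = emeasure (density lborel (\<lambda>x. ennreal (f x))) {a<..b}" if ab: "a \<le> b" for a b
  proof -
    have "emeasure (density lborel (\<lambda>x. ennreal (f x))) {a<..b} = (\<integral>\<^sup>+x. ennreal (f x) * indicator {a<..b} x \<partial>lborel)"
      by (simp add: emeasure_density)
    also have "\<dots> = (\<integral>\<^sup>+x. ennreal (indicator {a..b} x * f x) \<partial>lborel)"
      using AE_lborel_singleton[of a] by (intro nn_integral_cong_AE) (auto simp: indicator_def elim!: eventually_mono)
    also have "\<dots> = ennreal (LBINT x. indicator {a..b} x * f x)"
      using nonneg by (intro nn_integral_eq_integral mass(2) ab) auto
    finally show ?thesis using mass(1)[OF ab] by (simp add: emeasure_eq_measure)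
  qed
  have "\<mu> = density lborel (\<lambda>x. ennreal (f x))"
  proof (rule measure_eqI_lessThan)
    fix x :: real
    have U: "{x<..} = (\<Union>n. {x<..x + real n})"
    proof (intro equalityI subsetI)
      fix z assume "z \<in> {x<..}"
      moreover obtain n where "z - x < real n" using reals_Archimedean2 by blast
      ultimately show "z \<in> (\<Union>n. {x<..x + real n})" by (auto intro!: exI[of _ n])
    qed auto
    have inc: "incseq (\<lambda>n. {x<..x + real n})" by (auto simp: incseq_def)
    have "emeasure \<mu> {x<..} = (SUP n. emeasure \<mu> {x<..x + real n})"
      unfolding U using inc by (intro SUP_emeasure_incseq[symmetric]) auto
    also have "\<dots> = (SUP n. emeasure (density lborel (\<lambda>x. ennreal (f x))) {x<..x + real n})"
      by (intro SUP_cong refl Ioc) auto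
    also have "\<dots> = emeasure (density lborel (\<lambda>x. ennreal (f x))) {x<..}"
      unfolding U using inc by (intro SUP_emeasure_incseq) auto
    finally show "emeasure \<mu> {x<..} = emeasure (density lborel (\<lambda>x. ennreal (f x))) {x<..}" .
    show "emeasure \<mu> {x<..} < \<infinity>" by (simp add: emeasure_eq_measure)
  qed auto
  thus ?thesis using contU nonneg by blast
qed


section \<open>Splitting the coins into two independent blocks\<close>

lemma indep_vars_coordinates:
  fixes D :: "real measure"
  assumes S: "sets D = sets borel" and P: "prob_space D"
  shows "prob_space.indep_vars (Pi\<^sub>M UNIV (\<lambda>_. D)) (\<lambda>_. borel) (\<lambda>(i::nat) y. y i) UNIV"
proof -
  interpret product_prob_space "\<lambda>_. D" "UNIV :: nat set" by (intro product_prob_spaceI P)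
  note S[measurable_cong]
  have m: "(\<lambda>y. y i) \<in> borel_measurable (Pi\<^sub>M UNIV (\<lambda>_. D))" for i :: nat by measurable
  have comp: "distr (Pi\<^sub>M UNIV (\<lambda>_. D)) borel (\<lambda>y. y i) = D" for i :: nat
  proof -
    have "distr (Pi\<^sub>M UNIV (\<lambda>_. D)) borel (\<lambda>y. y i) = distr (Pi\<^sub>M UNIV (\<lambda>_. D)) D (\<lambda>y. y i)"
      using S by (intro distr_cong) auto
    thus ?thesis using PiM_component[of i] by simp
  qed
  have "distr (Pi\<^sub>M UNIV (\<lambda>_. D)) seq_borel (\<lambda>y. \<lambda>i\<in>UNIV. y i) = distr (Pi\<^sub>M UNIV (\<lambda>_. D)) (Pi\<^sub>M UNIV (\<lambda>_. D)) (\<lambda>y. y)"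
    using S by (intro distr_cong sets_PiM_cong) auto
  also have "\<dots> = Pi\<^sub>M UNIV (\<lambda>_. D)" by (rule distr_id)
  finally show ?thesis
    by (subst P.indep_vars_iff_distr_eq_PiM) (auto simp: comp m)
qed

lemma coin_summable:
  assumes "regular_steps y" "\<And>i. c i \<in> {0, 1::real}"
  shows "summable (\<lambda>i. indicator I i * c i * partial_product y i)"
proof (rule summable_masked[OF assms(1)])
  fix i show "\<bar>indicator I i * c i\<bar> \<le> 1" using assms(2)[of i] by (auto simp: indicator_def)
qed

lemma masked_sum_Un:
  assumes "regular_steps y" "\<And>i. c i \<in> {0, 1}" "A \<inter> B = {}"
  shows "masked_sum (A \<union> B) y c = masked_sum A y c + masked_sum B y c"
  unfolding masked_sum_def suminf_add[OF coin_summable[OF assms(1,2)] coin_summable[OF assms(1,2)]]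
  using assms(3) by (intro suminf_cong) (auto simp: indicator_def)

text \<open>The sums over two disjoint sets of coins are independent.\<close>

lemma char_masked_law_Un:
  assumes y: "regular_steps y" and AB: "A \<inter> B = {}"
  shows "char (masked_law (A \<union> B) y) t = char (masked_law A y) t * char (masked_law B y) t"
proof -
  interpret Q: prob_space coin_law by (rule prob_space_coin_law)
  have ind: "Q.indep_vars (\<lambda>_. borel) (\<lambda>i c. c i) UNIV"
    by (rule indep_vars_coordinates) (auto simp: prob_space_fair_coin)
  define f where "f C c = (\<Sum>i. (if i \<in> C then c i else 0) * partial_product y i)" for C :: "nat set" and c
  have fm: "f C \<in> borel_measurable (Pi\<^sub>M C (\<lambda>_. borel))" for C
    unfolding f_def
  proof (intro borel_measurable_suminf borel_measurable_times measurable_const)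
    fix i show "(\<lambda>c. if i \<in> C then c i else 0) \<in> borel_measurable (Pi\<^sub>M C (\<lambda>_. borel))"
      by (cases "i \<in> C") auto
  qed auto
  have fr: "f C (restrict (\<lambda>i. c i) C) = masked_sum C y c" for C c
    unfolding f_def masked_sum_def by (intro suminf_cong) (auto simp: indicator_def)
  have "Q.indep_var borel (f A \<circ> (\<lambda>c. restrict (\<lambda>i. c i) A)) borel (f B \<circ> (\<lambda>c. restrict (\<lambda>i. c i) B))"
    by (rule Q.indep_var_compose[OF Q.indep_var_restrict[OF ind AB] fm fm]) auto
  hence "Q.indep_var borel (masked_sum A y) borel (masked_sum B y)"
    by (simp add: comp_def fr)
  from Q.char_distr_add[OF this]
  have "char (distr coin_law borel (\<lambda>c. masked_sum A y c + masked_sum B y c)) t = char (masked_law A y) t * char (masked_law B y) t"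
    by (simp add: masked_law_def)
  moreover have "distr coin_law borel (\<lambda>c. masked_sum A y c + masked_sum B y c) = masked_law (A \<union> B) y"
    unfolding masked_law_def
  proof (rule distr_cong_AE)
    show "AE c in coin_law. masked_sum A y c + masked_sum B y c = masked_sum (A \<union> B) y c"
      using AE_coin_law by eventually_elim (rule masked_sum_Un[OF y _ AB, symmetric], blast)
  qed auto
  ultimately show ?thesis by simp
qed

section \<open>The set of subset sums\<close>

definition tail_sum :: "(nat \<Rightarrow> real) \<Rightarrow> nat \<Rightarrow> real" where
  "tail_sum y n = (\<Sum>i. partial_product y (i + n))"

lemma masked_sum_UNIV: "masked_sum UNIV y c = (\<Sum>i. c i * partial_product y i)"
  by (simp add: masked_sum_def)

lemma subset_sums_eq_image: "subset_sums y = masked_sum UNIV y ` {c. \<forall>i. c i \<in> {0, 1}}"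
  unfolding subset_sums_def masked_sum_UNIV by blast

lemma tail_sum_nonneg: "regular_steps y \<Longrightarrow> 0 \<le> tail_sum y n"
  unfolding tail_sum_def regular_steps_def
  by (intro suminf_nonneg summable_ignore_initial_segment) (auto intro: less_imp_le partial_product_pos)

lemma masked_sum_split:
  assumes y: "regular_steps y" and c: "\<And>i. c i \<in> {0, 1}"
  shows "\<exists>t\<in>{0..tail_sum y n}. masked_sum UNIV y c = (\<Sum>i<n. c i * partial_product y i) + t"
proof (intro bexI)
  have s: "summable (\<lambda>i. c i * partial_product y i)" using coin_summable[OF y c, of UNIV] by simp
  hence s2: "summable (\<lambda>i. c (i + n) * partial_product y (i + n))" by (rule summable_ignore_initial_segment)
  have pp: "0 < partial_product y i" for i using y by (intro partial_product_pos) (auto simp: regular_steps_def)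
  have s3: "summable (\<lambda>i. partial_product y (i + n))"
    using y by (intro summable_ignore_initial_segment) (auto simp: regular_steps_def)
  have c2: "0 \<le> c i \<and> c i \<le> 1" for i using c[of i] by auto
  show "masked_sum UNIV y c = (\<Sum>i<n. c i * partial_product y i) + (\<Sum>i. c (i + n) * partial_product y (i + n))"
    unfolding masked_sum_UNIV using suminf_split_initial_segment[OF s, of n] by simp
  have "0 \<le> (\<Sum>i. c (i + n) * partial_product y (i + n))"
    using c2 pp by (intro suminf_nonneg s2) (simp add: less_imp_le)
  moreover have "(\<Sum>i. c (i + n) * partial_product y (i + n)) \<le> tail_sum y n"
    unfolding tail_sum_def using c2 pp by (intro suminf_le s2 s3) (simp add: mult_left_le_one_le less_imp_le)
  ultimately show "(\<Sum>i. c (i + n) * partial_product y (i + n)) \<in> {0..tail_sum y n}" by simp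
qed

lemma masked_sum_close:
  assumes y: "regular_steps y" and c: "\<And>i. c i \<in> {0, 1}" "\<And>i. c' i \<in> {0, 1}" "\<And>i. i < n \<Longrightarrow> c i = c' i"
  shows "\<bar>masked_sum UNIV y c - masked_sum UNIV y c'\<bar> \<le> tail_sum y n"
proof -
  have "(\<Sum>i<n. c i * partial_product y i) = (\<Sum>i<n. c' i * partial_product y i)"
    using c(3) by (intro sum.cong) auto
  moreover have "\<exists>t\<in>{0..tail_sum y n}. masked_sum UNIV y c = (\<Sum>i<n. c i * partial_product y i) + t"
    by (rule masked_sum_split[OF y c(1)])
  moreover have "\<exists>t\<in>{0..tail_sum y n}. masked_sum UNIV y c' = (\<Sum>i<n. c' i * partial_product y i) + t"
    by (rule masked_sum_split[OF y c(2)])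
  ultimately show ?thesis by auto
qed

text \<open>The set is the image of the compact product space of all coin sequences, under a map that is continuous as
  a uniform limit of finite sums.\<close>

lemma compact_subset_sums:
  assumes y: "regular_steps y"
  shows "compact (subset_sums y)"
proof -
  let ?K = "{c :: nat \<Rightarrow> real. \<forall>i. c i \<in> {0, 1}}"
  have "compactin (product_topology (\<lambda>i::nat. euclidean) UNIV) (PiE UNIV (\<lambda>_. {0, 1::real}))"
    by (subst compactin_PiE) auto
  hence K: "compact ?K"
    by (simp add: euclidean_product_topology PiE_UNIV_domain Pi_def)
  have "uniform_limit ?K (\<lambda>n c. \<Sum>i<n. c i * partial_product y i) (\<lambda>c. \<Sum>i. c i * partial_product y i) sequentially"
  proof (rule Weierstrass_m_test)
    fix n c assume "c \<in> ?K"
    hence "c n = 0 \<or> c n = 1" by auto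
    moreover have "0 < partial_product y n" using y by (intro partial_product_pos) (auto simp: regular_steps_def)
    ultimately show "norm (c n * partial_product y n) \<le> partial_product y n" by auto
  qed (use y in \<open>simp add: regular_steps_def\<close>)
  hence "continuous_on ?K (\<lambda>c. \<Sum>i. c i * partial_product y i)"
    by (rule uniform_limit_theorem[rotated])
       (auto intro!: always_eventually continuous_intros continuous_on_subset[OF continuous_on_product_coordinates])
  hence "continuous_on ?K (masked_sum UNIV y)" by (simp add: masked_sum_UNIV)
  from compact_continuous_image[OF this K] show ?thesis by (simp add: subset_sums_eq_image)
qed

lemma masked_law_subset_sums:
  assumes y: "regular_steps y"
  shows "emeasure (masked_law UNIV y) (- subset_sums y) = 0"
proof -
  have [measurable]: "subset_sums y \<in> sets borel" using compact_subset_sums[OF y] by (simp add: compact_imp_closed borel_closed)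
  have "AE c in coin_law. masked_sum UNIV y c \<in> subset_sums y"
    using AE_coin_law by eventually_elim (auto simp: subset_sums_eq_image)
  hence "AE x in masked_law UNIV y. x \<in> subset_sums y"
    unfolding masked_law_def by (subst AE_distr_iff) auto
  thus ?thesis by (subst (asm) AE_iff_measurable[where N="- subset_sums y"]) auto
qed

text \<open>Every cylinder of coin sequences has positive probability, and its image has diameter at most the tail of
  the series.\<close>

lemma topological_support_masked_law:
  assumes y: "regular_steps y"
  shows "topological_support (masked_law UNIV y) = subset_sums y"
proof (intro equalityI subsetI)
  fix x assume x: "x \<in> topological_support (masked_law UNIV y)"
  have "open (- subset_sums y)" using compact_subset_sums[OF y] by (simp add: compact_imp_closed open_Compl)
  thus "x \<in> subset_sums y"
    using x masked_law_subset_sums[OF y] unfolding topological_support_def by force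
next
  fix x assume "x \<in> subset_sums y"
  then obtain a where a: "\<And>i. a i \<in> {0, 1}" "x = masked_sum UNIV y a" by (auto simp: subset_sums_eq_image)
  show "x \<in> topological_support (masked_law UNIV y)"
    unfolding topological_support_def
  proof (intro CollectI allI impI)
    fix U :: "real set" assume U: "open U" "x \<in> U"
    then obtain e where e: "e > 0" "\<And>z. dist z x < e \<Longrightarrow> z \<in> U" by (auto simp: open_dist)
    obtain n where n: "tail_sum y n < e"
      using suminf_exist_split[OF e(1), of "partial_product y"] y tail_sum_nonneg[OF y]
      by (auto simp: regular_steps_def tail_sum_def)
    have "ennreal 0 < ennreal ((1/2) ^ n)" by (subst ennreal_less_iff) auto
    also have "ennreal ((1/2) ^ n) = (\<Prod>i\<in>{..<n}. emeasure fair_coin {a i})"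
    proof -
      have "emeasure fair_coin {a i} = ennreal (1/2)" for i
        using a(1)[of i] by (auto simp: emeasure_fair_coin)
      thus ?thesis by (simp only: prod_constant card_lessThan) (rule ennreal_power[symmetric], simp)
    qed
    also have "\<dots> = emeasure coin_law {c. \<forall>i\<in>{..<n}. c i = a i}"
      by (rule emeasure_coin_law_cylinder[symmetric]) simp
    also have "\<dots> \<le> emeasure coin_law (masked_sum UNIV y -` U \<inter> space coin_law)"
    proof (rule emeasure_mono_AE)
      show "AE c in coin_law. c \<in> {c. \<forall>i\<in>{..<n}. c i = a i} \<longrightarrow> c \<in> masked_sum UNIV y -` U \<inter> space coin_law"
        using AE_coin_law
      proof eventually_elim
        case (elim c)
        have "masked_sum UNIV y c \<in> U" if "\<forall>i\<in>{..<n}. c i = a i"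
        proof (rule e(2))
          have "\<bar>masked_sum UNIV y c - masked_sum UNIV y a\<bar> \<le> tail_sum y n"
            using elim a(1) that by (intro masked_sum_close[OF y]) auto
          thus "dist (masked_sum UNIV y c) x < e" using n a(2) by (simp add: dist_real_def)
        qed
        thus ?case by simp
      qed
      show "masked_sum UNIV y -` U \<inter> space coin_law \<in> sets coin_law"
        using U(1) by (intro measurable_sets[of _ _ borel]) auto
    qed
    also have "\<dots> = emeasure (masked_law UNIV y) U"
      unfolding masked_law_def using U(1) by (subst emeasure_distr) auto
    finally show "0 < emeasure (masked_law UNIV y) U" by simp
  qed
qed

text \<open>The left endpoints of the \<open>2 ^ n\<close> intervals of the \<open>n\<close>-th generation, possibly with coincidences.\<close>

primrec corners :: "(nat \<Rightarrow> real) \<Rightarrow> nat \<Rightarrow> real set" where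
  "corners y 0 = {0}"
| "corners y (Suc n) = corners y n \<union> (\<lambda>x. x + partial_product y n) ` corners y n"

lemma finite_corners: "finite (corners y n)"
  by (induction n) auto

lemma card_corners_le: "card (corners y n) \<le> 2 ^ n"
proof (induction n)
  case (Suc n)
  have "card (corners y (Suc n)) \<le> card (corners y n) + card ((\<lambda>x. x + partial_product y n) ` corners y n)"
    by (simp add: card_Un_le)
  also have "\<dots> \<le> card (corners y n) + card (corners y n)"
    by (intro add_left_mono card_image_le finite_corners)
  finally show ?case using Suc by simp
qed simp

lemma sum_in_corners:
  assumes "\<And>i. c i \<in> {0, 1}"
  shows "(\<Sum>i<n. c i * partial_product y i) \<in> corners y n"
proof (induction n)
  case (Suc n)
  thus ?case using assms[of n] by auto
qed simp

lemma subset_sums_cover: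
  assumes y: "regular_steps y"
  shows "subset_sums y \<subseteq> (\<Union>x\<in>corners y n. {x..x + tail_sum y n})"
proof
  fix z assume "z \<in> subset_sums y"
  then obtain c where c: "\<And>i. c i \<in> {0, 1}" "z = masked_sum UNIV y c" by (auto simp: subset_sums_eq_image)
  obtain t where "t \<in> {0..tail_sum y n}" "z = (\<Sum>i<n. c i * partial_product y i) + t"
    using masked_sum_split[OF y, of c n] c by auto
  moreover have "(\<Sum>i<n. c i * partial_product y i) \<in> corners y n" by (rule sum_in_corners[OF c(1)])
  ultimately show "z \<in> (\<Union>x\<in>corners y n. {x..x + tail_sum y n})"
    by (intro UN_I[of "\<Sum>i<n. c i * partial_product y i"]) auto
qed

lemma emeasure_subset_sums_le:
  assumes y: "regular_steps y"
  shows "emeasure lborel (subset_sums y) \<le> ennreal (2 ^ n * tail_sum y n)"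
proof -
  have "emeasure lborel (subset_sums y) \<le> emeasure lborel (\<Union>x\<in>corners y n. {x..x + tail_sum y n})"
    by (intro emeasure_mono subset_sums_cover y) (auto intro!: sets.finite_UN finite_corners)
  also have "\<dots> \<le> (\<Sum>x\<in>corners y n. emeasure lborel {x..x + tail_sum y n})"
    by (rule emeasure_subadditive_finite) (auto simp: finite_corners)
  also have "\<dots> = of_nat (card (corners y n)) * ennreal (tail_sum y n)"
    using tail_sum_nonneg[OF y] by simp
  also have "\<dots> \<le> of_nat (2 ^ n) * ennreal (tail_sum y n)"
    using card_corners_le by (intro mult_right_mono) (auto simp del: of_nat_power)
  also have "\<dots> = ennreal (2 ^ n * tail_sum y n)"
    using tail_sum_nonneg[OF y] by (subst ennreal_mult) (auto simp: ennreal_power[symmetric])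
  finally show ?thesis .
qed

lemma hausdorff_premeasure_subset_sums_le:
  assumes y: "regular_steps y" and s: "s > 0" and \<delta>: "tail_sum y n \<le> \<delta>"
  shows "hausdorff_premeasure s \<delta> (subset_sums y) \<le> ennreal (2 ^ n * tail_sum y n powr s)"
proof -
  let ?t = "tail_sum y n"
  have t: "?t \<ge> 0" by (rule tail_sum_nonneg[OF y])
  define N where "N = card (corners y n)"
  obtain e where e: "bij_betw e {0..<N} (corners y n)"
    using ex_bij_betw_nat_finite[OF finite_corners] unfolding N_def by blast
  define U where "U k = (if k < N then {e k..e k + ?t} else {})" for k
  have cov: "subset_sums y \<subseteq> (\<Union>k. U k)"
  proof
    fix z assume "z \<in> subset_sums y"
    then obtain x where x: "x \<in> corners y n" "z \<in> {x..x + ?t}" using subset_sums_cover[OF y, of n] by blast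
    have "x \<in> e ` {0..<N}" using x(1) e by (simp add: bij_betw_def)
    then obtain k where "k < N" "x = e k" by auto
    thus "z \<in> (\<Union>k. U k)" using x(2) by (auto simp: U_def)
  qed
  have diam: "diameter (U k) = (if k < N then ?t else 0)" for k
    using t by (auto simp: U_def diameter_closed_interval)
  have "hausdorff_premeasure s \<delta> (subset_sums y) \<le> (\<Sum>k. hausdorff_weight s (U k))"
    unfolding hausdorff_premeasure_def
  proof (rule INF_lower, intro CollectI conjI allI)
    show "bounded (U k)" for k by (auto simp: U_def)
    show "diameter (U k) \<le> \<delta>" for k using diam \<delta> t by auto
  qed (rule cov)
  also have "\<dots> = (\<Sum>k<N. hausdorff_weight s (U k))"
    by (rule suminf_finite) (auto simp: U_def hausdorff_weight_def)
  also have "\<dots> = (\<Sum>k<N. ennreal (?t powr s))"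
    using s t by (intro sum.cong) (auto simp: hausdorff_weight_def diam U_def[of _])
  also have "\<dots> = ennreal (real N * ?t powr s)"
    by (simp add: ennreal_mult ennreal_of_nat_eq_real_of_nat)
  also have "\<dots> \<le> ennreal (2 ^ n * ?t powr s)"
  proof (intro ennreal_leI mult_right_mono)
    have "real N \<le> real (2 ^ n)" unfolding N_def using card_corners_le[of y n] by (rule of_nat_mono)
    thus "real N \<le> 2 ^ n" by simp
  qed simp
  finally show ?thesis .
qed

lemma tail_sum_le_exp:
  assumes y: "regular_steps y" and b: "b > 0" and C: "\<And>n. partial_product y n \<le> C * exp (- b * real n)"
  shows "tail_sum y n \<le> C / (1 - exp (-b)) * exp (- b * real n)"
proof -
  have "tail_sum y n \<le> (\<Sum>i. C * exp (- b * real (i + n)))"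
    unfolding tail_sum_def
  proof (rule suminf_le)
    show "summable (\<lambda>i. partial_product y (i + n))"
      using y by (intro summable_ignore_initial_segment) (simp add: regular_steps_def)
    show "summable (\<lambda>i. C * exp (- b * real (i + n)))" using exp_decay_sums[OF b] by (rule sums_summable)
  qed (rule C)
  thus ?thesis using exp_decay_sums[OF b, of C n] by (simp add: sums_iff)
qed

lemma tendsto_tail_sum_powr:
  assumes y: "regular_steps y" and b: "b > 0" and C: "\<And>n. partial_product y n \<le> C * exp (- b * real n)"
    and s: "s > 0" "b * s > ln 2"
  shows "(\<lambda>n. 2 ^ n * tail_sum y n powr s) \<longlonglongrightarrow> 0"
proof (rule tendsto_sandwich[where f="\<lambda>_. 0" and h="\<lambda>n. (C / (1 - exp (-b))) powr s * (2 * exp (- (b * s))) ^ n"])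
  let ?D = "C / (1 - exp (-b))"
  have C0: "C > 0"
  proof -
    have "0 < partial_product y 0" using y by (intro partial_product_pos) (auto simp: regular_steps_def)
    thus ?thesis using C[of 0] by simp
  qed
  have D: "?D > 0" using C0 b by simp
  have le: "2 ^ n * tail_sum y n powr s \<le> ?D powr s * (2 * exp (- (b * s))) ^ n" for n
  proof -
    have "tail_sum y n powr s \<le> (?D * exp (- b * real n)) powr s"
      using s tail_sum_nonneg[OF y] tail_sum_le_exp[OF y b C] by (intro powr_mono2) auto
    also have "\<dots> = ?D powr s * exp (- b * real n) powr s" by (rule powr_mult)
    also have "exp (- b * real n) powr s = exp (- (b * s)) ^ n"
      by (simp add: exp_powr_real exp_of_nat_mult[symmetric] mult_ac)
    finally have "2 ^ n * tail_sum y n powr s \<le> 2 ^ n * (?D powr s * exp (- (b * s)) ^ n)" by (rule mult_left_mono) simp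
    thus ?thesis by (simp add: power_mult_distrib mult_ac)
  qed
  show "\<forall>\<^sub>F n in sequentially. 2 ^ n * tail_sum y n powr s \<le> ?D powr s * (2 * exp (- (b * s))) ^ n"
    using le by (intro always_eventually allI)
  have "exp (ln 2) < exp (b * s)" unfolding exp_less_cancel_iff by (rule s(2))
  hence "2 * exp (- (b * s)) < 1" by (simp add: exp_minus field_simps)
  hence "(\<lambda>n. (2 * exp (- (b * s))) ^ n) \<longlonglongrightarrow> 0" by (intro LIMSEQ_realpow_zero) auto
  from tendsto_mult_right_zero[OF this] show "(\<lambda>n. ?D powr s * (2 * exp (- (b * s))) ^ n) \<longlonglongrightarrow> 0" .
qed auto

lemma AE_hausdorff_measure_subset_sums_zero:
  assumes \<theta>: "\<theta> > 0" and s: "s > \<theta> * ln 2"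
  shows "AE y in step_law \<theta>. hausdorff_measure s (subset_sums y) = 0"
proof -
  have s0: "s > 0" using s \<theta> by (intro less_trans[OF _ s]) simp
  have "ln 2 / s < 1 / \<theta>" using s s0 \<theta> by (simp add: field_simps)
  then obtain b where b: "ln 2 / s < b" "b < 1 / \<theta>" using dense by blast
  have "0 < ln 2 / s" using s0 by simp
  hence b0: "b > 0" using b(1) by linarith
  have bs: "b * s > ln 2" using b(1) s0 by (simp add: field_simps)
  show ?thesis
    using AE_regular_steps[OF \<theta>] AE_partial_product_upper[OF \<theta> b0 b(2)]
  proof eventually_elim
    case (elim y)
    note y = elim(1)
    obtain C where C: "\<And>n. partial_product y n \<le> C * exp (- b * real n)" using elim by blast
    have lim: "(\<lambda>n. ennreal (2 ^ n * tail_sum y n powr s)) \<longlonglongrightarrow> ennreal 0"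
      by (intro tendsto_ennrealI tendsto_tail_sum_powr[OF y b0 C s0 bs])
    have "hausdorff_premeasure s \<delta> (subset_sums y) \<le> ennreal 0" if \<delta>: "\<delta> > 0" for \<delta>
    proof (rule LIMSEQ_le_const[OF lim])
      obtain N where N: "\<And>n. n \<ge> N \<Longrightarrow> tail_sum y n < \<delta>"
        using suminf_exist_split[OF \<delta>, of "partial_product y"] y tail_sum_nonneg[OF y]
        by (auto simp: regular_steps_def tail_sum_def)
      show "\<exists>N. \<forall>n\<ge>N. hausdorff_premeasure s \<delta> (subset_sums y) \<le> ennreal (2 ^ n * tail_sum y n powr s)"
        using hausdorff_premeasure_subset_sums_le[OF y s0] N by (meson less_imp_le)
    qed
    hence "hausdorff_measure s (subset_sums y) \<le> 0"
      unfolding hausdorff_measure_def by (intro SUP_least) auto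
    thus ?case by simp
  qed
qed

lemma AE_hausdorff_dim_subset_sums_le:
  assumes \<theta>: "\<theta> > 0"
  shows "AE y in step_law \<theta>. hausdorff_dim (subset_sums y) \<le> ennreal (\<theta> * ln 2)"
proof -
  let ?d = "\<theta> * ln 2"
  have d: "?d > 0" using \<theta> by simp
  have "AE y in step_law \<theta>. \<forall>n. hausdorff_measure (?d + inverse (real (Suc n))) (subset_sums y) = 0"
    unfolding AE_all_countable by (intro allI AE_hausdorff_measure_subset_sums_zero \<theta>) simp
  thus ?thesis
  proof eventually_elim
    case (elim y)
    have "hausdorff_dim (subset_sums y) \<le> ennreal (?d + inverse (real (Suc n)))" for n
      unfolding hausdorff_dim_def using elim d by (intro INF_lower) (auto intro: add_nonneg_nonneg)
    moreover have "(\<lambda>n. ennreal (?d + inverse (real (Suc n)))) \<longlonglongrightarrow> ennreal (?d + 0)"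
      by (intro tendsto_ennrealI tendsto_add tendsto_const LIMSEQ_inverse_real_of_nat)
    ultimately have "hausdorff_dim (subset_sums y) \<le> ennreal (?d + 0)"
      by (intro LIMSEQ_le_const) auto
    thus ?case by simp
  qed
qed

section \<open>Hausdorff dimension from below\<close>

lemma dyadic_scale:
  fixes d :: real
  assumes "0 < d" "d \<le> 1"
  obtains m where "d \<le> (1/2) ^ m" "(1/2) ^ m < 2 * d"
proof -
  have ex: "\<exists>n. (1/2) ^ n < d" using real_arch_pow_inv[OF assms(1), of "1/2"] by simp
  define k where "k = (LEAST n. (1/2) ^ n < d)"
  have k: "(1/2) ^ k < d" unfolding k_def by (rule LeastI_ex[OF ex])
  have "k \<noteq> 0" using k assms by (intro notI) simp
  then obtain m where m: "k = Suc m" by (cases k) auto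
  have "\<not> (1/2) ^ m < d" using not_less_Least[of m "\<lambda>n. (1/2) ^ n < d"] m by (simp add: k_def)
  thus ?thesis using k m by (intro that[of m]) auto
qed

text \<open>A set of full measure meets, in positive mass, the set \<open>E K\<close> of points with a uniform constant \<open>K\<close>. A set \<open>U\<close> that
  contains such a point lies in a dyadic interval around it of length comparable to the diameter of \<open>U\<close>, so it
  carries mass at most a multiple of its weight. Sets of diameter 0 carry no mass because \<open>t > 0\<close>; and if \<open>s = 0\<close>, the
  weight of a nonempty set is 1, which still dominates the power \<open>t\<close> of its diameter.\<close>

proposition mass_distribution_principle:
  fixes \<mu> :: "real measure"
  assumes S: "sets \<mu> = sets borel" and P: "prob_space \<mu>" and st: "0 \<le> s" "s < t"
    and reg: "AE x in \<mu>. \<exists>K. \<forall>n. emeasure \<mu> {x - (1/2) ^ n..x + (1/2) ^ n} \<le> ennreal (K * 2 powr (- t * real n))"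
    and A: "- A \<in> null_sets \<mu>"
  shows "hausdorff_measure s A \<noteq> 0"
proof -
  interpret prob_space \<mu> by fact
  have sp: "space \<mu> = UNIV" using sets_eq_imp_space_eq[OF S] by simp
  note S[measurable_cong]
  have [measurable]: "A \<in> sets \<mu>" using A sp by (metis Compl_eq_Diff_UNIV double_complement null_setsD2 sets.compl_sets)
  define E where "E K = {x. \<forall>n. emeasure \<mu> {x - (1/2) ^ n..x + (1/2) ^ n} \<le> ennreal (real K * 2 powr (- t * real n))}" for K :: nat
  have Em[measurable]: "E K \<in> sets \<mu>" for K
  proof -
    have [measurable]: "(\<lambda>x. emeasure \<mu> {x - (1/2) ^ n..x + (1/2) ^ n}) \<in> borel_measurable borel" for n
    proof -
      have "(\<lambda>x. emeasure \<mu> {x..x + 2 * (1/2) ^ n}) \<circ> (\<lambda>x. x - (1/2) ^ n) \<in> borel_measurable borel"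
        by (rule measurable_comp[OF _ emeasure_window_measurable[OF S P]]) measurable
      thus ?thesis by (simp add: comp_def add.commute)
    qed
    have "Measurable.pred borel (\<lambda>x. \<forall>n. emeasure \<mu> {x - (1/2) ^ n..x + (1/2) ^ n} \<le> ennreal (real K * 2 powr (- t * real n)))"
      by measurable
    thus ?thesis unfolding E_def by (simp add: pred_def S)
  qed
  have "\<exists>K. emeasure \<mu> (E K \<inter> A) \<noteq> 0"
  proof (rule ccontr)
    assume "\<not> ?thesis"
    hence "\<And>K. E K \<inter> A \<in> null_sets \<mu>" by (auto simp: null_sets_def)
    hence "AE x in \<mu>. \<forall>K. x \<notin> E K \<inter> A" unfolding AE_all_countable by (intro allI AE_not_in)
    moreover have "AE x in \<mu>. x \<notin> - A" by (rule AE_not_in[OF A])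
    moreover note reg
    ultimately have "AE x in \<mu>. False"
    proof eventually_elim
      case (elim x)
      then obtain K where K: "\<And>n. emeasure \<mu> {x - (1/2) ^ n..x + (1/2) ^ n} \<le> ennreal (K * 2 powr (- t * real n))" by blast
      obtain k where "K \<le> real k" using real_arch_simple by blast
      hence le: "ennreal (K * 2 powr (- t * real n)) \<le> ennreal (real k * 2 powr (- t * real n))" for n
        by (intro ennreal_leI mult_right_mono) auto
      have "x \<in> E k" unfolding E_def by (intro CollectI allI order_trans[OF K le])
      thus ?case using elim by blast
    qed
    thus False using AE_False by (simp add: prob_space)
  qed
  then obtain K where K: "emeasure \<mu> (E K \<inter> A) \<noteq> 0" by blast
  define L where "L = real K * 2 powr t"
  have L: "L \<ge> 0" by (simp add: L_def)
  have cover: "emeasure \<mu> (E K \<inter> A) \<le> ennreal L * (\<Sum>n. hausdorff_weight s (U n))"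
    if U: "A \<subseteq> (\<Union>n. U n)" "\<And>n. bounded (U n)" "\<And>n. diameter (U n) \<le> 1" for U :: "nat \<Rightarrow> real set"
  proof -
    have "\<exists>V\<in>sets \<mu>. U n \<inter> (E K \<inter> A) \<subseteq> V \<and> emeasure \<mu> V \<le> ennreal L * hausdorff_weight s (U n)" for n
    proof (cases "U n \<inter> (E K \<inter> A) = {}")
      case True
      thus ?thesis by (intro bexI[of _ "{}"]) auto
    next
      case False
      then obtain x where x: "x \<in> U n" "x \<in> E K" by blast
      define d where "d = diameter (U n)"
      have d: "0 \<le> d" "d \<le> 1" using U(2,3)[of n] by (auto simp: d_def diameter_ge_0)
      have dist: "\<bar>z - x\<bar> \<le> d" if "z \<in> U n" for z
        using diameter_bounded_bound[OF U(2) that x(1)] by (simp add: d_def dist_real_def)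
      have Ex: "emeasure \<mu> {x - (1/2) ^ m..x + (1/2) ^ m} \<le> ennreal (real K * 2 powr (- t * real m))" for m
        using x(2) by (simp add: E_def)
      show ?thesis
      proof (cases "d = 0")
        case True
        hence sub: "U n \<subseteq> {x}" using dist by force
        have "(\<lambda>m. real K * (2 powr (- t)) ^ m) \<longlonglongrightarrow> real K * 0"
          using st powr_less_mono[of "- t" 0 2] by (intro tendsto_mult tendsto_const LIMSEQ_realpow_zero) auto
        moreover have "(2 powr (- t)) ^ m = 2 powr (- t * real m)" for m
          by (simp add: powr_power mult.commute)
        ultimately have "(\<lambda>m. ennreal (real K * 2 powr (- t * real m))) \<longlonglongrightarrow> ennreal 0"
          by (intro tendsto_ennrealI) simp
        hence "emeasure \<mu> {x} \<le> ennreal 0"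
        proof (rule LIMSEQ_le_const, intro exI allI impI)
          fix m :: nat
          have "emeasure \<mu> {x} \<le> emeasure \<mu> {x - (1/2) ^ m..x + (1/2) ^ m}" by (intro emeasure_mono) auto
          thus "emeasure \<mu> {x} \<le> ennreal (real K * 2 powr (- t * real m))" using Ex[of m] by (rule order_trans)
        qed
        thus ?thesis using sub by (intro bexI[of _ "{x}"]) auto
      next
        case False
        then obtain m where m: "d \<le> (1/2) ^ m" "(1/2) ^ m < 2 * d" using dyadic_scale[of d] d by auto
        have "2 powr (- t * real m) = ((1/2) ^ m) powr t" by (rule half_power_powr[symmetric])
        also have "\<dots> \<le> (2 * d) powr t" using m st by (intro powr_mono2) auto
        also have "\<dots> = 2 powr t * d powr t" by (rule powr_mult)
        finally have "real K * 2 powr (- t * real m) \<le> L * d powr t"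
          unfolding L_def mult.assoc by (intro mult_left_mono) auto
        hence "ennreal (real K * 2 powr (- t * real m)) \<le> ennreal L * ennreal (d powr t)"
          using L by (subst ennreal_mult[symmetric]) (auto intro: ennreal_leI)
        also have "ennreal (d powr t) \<le> hausdorff_weight s (U n)"
        proof (cases "s = 0")
          case True
          have "d powr t \<le> 1" using d st by (intro powr_le1) auto
          thus ?thesis using True x(1) by (auto simp: hausdorff_weight_def ennreal_le_1)
        next
          case False
          have "d powr t \<le> d powr s" using d st by (intro powr_mono') auto
          thus ?thesis using False x(1) by (auto simp: hausdorff_weight_def d_def intro: ennreal_leI)
        qed
        finally have w: "ennreal (real K * 2 powr (- t * real m)) \<le> ennreal L * hausdorff_weight s (U n)"
          by (simp add: mult_left_mono)
        have "U n \<subseteq> {x - (1/2) ^ m..x + (1/2) ^ m}"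
        proof
          fix z assume "z \<in> U n"
          hence "\<bar>z - x\<bar> \<le> (1/2) ^ m" by (rule order_trans[OF dist m(1)])
          thus "z \<in> {x - (1/2) ^ m..x + (1/2) ^ m}" unfolding abs_le_iff by (simp add: algebra_simps)
        qed
        thus ?thesis using order_trans[OF Ex w]
          by (intro bexI[of _ "{x - (1/2) ^ m..x + (1/2) ^ m}"]) auto
      qed
    qed
    then obtain V where V: "\<And>n. V n \<in> sets \<mu>" "\<And>n. U n \<inter> (E K \<inter> A) \<subseteq> V n"
        "\<And>n. emeasure \<mu> (V n) \<le> ennreal L * hausdorff_weight s (U n)"
      by metis
    have "emeasure \<mu> (E K \<inter> A) \<le> emeasure \<mu> (\<Union>n. V n)"
    proof (rule emeasure_mono)
      show "E K \<inter> A \<subseteq> (\<Union>n. V n)"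
      proof
        fix x assume x: "x \<in> E K \<inter> A"
        then obtain n where "x \<in> U n" using U(1) by blast
        hence "x \<in> V n" using V(2)[of n] x by blast
        thus "x \<in> (\<Union>n. V n)" by blast
      qed
      show "(\<Union>n. V n) \<in> sets \<mu>" using V(1) by blast
    qed
    also have "\<dots> \<le> (\<Sum>n. emeasure \<mu> (V n))"
      using V(1) by (intro emeasure_subadditive_countably) auto
    also have "\<dots> \<le> (\<Sum>n. ennreal L * hausdorff_weight s (U n))"
      by (intro suminf_le V(3)) auto
    finally show ?thesis by (simp add: ennreal_suminf_cmult)
  qed
  show ?thesis
  proof
    assume "hausdorff_measure s A = 0"
    moreover have "hausdorff_premeasure s 1 A \<le> hausdorff_measure s A"
      unfolding hausdorff_measure_def by (intro SUP_upper) auto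
    ultimately have p0: "hausdorff_premeasure s 1 A = 0" by simp
    have "emeasure \<mu> (E K \<inter> A) \<le> 0 + ennreal e" if e: "e > 0" for e
    proof -
      have "hausdorff_premeasure s 1 A < ennreal (e / (L + 1))" using p0 e L by simp
      then obtain U where U: "A \<subseteq> (\<Union>n. U n)" "\<And>n. bounded (U n)" "\<And>n. diameter (U n) \<le> 1"
          and lt: "(\<Sum>n. hausdorff_weight s (U n)) < ennreal (e / (L + 1))"
        unfolding hausdorff_premeasure_def INF_less_iff by blast
      have "emeasure \<mu> (E K \<inter> A) \<le> ennreal L * (\<Sum>n. hausdorff_weight s (U n))"
        by (rule cover[OF U])
      also have "\<dots> \<le> ennreal L * ennreal (e / (L + 1))"
        using lt by (intro mult_left_mono) auto
      also have "\<dots> = ennreal (L * (e / (L + 1)))" using L e by (intro ennreal_mult[symmetric]) auto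
      also have "\<dots> \<le> ennreal e"
        using L e by (intro ennreal_leI) (simp add: field_simps)
      finally show ?thesis by simp
    qed
    hence "emeasure \<mu> (E K \<inter> A) \<le> 0" by (rule ennreal_le_epsilon)
    thus False using K by simp
  qed
qed

text \<open>The series is the integral over \<open>x\<close> of \<open>\<Sum>n. 2 powr (t * n) * \<mu> {x - (1/2) ^ n..x + (1/2) ^ n}\<close>; where this sum is finite, it
  bounds each of its terms.\<close>

lemma AE_dyadic_regularity:
  fixes \<mu> :: "real measure"
  assumes S: "sets \<mu> = sets borel" and P: "prob_space \<mu>"
    and fin: "(\<Sum>n. ennreal (2 powr (t * real n)) * pair_energy (dyadic_box n) \<mu>) < \<infinity>"
  shows "AE x in \<mu>. \<exists>K. \<forall>n. emeasure \<mu> {x - (1/2) ^ n..x + (1/2) ^ n} \<le> ennreal (K * 2 powr (- t * real n))"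
proof -
  interpret prob_space \<mu> by fact
  note S[measurable_cong]
  let ?B = "\<lambda>n x. emeasure \<mu> {x - (1/2) ^ n..x + (1/2) ^ n :: real}"
  have B: "(\<integral>\<^sup>+x'. dyadic_box n (x - x') \<partial>\<mu>) = ?B n x" for n x
  proof -
    have "?B n x = (\<integral>\<^sup>+x'. indicator {x - (1/2) ^ n..x + (1/2) ^ n} x' \<partial>\<mu>)"
      using S by (intro nn_integral_indicator[symmetric]) simp
    also have "\<dots> = (\<integral>\<^sup>+x'. dyadic_box n (x - x') \<partial>\<mu>)"
      by (intro nn_integral_cong) (auto simp: indicator_def)
    finally show ?thesis ..
  qed
  have Bm[measurable]: "?B n \<in> borel_measurable \<mu>" for n
    unfolding B[symmetric] by measurable
  have "(\<integral>\<^sup>+x. (\<Sum>n. ennreal (2 powr (t * real n)) * ?B n x) \<partial>\<mu>)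
      = (\<Sum>n. ennreal (2 powr (t * real n)) * pair_energy (dyadic_box n) \<mu>)"
    unfolding pair_energy_def B by (subst nn_integral_suminf) (auto simp: nn_integral_cmult)
  also note fin
  finally have "AE x in \<mu>. (\<Sum>n. ennreal (2 powr (t * real n)) * ?B n x) \<noteq> \<infinity>"
    by (intro nn_integral_PInf_AE) auto
  thus ?thesis
  proof eventually_elim
    case (elim x)
    then obtain K where K: "K \<ge> 0" "(\<Sum>n. ennreal (2 powr (t * real n)) * ?B n x) = ennreal K"
      by (cases "(\<Sum>n. ennreal (2 powr (t * real n)) * ?B n x)") auto
    have "?B n x \<le> ennreal (K * 2 powr (- t * real n))" for n
    proof -
      have "ennreal (2 powr (t * real n)) * ?B n x \<le> (\<Sum>n. ennreal (2 powr (t * real n)) * ?B n x)"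
        using sum_le_suminf[of "\<lambda>n. ennreal (2 powr (t * real n)) * ?B n x" "{n}"] by simp
      hence "ennreal (2 powr (- t * real n)) * (ennreal (2 powr (t * real n)) * ?B n x) \<le> ennreal (2 powr (- t * real n)) * ennreal K"
        unfolding K(2) by (rule mult_left_mono) simp
      moreover have "ennreal (2 powr (- t * real n)) * (ennreal (2 powr (t * real n)) * ?B n x) = ?B n x"
        by (simp add: mult.assoc[symmetric] ennreal_mult[symmetric] powr_add[symmetric])
      ultimately show ?thesis using K(1) by (simp add: ennreal_mult[symmetric] mult.commute)
    qed
    thus ?case by blast
  qed
qed

text \<open>Countably many exponents increasing to \<open>\<theta> * ln 2\<close> suffice, so one null set of steps serves all sets \<open>A\<close>.\<close>

lemma AE_hausdorff_dim_lower:
  assumes \<theta>: "\<theta> > 0" "\<theta> \<le> 1 / ln 2"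
  shows "AE y in step_law \<theta>. \<forall>A. - A \<in> null_sets (masked_law UNIV y) \<longrightarrow> ennreal (\<theta> * ln 2) \<le> hausdorff_dim A"
proof -
  let ?d = "\<theta> * ln 2"
  have d: "?d > 0" "?d \<le> 1" using \<theta> by (auto simp: field_simps)
  define t where "t n = ?d * (1 - inverse (real (Suc (Suc n))))" for n
  have t: "0 \<le> t n" "t n < ?d" "t n < 1" for n
  proof -
    have i: "0 < inverse (real (Suc (Suc n)))" "inverse (real (Suc (Suc n))) \<le> 1" by (auto simp: field_simps)
    show "0 \<le> t n" unfolding t_def using i \<theta>(1) by (intro mult_nonneg_nonneg) auto
    have "t n < ?d * 1" unfolding t_def using i d by (intro mult_strict_left_mono) auto
    thus "t n < ?d" by simp
    thus "t n < 1" using d(2) by linarith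
  qed
  have tlim: "t \<longlonglongrightarrow> ?d"
  proof -
    have "(\<lambda>n. ?d * (1 - inverse (real (Suc (Suc n))))) \<longlonglongrightarrow> ?d * (1 - 0)"
      by (intro tendsto_mult tendsto_diff tendsto_const LIMSEQ_Suc[OF LIMSEQ_inverse_real_of_nat])
    thus ?thesis by (simp add: t_def[abs_def])
  qed
  have "AE y in step_law \<theta>. \<forall>n. (\<Sum>m. ennreal (2 powr (t n * real m)) * 
            pair_energy (dyadic_box m) (masked_law UNIV y)) < \<infinity>"
    unfolding AE_all_countable by (intro allI AE_summable_near_diagonal_mass \<theta> t)
  thus ?thesis
  proof eventually_elim
    case (elim y)
    show ?case
    proof (intro allI impI)
      fix A :: "real set" assume A: "- A \<in> null_sets (masked_law UNIV y)"
      show "ennreal ?d \<le> hausdorff_dim A"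
        unfolding hausdorff_dim_def
      proof (rule INF_greatest, clarify)
        fix s assume s: "0 \<le> s" "hausdorff_measure s A = 0"
        show "ennreal ?d \<le> ennreal s"
        proof (rule ccontr)
          assume "\<not> ?thesis"
          hence "s < ?d" using s(1) by (metis ennreal_leI not_le)
          then obtain n where "s < t n"
            using order_tendstoD(1)[OF tlim] by (auto simp: eventually_sequentially)
          moreover have "(\<Sum>m. ennreal (2 powr (t n * real m)) * 
            pair_energy (dyadic_box m) (masked_law UNIV y)) < \<infinity>" using elim by blast
          ultimately have "hausdorff_measure s A \<noteq> 0"
            using mass_distribution_principle[OF sets_masked_law prob_space_masked_law s(1) _ _ A, of "t n"]
              AE_dyadic_regularity[OF sets_masked_law prob_space_masked_law] by blast
          thus False using s(2) by simp
        qed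
      qed
    qed
  qed
qed


section \<open>The critical exponent\<close>

lemma emeasure_power_law_atLeast:
  assumes "\<theta> > 0" "0 < t" "t \<le> 1"
  shows "emeasure (power_law \<theta>) {t..} = ennreal (1 - t powr \<theta>)"
proof -
  have "emeasure (power_law \<theta>) {t..} = (\<integral>\<^sup>+u. indicator {t..} (u powr (1/\<theta>)) * indicator {0..1} u \<partial>lborel)"
    by (subst nn_integral_power_law[symmetric]) (auto simp: nn_integral_indicator)
  also have "\<dots> = (\<integral>\<^sup>+u. indicator {t powr \<theta>..1} u \<partial>lborel)"
  proof (rule nn_integral_cong)
    fix u :: real
    have tp: "0 < t powr \<theta>" "(t powr \<theta>) powr (1/\<theta>) = t" using assms by (auto simp: powr_powr)
    have "t \<le> u powr (1/\<theta>) \<longleftrightarrow> t powr \<theta> \<le> u" if "u \<ge> 0"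
    proof
      assume "t \<le> u powr (1/\<theta>)"
      hence "t powr \<theta> \<le> (u powr (1/\<theta>)) powr \<theta>" using assms by (intro powr_mono2) auto
      thus "t powr \<theta> \<le> u" using assms that by (simp add: powr_powr)
    next
      assume "t powr \<theta> \<le> u"
      hence "(t powr \<theta>) powr (1/\<theta>) \<le> u powr (1/\<theta>)" using assms tp(1) by (intro powr_mono2) auto
      thus "t \<le> u powr (1/\<theta>)" by (simp only: tp)
    qed
    moreover have "u \<ge> 0" if "t powr \<theta> \<le> u" using that tp(1) by linarith
    ultimately show "indicator {t..} (u powr (1/\<theta>)) * indicator {0..1} u = (indicator {t powr \<theta>..1} u :: ennreal)"
      by (auto simp: indicator_def)
  qed
  also have "\<dots> = ennreal (1 - t powr \<theta>)" using assms by (simp add: powr_le1)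
  finally show ?thesis .
qed

text \<open>This identifies the mean and the variance of the increments of \<open>ln X\<^sub>k\<close>.\<close>

lemma neg_ln_exponential:
  assumes \<theta>: "\<theta> > 0"
  shows "distributed (power_law \<theta>) lborel (\<lambda>u. - ln u) (exponential_density \<theta>)"
proof (rule exponential_distributedI[OF _ \<theta>])
  fix a :: real assume a: "0 \<le> a"
  have iff: "- ln u \<le> a \<longleftrightarrow> exp (- a) \<le> u" if "u > 0" for u
    using that ln_ge_iff[of u "- a"] by auto
  have "emeasure (power_law \<theta>) {u \<in> space (power_law \<theta>). - ln u \<le> a} = emeasure (power_law \<theta>) {exp (- a)..}"
    by (rule emeasure_eq_AE, use AE_power_law[OF \<theta>] in eventually_elim) (use iff in auto)
  also have "\<dots> = ennreal (1 - exp (- a) powr \<theta>)"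
    using a \<theta> by (intro emeasure_power_law_atLeast) auto
  also have "\<dots> = 1 - ennreal (exp (- a * \<theta>))"
    using ennreal_minus[of "exp (- a * \<theta>)" 1] by (simp add: exp_powr_real)
  finally show "emeasure (power_law \<theta>) {u \<in> space (power_law \<theta>). - ln u \<le> a} = 1 - ennreal (exp (- a * \<theta>))" .
qed measurable

lemma distr_step_law_component: "distr (step_law \<theta>) borel (\<lambda>y. y i) = power_law \<theta>"
proof -
  interpret product_prob_space "\<lambda>_. power_law \<theta>" "UNIV :: nat set"
    by (intro product_prob_spaceI prob_space_power_law)
  have "distr (step_law \<theta>) borel (\<lambda>y. y i) = distr (step_law \<theta>) (power_law \<theta>) (\<lambda>y. y i)"
    by (intro distr_cong) auto
  thus ?thesis using PiM_component[of i] by simp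
qed

definition shift_seq :: "nat \<Rightarrow> (nat \<Rightarrow> real) \<Rightarrow> nat \<Rightarrow> real" where
  "shift_seq m y = (\<lambda>i. y (i + m))"

lemma shift_seq_measurable [measurable]: "shift_seq m \<in> seq_borel \<rightarrow>\<^sub>M seq_borel"
  unfolding shift_seq_def by (rule measurable_PiM_single') auto

lemma distr_shift_seq: "distr (step_law \<theta>) (step_law \<theta>) (shift_seq m) = step_law \<theta>"
proof -
  have "(\<lambda>y. \<lambda>n\<in>UNIV. y (n + m)) = shift_seq m" by (simp add: shift_seq_def fun_eq_iff)
  thus ?thesis using distr_PiM_reindex[of UNIV "\<lambda>_. power_law \<theta>" "\<lambda>i. i + m" UNIV]
    by (simp add: prob_space_power_law inj_on_def)
qed

lemma partial_product_shift:
  "partial_product y (i + m) = (\<Prod>j<m. y j) * partial_product (shift_seq m y) i"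
proof (induction i)
  case 0
  show ?case by (simp add: partial_product_def shift_seq_def lessThan_Suc_atMost[symmetric])
next
  case (Suc i)
  show ?case using Suc partial_product_Suc[of y "i + m"]
    by (simp add: partial_product_Suc) (simp add: shift_seq_def)
qed

lemma regular_steps_shift:
  assumes "regular_steps y" shows "regular_steps (shift_seq m y)"
proof -
  have "(\<Prod>j<m. y j) \<noteq> 0" using assms by (auto simp: regular_steps_def prod_zero_iff less_imp_neq[symmetric])
  moreover have "summable (\<lambda>i. (\<Prod>j<m. y j) * partial_product (shift_seq m y) i)"
    unfolding partial_product_shift[symmetric] using assms
    by (intro summable_ignore_initial_segment) (auto simp: regular_steps_def)
  ultimately have "summable (partial_product (shift_seq m y))" by simp
  thus ?thesis using assms by (auto simp: regular_steps_def shift_seq_def)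
qed

lemma tail_sum_shift:
  assumes "regular_steps y"
  shows "tail_sum y (n + m) = (\<Prod>j<m. y j) * tail_sum (shift_seq m y) n"
proof -
  have "summable (\<lambda>i. partial_product (shift_seq m y) (i + n))"
    using regular_steps_shift[OF assms, of m] by (intro summable_ignore_initial_segment) (simp add: regular_steps_def)
  from suminf_mult[OF this, of "\<Prod>j<m. y j"] show ?thesis
    unfolding tail_sum_def partial_product_shift[symmetric] by (simp add: add.assoc)
qed

lemma tail_sum_measurable [measurable (raw)]:
  assumes [measurable]: "f \<in> M \<rightarrow>\<^sub>M seq_borel"
  shows "(\<lambda>x. tail_sum (f x) n) \<in> borel_measurable M"
  unfolding tail_sum_def by measurable

text \<open>For \<open>\<theta> = 1 / ln 2\<close> the variable \<open>- ln Y\<close> is exponential with mean and standard deviation \<open>ln 2\<close>, so the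
  increments \<open>ln 2 + ln Y\<close> are centred.\<close>

lemma critical_walk_clt:
  assumes \<theta>: "\<theta> = 1 / ln 2"
  shows "weak_conv_m (\<lambda>n. distr (step_law \<theta>) borel (\<lambda>y. (\<Sum>i<n. ln 2 + ln (y i)) / sqrt (real n * (ln 2)\<^sup>2))) std_normal_distribution"
proof -
  have \<theta>0: "\<theta> > 0" using \<theta> by simp
  interpret D: prob_space "power_law \<theta>" by (rule prob_space_power_law)
  interpret P: prob_space "step_law \<theta>" by (rule prob_space_step_law)
  let ?g = "\<lambda>u::real. ln 2 + ln u"
  note dist = neg_ln_exponential[OF \<theta>0]
  have ex: "D.expectation (\<lambda>u. - ln u) = ln 2"
    using D.exponential_distributed_expectation[OF \<theta>0 dist] \<theta> by simp
  have var: "D.variance (\<lambda>u. - ln u) = (ln 2)\<^sup>2"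
    using D.exponential_distributed_variance[OF \<theta>0 dist] \<theta> by (simp add: power_divide)
  have sq: "(- ln u - ln 2)\<^sup>2 = (?g u)\<^sup>2" for u :: real by (simp add: power2_eq_square algebra_simps)
  have var2: "D.expectation (\<lambda>u. (?g u)\<^sup>2) = (ln 2)\<^sup>2" using var unfolding ex sq .
  \<comment> \<open>The integral of a function that is not integrable is 0 by convention, so a nonzero value proves integrability.\<close>
  have int2: "integrable (power_law \<theta>) (\<lambda>u. (?g u)\<^sup>2)"
    using var2 not_integrable_integral_eq by fastforce
  have intl: "integrable (power_law \<theta>) (\<lambda>u. - ln u)"
    using ex not_integrable_integral_eq[of "power_law \<theta>" "\<lambda>u. - ln u"] by fastforce
  hence intl': "integrable (power_law \<theta>) ln" using integrable_minus[of "power_law \<theta>" "\<lambda>u. - ln u"] by simp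
  have exg: "D.expectation ?g = 0"
    using ex intl' D.prob_space by simp
  have tr: "integral\<^sup>L (step_law \<theta>) (\<lambda>y. h (y i)) = integral\<^sup>L (power_law \<theta>) h"
    if [measurable]: "h \<in> borel_measurable borel" for h :: "real \<Rightarrow> real" and i
    by (subst distr_step_law_component[of \<theta> i, symmetric]) (simp add: integral_distr)
  show ?thesis
  proof (rule P.central_limit_theorem_zero_mean[where \<mu>="distr (power_law \<theta>) borel ?g"])
    show "P.indep_vars (\<lambda>i. borel) (\<lambda>i y. ?g (y i)) UNIV"
      by (rule P.indep_vars_compose2[OF indep_vars_coordinates[of "power_law \<theta>"]]) (auto simp: prob_space_power_law)
    show e0: "P.expectation (\<lambda>y. ?g (y n)) = 0" for n using tr[of ?g n] exg by simp
    show "integrable (step_law \<theta>) (\<lambda>y. (?g (y n))\<^sup>2)" for n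
    proof -
      have "integrable (distr (step_law \<theta>) borel (\<lambda>y. y n)) (\<lambda>u. (?g u)\<^sup>2)"
        using int2 by (simp only: distr_step_law_component)
      thus ?thesis by (rule integrable_distr[rotated]) simp
    qed
    show "P.variance (\<lambda>y. ?g (y n)) = (ln 2)\<^sup>2" for n
      using tr[of "\<lambda>u. (?g u)\<^sup>2" n] var2 unfolding e0 by simp
    show "distr (step_law \<theta>) borel (\<lambda>y. ?g (y n)) = distr (power_law \<theta>) borel ?g" for n
      by (subst distr_step_law_component[of \<theta> n, symmetric]) (simp add: distr_distr comp_def)
  qed simp
qed

lemma cdf_std_normal_pos: "cdf std_normal_distribution x > 0"
proof -
  interpret real_distribution std_normal_distribution by (rule real_dist_normal_dist)
  have "emeasure std_normal_distribution {..x} \<noteq> 0"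
  proof
    assume "emeasure std_normal_distribution {..x} = 0"
    hence "(\<integral>\<^sup>+t. ennreal (std_normal_density t) * indicator {..x} t \<partial>lborel) = 0"
      by (simp add: emeasure_density)
    hence "AE t in lborel. ennreal (std_normal_density t) * indicator {..x} t = 0"
      by (subst (asm) nn_integral_0_iff_AE) auto
    moreover have "ennreal (std_normal_density t) \<noteq> 0" for t using normal_density_pos[of 1 0 t] by simp
    ultimately have "AE t in lborel. t \<notin> {..x}"
      by (elim eventually_mono) (simp add: indicator_def split: if_splits)
    hence "emeasure lborel {..x} = 0"
      by (subst (asm) AE_iff_measurable[where N="{..x}"]) auto
    moreover have "emeasure lborel {x - 1..x} \<le> emeasure lborel {..x}" by (intro emeasure_mono) auto
    ultimately show False by simp
  qed
  thus ?thesis unfolding cdf_def by (simp add: emeasure_eq_measure zero_less_measure_iff)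
qed

lemma cdf_std_normal_isCont: "isCont (cdf std_normal_distribution) x"
proof -
  interpret real_distribution std_normal_distribution by (rule real_dist_normal_dist)
  have "emeasure std_normal_distribution {x} = 0"
    by (simp add: emeasure_density nn_integral_0_iff_AE)
  thus ?thesis by (simp add: isCont_cdf measure_def)
qed

text \<open>The total length of the intervals of the \<open>n\<close>-th generation has lower limit 0. Infinitely many \<open>n\<close> are asked for in
  place of a single one, so that the property does not change when finitely many steps are removed.\<close>

definition vanishing_covers :: "(nat \<Rightarrow> real) \<Rightarrow> bool" where
  "vanishing_covers y \<longleftrightarrow> (\<forall>k m. \<exists>n\<ge>m. 2 ^ n * tail_sum y n \<le> inverse (real (Suc k)))"

lemma vanishing_covers_pred [measurable]: "Measurable.pred seq_borel vanishing_covers"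
  unfolding vanishing_covers_def by measurable

lemma null_subset_sums_of_vanishing_covers:
  assumes y: "regular_steps y" and v: "vanishing_covers y"
  shows "emeasure lborel (subset_sums y) = 0"
proof -
  have "emeasure lborel (subset_sums y) \<le> 0 + ennreal e" if e: "e > 0" for e
  proof -
    obtain k where k: "inverse (real (Suc k)) < e" using reals_Archimedean[OF e] by auto
    obtain n where "2 ^ n * tail_sum y n \<le> inverse (real (Suc k))" using v unfolding vanishing_covers_def by blast
    hence "2 ^ n * tail_sum y n \<le> e" using k by simp
    thus ?thesis using emeasure_subset_sums_le[OF y, of n] by (simp add: order_trans[OF _ ennreal_leI])
  qed
  hence "emeasure lborel (subset_sums y) \<le> 0" by (rule ennreal_le_epsilon)
  thus ?thesis by simp
qed

text \<open>Removal of the first \<open>m\<close> steps multiplies all later total lengths by one positive constant.\<close>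

lemma vanishing_covers_shift:
  assumes y: "regular_steps y"
  shows "vanishing_covers (shift_seq m y) \<longleftrightarrow> vanishing_covers y"
proof -
  define c where "c = 2 ^ m * (\<Prod>j<m. y j)"
  have c: "c > 0" using y by (auto simp: c_def regular_steps_def intro!: mult_pos_pos prod_pos)
  have eq: "2 ^ (n + m) * tail_sum y (n + m) = c * (2 ^ n * tail_sum (shift_seq m y) n)" for n
    by (simp add: tail_sum_shift[OF y] c_def power_add)
  show ?thesis
  proof
    assume L: "vanishing_covers (shift_seq m y)"
    show "vanishing_covers y" unfolding vanishing_covers_def
    proof (intro allI)
      fix k m'
      obtain k' where k': "inverse (real (Suc k')) < inverse (real (Suc k)) / c"
        using reals_Archimedean[of "inverse (real (Suc k)) / c"] c by auto
      obtain n where n: "n \<ge> m'" "2 ^ n * tail_sum (shift_seq m y) n \<le> inverse (real (Suc k'))"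
        using L unfolding vanishing_covers_def by blast
      have "c * (2 ^ n * tail_sum (shift_seq m y) n) \<le> c * (inverse (real (Suc k)) / c)"
        using n(2) k' c by (intro mult_left_mono) auto
      hence "2 ^ (n + m) * tail_sum y (n + m) \<le> inverse (real (Suc k))" unfolding eq using c by simp
      thus "\<exists>n\<ge>m'. 2 ^ n * tail_sum y n \<le> inverse (real (Suc k))" using n(1) by (intro exI[of _ "n + m"]) simp
    qed
  next
    assume R: "vanishing_covers y"
    show "vanishing_covers (shift_seq m y)" unfolding vanishing_covers_def
    proof (intro allI)
      fix k m'
      obtain k' where k': "inverse (real (Suc k')) < c * inverse (real (Suc k))"
        using reals_Archimedean[of "c * inverse (real (Suc k))"] c by auto
      obtain n0 where n0: "n0 \<ge> m' + m" "2 ^ n0 * tail_sum y n0 \<le> inverse (real (Suc k'))"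
        using R unfolding vanishing_covers_def by blast
      define n where "n = n0 - m"
      have nn: "n0 = n + m" "n \<ge> m'" using n0(1) by (auto simp: n_def)
      have "c * (2 ^ n * tail_sum (shift_seq m y) n) \<le> c * inverse (real (Suc k))"
        using n0(2) k' unfolding nn(1) eq by linarith
      hence "2 ^ n * tail_sum (shift_seq m y) n \<le> inverse (real (Suc k))" using c by simp
      thus "\<exists>n\<ge>m'. 2 ^ n * tail_sum (shift_seq m y) n \<le> inverse (real (Suc k))" using nn(2) by blast
    qed
  qed
qed

text \<open>The event that \<open>vanishing_covers\<close> holds for all sufficiently late shifts of the steps is a tail event in the literal
  sense, and for regular steps it coincides with \<open>vanishing_covers\<close> itself.\<close>

lemma vanishing_covers_zero_one:
  assumes \<theta>: "\<theta> > 0" and pos: "\<not> (AE y in step_law \<theta>. \<not> vanishing_covers y)"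
  shows "AE y in step_law \<theta>. vanishing_covers y"
proof -
  interpret P: prob_space "step_law \<theta>" by (rule prob_space_step_law)
  define A where "A i = sigma_sets (space (step_law \<theta>)) {(\<lambda>y. y i) -` B \<inter> space (step_law \<theta>) | B. B \<in> sets (borel :: real measure)}" for i :: nat
  have ind: "P.indep_sets A UNIV"
    using indep_vars_coordinates[of "power_law \<theta>"] unfolding P.indep_vars_def A_def by (simp add: prob_space_power_law)
  \<comment> \<open>Only the shifts by at least \<open>n\<close> matter here, for any \<open>n\<close>; so \<open>T\<close> is determined by the coordinates from \<open>n\<close> on.\<close>
  define T where "T = {y. \<exists>m. \<forall>l\<ge>m. vanishing_covers (shift_seq l y)}"
  have tail: "T \<in> P.tail_events A"
    unfolding P.tail_events_def
  proof (rule INT_I)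
    fix n :: nat
    define G where "G = sigma (UNIV :: (nat \<Rightarrow> real) set) (\<Union> (A ` {n..}))"
    have sub: "\<Union> (A ` {n..}) \<subseteq> Pow UNIV" by simp
    have sG: "sets G = sigma_sets UNIV (\<Union> (A ` {n..}))" unfolding G_def by (rule sets_measure_of[OF sub])
    have spG: "space G = UNIV" unfolding G_def by (rule space_measure_of[OF sub])
    have coord: "(\<lambda>y. y i) \<in> borel_measurable G" if "i \<ge> n" for i
    proof (rule measurableI)
      fix B :: "real set" assume "B \<in> sets borel"
      hence "(\<lambda>y. y i) -` B \<inter> UNIV \<in> A i" unfolding A_def by (auto intro!: sigma_sets.Basic)
      thus "(\<lambda>y. y i) -` B \<inter> space G \<in> sets G" using that unfolding sG spG by (auto intro!: sigma_sets.Basic)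
    qed auto
    have sh: "shift_seq l \<in> G \<rightarrow>\<^sub>M seq_borel" if "l \<ge> n" for l
      unfolding shift_seq_def using that by (intro measurable_PiM_single' coord) auto
    have pr: "Measurable.pred G (\<lambda>y. vanishing_covers (shift_seq (l + n) y))" for l
      by (rule measurable_compose[OF sh vanishing_covers_pred]) simp
    have "Measurable.pred G (\<lambda>y. \<exists>m. \<forall>l. l \<ge> m \<longrightarrow> vanishing_covers (shift_seq (l + n) y))"
      using pr by (intro pred_intros_countable pred_intros_logic) auto
    moreover have "(\<exists>m. \<forall>l\<ge>m. vanishing_covers (shift_seq l y)) \<longleftrightarrow> (\<exists>m. \<forall>l. l \<ge> m \<longrightarrow> vanishing_covers (shift_seq (l + n) y))" for y
    proof
      assume "\<exists>m. \<forall>l\<ge>m. vanishing_covers (shift_seq l y)"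
      thus "\<exists>m. \<forall>l. l \<ge> m \<longrightarrow> vanishing_covers (shift_seq (l + n) y)" by (meson trans_le_add1)
    next
      assume "\<exists>m. \<forall>l. l \<ge> m \<longrightarrow> vanishing_covers (shift_seq (l + n) y)"
      then obtain m where m: "\<And>l. l \<ge> m \<Longrightarrow> vanishing_covers (shift_seq (l + n) y)" by blast
      have "vanishing_covers (shift_seq l y)" if "l \<ge> m + n" for l using m[of "l - n"] that by simp
      thus "\<exists>m. \<forall>l\<ge>m. vanishing_covers (shift_seq l y)" by blast
    qed
    ultimately have "T \<in> sets G" unfolding T_def by (simp add: pred_def spG)
    thus "T \<in> sigma_sets (space (step_law \<theta>)) (\<Union> (A ` {n..}))" using sG by simp
  qed
  have "P.prob T = 0 \<or> P.prob T = 1"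
  proof (rule P.kolmogorov_0_1_law[OF _ ind tail])
    show "sigma_algebra (space (step_law \<theta>)) (A i)" for i unfolding A_def by (rule sigma_algebra_sigma_sets) auto
  qed
  moreover have TE: "T \<in> sets (step_law \<theta>)"
  proof -
    have "A i \<subseteq> P.events" for i using ind unfolding P.indep_sets_def by blast
    hence "P.tail_events A \<subseteq> P.events" by (rule P.tail_events_sets)
    thus ?thesis using tail by blast
  qed
  moreover have iff: "AE y in step_law \<theta>. y \<in> T \<longleftrightarrow> vanishing_covers y"
    using AE_regular_steps[OF \<theta>]
    by eventually_elim (auto simp: T_def vanishing_covers_shift)
  moreover have "P.prob T \<noteq> 0"
  proof
    assume "P.prob T = 0"
    hence "AE y in step_law \<theta>. y \<notin> T" using TE P.prob_eq_0 by (metis)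
    with iff have "AE y in step_law \<theta>. \<not> vanishing_covers y" by eventually_elim auto
    thus False using pos by simp
  qed
  ultimately have "AE y in step_law \<theta>. y \<in> T" by (metis P.AE_prob_1)
  with iff show ?thesis by eventually_elim auto
qed

text \<open>The total length is \<open>exp (S n y)\<close> times the sum \<open>D\<close> of the series for the shifted steps. By the central limit
  theorem, \<open>S n y \<le> - sqrt n * ln 2\<close> with probability bounded away from 0, and \<open>D\<close> exceeds a large constant with
  smaller probability by stationarity. So both events occur together for infinitely many \<open>n\<close> with positive
  probability, which the zero-one law raises to 1.\<close>

lemma critical_vanishing_covers:
  assumes \<theta>: "\<theta> = 1 / ln 2"
  shows "AE y in step_law \<theta>. vanishing_covers y"
proof (rule vanishing_covers_zero_one)
  show \<theta>0: "\<theta> > 0" using \<theta> by simp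
  interpret P: prob_space "step_law \<theta>" by (rule prob_space_step_law)
  define S where "S n y = (\<Sum>i<n. ln 2 + ln (y i :: real))" for n and y :: "nat \<Rightarrow> real"
  have Sm[measurable]: "S n \<in> borel_measurable (step_law \<theta>)" for n unfolding S_def by measurable
  define p where "p = cdf std_normal_distribution (- 1)"
  have p: "p > 0" unfolding p_def by (rule cdf_std_normal_pos)
  have "(\<lambda>n. cdf (distr (step_law \<theta>) borel (\<lambda>y. S n y / sqrt (real n * (ln 2)\<^sup>2))) (- 1)) \<longlonglongrightarrow> p"
    using critical_walk_clt[OF \<theta>] cdf_std_normal_isCont unfolding weak_conv_m_def weak_conv_def p_def S_def by blast
  moreover have "cdf (distr (step_law \<theta>) borel (\<lambda>y. S n y / sqrt (real n * (ln 2)\<^sup>2))) (- 1) = P.prob {y. S n y / sqrt (real n * (ln 2)\<^sup>2) \<le> - 1}" for n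
    unfolding cdf_def by (subst measure_distr) (auto simp: vimage_def)
  ultimately have "eventually (\<lambda>n. P.prob {y. S n y / sqrt (real n * (ln 2)\<^sup>2) \<le> - 1} > p / 2) sequentially"
    using p by (intro order_tendstoD(1)[of _ p]) auto
  then obtain N where N: "\<And>n. n \<ge> N \<Longrightarrow> P.prob {y. S n y / sqrt (real n * (ln 2)\<^sup>2) \<le> - 1} > p / 2"
    by (auto simp: eventually_sequentially)
  define D where "D y = tail_sum y 0" for y
  have Dm[measurable]: "D \<in> borel_measurable (step_law \<theta>)" unfolding D_def by measurable
  interpret Dd: real_distribution "distr (step_law \<theta>) borel D" by (rule P.real_distribution_distr) measurable
  have "eventually (\<lambda>k. cdf (distr (step_law \<theta>) borel D) k > 1 - p / 4) at_top"
    using p by (intro order_tendstoD(1)[OF Dd.cdf_lim_at_top_prob]) auto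
  then obtain K0 where K0: "\<And>k. k \<ge> K0 \<Longrightarrow> cdf (distr (step_law \<theta>) borel D) k > 1 - p / 4"
    by (auto simp: eventually_at_top_linorder)
  define K where "K = max K0 1"
  have K1: "K \<ge> 1" and KK: "P.prob {y. D y \<le> K} > 1 - p / 4"
    using K0[of K] unfolding cdf_def by (auto simp: K_def measure_distr vimage_def)
  have DK: "P.prob {y. D (shift_seq n y) \<le> K} > 1 - p / 4" for n
  proof -
    have [measurable]: "shift_seq n \<in> step_law \<theta> \<rightarrow>\<^sub>M step_law \<theta>" by measurable
    have "P.prob {y. D y \<le> K} = measure (distr (step_law \<theta>) (step_law \<theta>) (shift_seq n)) {y. D y \<le> K}"
      by (simp add: distr_shift_seq)
    also have "\<dots> = P.prob {y. D (shift_seq n y) \<le> K}"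
    proof (subst measure_distr)
      have "{y \<in> space (step_law \<theta>). D y \<le> K} \<in> sets (step_law \<theta>)" by measurable
      thus "{y. D y \<le> K} \<in> sets (step_law \<theta>)" by simp
    qed (auto simp: vimage_def)
    finally show ?thesis using KK by simp
  qed
  define A where "A n = {y. S n y / sqrt (real n * (ln 2)\<^sup>2) \<le> - 1 \<and> D (shift_seq n y) \<le> K}" for n
  have ms1: "{y. S n y / sqrt (real n * (ln 2)\<^sup>2) \<le> - 1} \<in> sets (step_law \<theta>)" for n
  proof -
    have "{y \<in> space (step_law \<theta>). S n y / sqrt (real n * (ln 2)\<^sup>2) \<le> - 1} \<in> sets (step_law \<theta>)" by measurable
    thus ?thesis by simp
  qed
  have ms2: "{y. D (shift_seq n y) \<le> K} \<in> sets (step_law \<theta>)" for n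
  proof -
    have [measurable]: "shift_seq n \<in> step_law \<theta> \<rightarrow>\<^sub>M step_law \<theta>" by measurable
    have "{y \<in> space (step_law \<theta>). D (shift_seq n y) \<le> K} \<in> sets (step_law \<theta>)" by measurable
    thus ?thesis by simp
  qed
  have Aeq: "A n = {y. S n y / sqrt (real n * (ln 2)\<^sup>2) \<le> - 1} \<inter> {y. D (shift_seq n y) \<le> K}" for n by (auto simp: A_def)
  have Am[measurable]: "A n \<in> sets (step_law \<theta>)" for n unfolding Aeq using ms1 ms2 by blast
  have PA: "P.prob (A n) \<ge> p / 4" if "n \<ge> N" for n
  proof -
    have c: "UNIV - {y. D (shift_seq n y) \<le> K} \<in> sets (step_law \<theta>)"
      using sets.compl_sets[OF ms2] by simp
    have "P.prob {y. S n y / sqrt (real n * (ln 2)\<^sup>2) \<le> - 1} \<le> P.prob (A n \<union> (UNIV - {y. D (shift_seq n y) \<le> K}))"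
      using c by (intro P.finite_measure_mono sets.Un Am) (auto simp: Aeq)
    also have "\<dots> \<le> P.prob (A n) + P.prob (UNIV - {y. D (shift_seq n y) \<le> K})"
      using c by (intro measure_Un_le Am)
    also have "P.prob (UNIV - {y. D (shift_seq n y) \<le> K}) = 1 - P.prob {y. D (shift_seq n y) \<le> K}"
      using P.prob_compl[OF ms2] by simp
    finally show ?thesis using N[OF that] DK[of n] by linarith
  qed
  \<comment> \<open>The decreasing sets \<open>B m\<close> keep probability at least \<open>p / 4\<close>, hence so does the event that infinitely many \<open>A n\<close> occur.\<close>
  define B where "B m = (\<Union>n\<in>{m..}. A n)" for m
  have Bm[measurable]: "B m \<in> sets (step_law \<theta>)" for m unfolding B_def by measurable
  have PB: "P.prob (B m) \<ge> p / 4" for m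
  proof -
    have "p / 4 \<le> P.prob (A (max m N))" by (rule PA) simp
    also have "\<dots> \<le> P.prob (B m)" by (intro P.finite_measure_mono) (auto simp: B_def intro!: bexI[of _ "max m N"])
    finally show ?thesis .
  qed
  have "(\<lambda>m. P.prob (B m)) \<longlonglongrightarrow> P.prob (\<Inter>m. B m)"
  proof (rule P.finite_Lim_measure_decseq)
    show "decseq B" unfolding decseq_def B_def by (intro allI impI UN_mono) auto
  qed auto
  hence PI: "P.prob (\<Inter>m. B m) \<ge> p / 4" by (rule LIMSEQ_le_const) (use PB in auto)
  have impl: "vanishing_covers y" if y: "regular_steps y" and B: "y \<in> (\<Inter>m. B m)" for y
    unfolding vanishing_covers_def
  proof (intro allI)
    fix k m :: nat
    have "filterlim (\<lambda>n. K * exp (- (sqrt (real n) * ln 2))) (nhds 0) sequentially"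
    proof -
      have "filterlim (\<lambda>n. sqrt (real n) * ln 2) at_top sequentially"
        by (intro filterlim_at_top_mult_tendsto_pos[OF tendsto_const]
              filterlim_compose[OF sqrt_at_top filterlim_real_sequentially]) simp
      hence "filterlim (\<lambda>n. - (sqrt (real n) * ln 2)) at_bot sequentially"
        by (simp add: filterlim_uminus_at_top)
      from tendsto_mult_right_zero[OF filterlim_compose[OF exp_at_bot this], of K] show ?thesis .
    qed
    hence "eventually (\<lambda>n. K * exp (- (sqrt (real n) * ln 2)) < inverse (real (Suc k))) sequentially"
      by (rule order_tendstoD(2)) simp
    then obtain M where M: "\<And>n. n \<ge> M \<Longrightarrow> K * exp (- (sqrt (real n) * ln 2)) < inverse (real (Suc k))"
      by (auto simp: eventually_sequentially)
    have "y \<in> B (max (max m M) 1)" using B by blast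
    then obtain n where n: "n \<ge> max (max m M) 1" "y \<in> A n" by (auto simp: B_def)
    have ypos: "y i > 0" for i using y by (simp add: regular_steps_def)
    have "S n y / (sqrt (real n) * ln 2) \<le> - 1" using n(2) by (simp add: A_def real_sqrt_mult)
    moreover have "sqrt (real n) * ln 2 > 0" using n(1) by simp
    ultimately have S: "S n y \<le> - (sqrt (real n) * ln 2)" by (simp add: divide_le_eq)
    have "2 ^ n * (\<Prod>j<n. y j) = exp (S n y)"
      using ypos by (simp add: S_def exp_sum exp_add prod.distrib)
    hence "2 ^ n * tail_sum y n = exp (S n y) * D (shift_seq n y)"
      using tail_sum_shift[OF y, of 0 n] by (simp add: D_def mult.assoc[symmetric])
    also have "\<dots> \<le> exp (- (sqrt (real n) * ln 2)) * K"
      using n(2) S tail_sum_nonneg[OF regular_steps_shift[OF y]] by (intro mult_mono) (auto simp: A_def D_def)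
    also have "\<dots> \<le> inverse (real (Suc k))" using M[of n] n(1) by (simp add: mult.commute)
    finally show "\<exists>n\<ge>m. 2 ^ n * tail_sum y n \<le> inverse (real (Suc k))" using n(1) by (intro exI[of _ n]) simp
  qed
  show "\<not> (AE y in step_law \<theta>. \<not> vanishing_covers y)"
  proof
    assume "AE y in step_law \<theta>. \<not> vanishing_covers y"
    with AE_regular_steps[OF \<theta>0] have "AE y in step_law \<theta>. y \<notin> (\<Inter>m. B m)"
      by eventually_elim (use impl in blast)
    moreover have "(\<Inter>m. B m) \<in> sets (step_law \<theta>)" by measurable
    ultimately have "P.prob (\<Inter>m. B m) = 0" by (simp add: P.prob_eq_0)
    thus False using PI p by simp
  qed
qed

text \<open>For \<open>\<theta> < 1 / ln 2\<close> the total length \<open>2 ^ n * tail_sum y n\<close> decays exponentially; the critical exponent needs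
  the fluctuations of the walk.\<close>

lemma AE_null_subset_sums:
  assumes \<theta>: "\<theta> > 0" "\<theta> \<le> 1 / ln 2"
  shows "AE y in step_law \<theta>. emeasure lborel (subset_sums y) = 0"
proof (cases "\<theta> = 1 / ln 2")
  case True
  show ?thesis using AE_regular_steps[OF \<theta>(1)] critical_vanishing_covers[OF True]
    by eventually_elim (rule null_subset_sums_of_vanishing_covers)
next
  case False
  hence "ln 2 < 1 / \<theta>" using \<theta> by (simp add: field_simps)
  then obtain b where b: "ln 2 < b" "b < 1 / \<theta>" using dense by blast
  have b0: "b > 0" using less_trans[OF _ b(1), of 0] by simp
  show ?thesis using AE_regular_steps[OF \<theta>(1)] AE_partial_product_upper[OF \<theta>(1) b0 b(2)]
  proof eventually_elim
    case (elim y)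
    then obtain C where C: "\<And>n. partial_product y n \<le> C * exp (- b * real n)" by blast
    have "(\<lambda>n. 2 ^ n * tail_sum y n powr 1) \<longlonglongrightarrow> 0"
      using b(1) by (intro tendsto_tail_sum_powr[OF elim(1) b0 C]) auto
    hence "(\<lambda>n. ennreal (2 ^ n * tail_sum y n)) \<longlonglongrightarrow> ennreal 0"
      using tail_sum_nonneg[OF elim(1)] by (intro tendsto_ennrealI) simp
    hence "emeasure lborel (subset_sums y) \<le> ennreal 0"
      by (rule LIMSEQ_le_const) (use emeasure_subset_sums_le[OF elim(1)] in auto)
    thus ?case by simp
  qed
qed


section \<open>The conditional law\<close>

lemma distr_eq_fair_coin:
  fixes X :: "'a \<Rightarrow> real"
  assumes "prob_space M" and X[measurable]: "X \<in> borel_measurable M"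
    and X0: "measure M {\<omega> \<in> space M. X \<omega> = 0} = 1 / 2" and X1: "measure M {\<omega> \<in> space M. X \<omega> = 1} = 1 / 2"
  shows "distr M borel X = fair_coin"
proof (rule measure_eqI)
  interpret prob_space M by fact
  let ?E = "\<lambda>v. {\<omega> \<in> space M. X \<omega> = v}"
  have E[measurable]: "?E v \<in> events" for v by measurable
  have "prob (?E 0 \<union> ?E 1) = prob (?E 0) + prob (?E 1)"
    by (intro finite_measure_Union E) auto
  hence "prob (?E 0 \<union> ?E 1) = 1" using X0 X1 by simp
  hence ae: "AE \<omega> in M. \<omega> \<in> ?E 0 \<union> ?E 1" by (rule AE_prob_1)
  fix B assume "B \<in> sets (distr M borel X)"
  hence B: "B \<in> sets borel" by simp
  have "emeasure (distr M borel X) B = emeasure M (X -` B \<inter> space M)"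
    using B by (intro emeasure_distr) auto
  also have "\<dots> = emeasure M ((if 0 \<in> B then ?E 0 else {}) \<union> (if 1 \<in> B then ?E 1 else {}))"
  proof (rule emeasure_eq_AE)
    show "AE \<omega> in M. \<omega> \<in> X -` B \<inter> space M \<longleftrightarrow> \<omega> \<in> (if 0 \<in> B then ?E 0 else {}) \<union> (if 1 \<in> B then ?E 1 else {})"
      using ae by eventually_elim auto
    show "X -` B \<inter> space M \<in> events" using B by (rule measurable_sets[OF X])
  qed auto
  also have "\<dots> = emeasure M (if 0 \<in> B then ?E 0 else {}) + emeasure M (if 1 \<in> B then ?E 1 else {})"
    by (intro plus_emeasure[symmetric]) auto
  also have "\<dots> = ennreal (indicator B 0 / 2) + ennreal (indicator B 1 / 2)"
  proof -
    have "emeasure M (if 0 \<in> B then ?E 0 else {}) = ennreal (indicator B 0 / 2)"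
      using X0 by (simp only: emeasure_eq_measure) (simp add: indicator_def)
    moreover have "emeasure M (if 1 \<in> B then ?E 1 else {}) = ennreal (indicator B 1 / 2)"
      using X1 by (simp only: emeasure_eq_measure) (simp add: indicator_def)
    ultimately show ?thesis by (simp only:)
  qed
  also have "\<dots> = ennreal (indicator B 0 / 2 + indicator B 1 / 2)"
    by (intro ennreal_plus[symmetric]) auto
  finally show "emeasure (distr M borel X) B = emeasure fair_coin B"
    unfolding emeasure_fair_coin[OF B] by (simp only: add_divide_distrib)
qed simp

lemma distr_sequence_eq_PiM:
  fixes X :: "nat \<Rightarrow> 'a \<Rightarrow> real"
  assumes "prob_space M" and ind: "prob_space.indep_vars M (\<lambda>_. borel) X UNIV"
    and D: "\<And>i. distr M borel (X i) = D"
  shows "distr M seq_borel (\<lambda>\<omega> i. X i \<omega>) = Pi\<^sub>M UNIV (\<lambda>_. D)"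
proof -
  interpret prob_space M by fact
  have rv: "random_variable borel (X i)" for i using ind by (simp add: indep_vars_def)
  have "distr M seq_borel (\<lambda>x. \<lambda>i\<in>UNIV. X i x) = (Pi\<^sub>M UNIV (\<lambda>i. distr M borel (X i)))"
    using ind rv by (subst (asm) indep_vars_iff_distr_eq_PiM) auto
  moreover have "(\<lambda>x. \<lambda>i\<in>UNIV. X i x) = (\<lambda>x i. X i x)" by (simp add: fun_eq_iff)
  ultimately show ?thesis by (simp add: D)
qed

text \<open>Countably many half-lines determine the measure, which allows almost sure equalities to be combined.\<close>

lemma real_measure_eqI_rat:
  fixes M N :: "real measure"
  assumes S: "sets M = sets borel" "sets N = sets borel" and P: "prob_space M" "prob_space N"
    and eq: "\<And>q. q \<in> \<rat> \<Longrightarrow> emeasure M {q<..} = emeasure N {q<..}"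
  shows "M = N"
proof (rule measure_eqI_lessThan[OF S])
  have le: "emeasure M {x<..} \<le> emeasure N {x<..}"
    if S: "sets M = sets borel" "sets N = sets borel" and eq: "\<And>q. q \<in> \<rat> \<Longrightarrow> emeasure M {q<..} = emeasure N {q<..}"
    for x :: real and M N :: "real measure"
  proof -
    have U: "{x<..} = (\<Union>n. {x + inverse (real (Suc n))<..})"
    proof (intro equalityI subsetI)
      fix z assume "z \<in> {x<..}"
      then obtain n where "inverse (real (Suc n)) < z - x" using reals_Archimedean[of "z - x"] by auto
      thus "z \<in> (\<Union>n. {x + inverse (real (Suc n))<..})" by (auto intro!: exI[of _ n])
    next
      fix z assume "z \<in> (\<Union>n. {x + inverse (real (Suc n))<..})"
      then obtain n where "x + inverse (real (Suc n)) < z" by auto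
      moreover have "inverse (real (Suc n)) > 0" by simp
      ultimately have "x < z" by linarith
      thus "z \<in> {x<..}" by simp
    qed
    have inc: "incseq (\<lambda>n. {x + inverse (real (Suc n))<..})"
    proof (intro monoI subsetI)
      fix m n :: nat and z assume "m \<le> n" and z: "z \<in> {x + inverse (real (Suc m))<..}"
      hence "inverse (real (Suc n)) \<le> inverse (real (Suc m))" by (intro le_imp_inverse_le) auto
      moreover have "x + inverse (real (Suc m)) < z" using z by simp
      ultimately have "x + inverse (real (Suc n)) < z" by linarith
      thus "z \<in> {x + inverse (real (Suc n))<..}" by simp
    qed
    have "emeasure M {x<..} = (SUP n. emeasure M {x + inverse (real (Suc n))<..})"
    proof -
      have "range (\<lambda>n. {x + inverse (real (Suc n))<..}) \<subseteq> sets M" unfolding S(1) by (rule image_subsetI) (rule borel_open, rule open_greaterThan)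
      from SUP_emeasure_incseq[OF this inc] show ?thesis by (simp only: U)
    qed
    also have "\<dots> \<le> emeasure N {x<..}"
    proof (rule SUP_least)
      fix n :: nat
      obtain q where q: "q \<in> \<rat>" "x < q" "q < x + inverse (real (Suc n))"
        using Rats_dense_in_real[of x "x + inverse (real (Suc n))"]
        by (metis inverse_positive_iff_positive less_add_same_cancel1 of_nat_0_less_iff zero_less_Suc)
      have "emeasure M {x + inverse (real (Suc n))<..} \<le> emeasure M {q<..}"
        using q S by (intro emeasure_mono) auto
      also have "\<dots> = emeasure N {q<..}" by (rule eq[OF q(1)])
      also have "\<dots> \<le> emeasure N {x<..}" using q S by (intro emeasure_mono) auto
      finally show "emeasure M {x + inverse (real (Suc n))<..} \<le> emeasure N {x<..}" .
    qed
    finally show ?thesis .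
  qed
  show "emeasure M {x<..} = emeasure N {x<..}" for x
    using le[OF S eq] le[OF S(2,1) eq[symmetric]] by (intro antisym)
  interpret M: prob_space M by (rule P(1))
  show "emeasure M {x<..} < \<infinity>" for x by (simp add: M.emeasure_eq_measure)
qed

lemma borel_measurable_emeasure_masked_law:
  assumes B: "B \<in> sets borel"
  shows "(\<lambda>y. emeasure (masked_law I y) B) \<in> borel_measurable seq_borel"
proof -
  interpret Q: prob_space coin_law by (rule prob_space_coin_law)
  note B[measurable]
  have "(\<lambda>y. \<integral>\<^sup>+c. indicator B (masked_sum I y c) \<partial>coin_law) \<in> borel_measurable seq_borel"
    by measurable
  moreover have "(\<integral>\<^sup>+c. indicator B (masked_sum I y c) \<partial>coin_law) = emeasure (masked_law I y) B" for y
    using B by (subst nn_integral_masked_law[symmetric]) auto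
  ultimately show ?thesis by simp
qed

text \<open>Integrated over sets of steps, both kernels give the joint law of the steps and \<open>Z\<close>, the coins being independent of
  the steps. Hence they agree on every fixed Borel set for almost every sequence of steps, and on all rational half-lines
  simultaneously.\<close>

proposition AE_conditional_law_eq_masked_law:
  fixes M :: "'a measure" and Y J :: "nat \<Rightarrow> 'a \<Rightarrow> real"
  assumes "prob_space M"
    and Y_law: "distr M seq_borel (\<lambda>\<omega> i. Y i \<omega>) = step_law \<theta>"
    and J_law: "distr M seq_borel (\<lambda>\<omega> i. J i \<omega>) = coin_law"
    and ind: "prob_space.indep_var M
           seq_borel (\<lambda>\<omega> i. Y i \<omega>) seq_borel (\<lambda>\<omega> i. J i \<omega>)"
    and Z: "Z = (\<lambda>\<omega>. \<Sum>i. J i \<omega> * partial_product (\<lambda>j. Y j \<omega>) i)"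
    and \<nu>: "is_cond_distr M seq_borel (\<lambda>\<omega> i. Y i \<omega>) borel Z \<nu>"
  shows "AE y in step_law \<theta>. \<nu> y = masked_law UNIV y"
proof -
  interpret prob_space M by fact
  interpret P: prob_space "step_law \<theta>" by (rule prob_space_step_law)
  interpret Q: prob_space coin_law by (rule prob_space_coin_law)
  let ?B = seq_borel
  let ?Y = "\<lambda>\<omega> i. Y i \<omega>" and ?J = "\<lambda>\<omega> i. J i \<omega>"
  have rv[measurable]: "?Y \<in> M \<rightarrow>\<^sub>M ?B" "?J \<in> M \<rightarrow>\<^sub>M ?B"
    and joint: "step_law \<theta> \<Otimes>\<^sub>M coin_law = distr M (?B \<Otimes>\<^sub>M ?B) (\<lambda>\<omega>. (?Y \<omega>, ?J \<omega>))"
    using ind unfolding indep_var_distribution_eq Y_law J_law by auto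
  have spB: "space ?B = UNIV" by (simp add: space_PiM)
  have Z': "Z \<omega> = masked_sum UNIV (?Y \<omega>) (?J \<omega>)" for \<omega> unfolding Z masked_sum_UNIV ..
  have \<nu>m: "\<nu> \<in> ?B \<rightarrow>\<^sub>M prob_algebra borel"
    and \<nu>i: "\<And>A B. A \<in> sets ?B \<Longrightarrow> B \<in> sets borel \<Longrightarrow>
      emeasure M {\<omega> \<in> space M. ?Y \<omega> \<in> A \<and> Z \<omega> \<in> B} = (\<integral>\<^sup>+y\<in>A. emeasure (\<nu> y) B \<partial>step_law \<theta>)"
    using \<nu> unfolding is_cond_distr_def Y_law by auto
  have \<nu>s: "sets (\<nu> y) = sets borel" "prob_space (\<nu> y)" for y
    using measurable_space[OF \<nu>m, of y] by (auto simp: space_prob_algebra spB)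
  have mi: "emeasure M {\<omega> \<in> space M. ?Y \<omega> \<in> A \<and> Z \<omega> \<in> B} = (\<integral>\<^sup>+y\<in>A. emeasure (masked_law UNIV y) B \<partial>step_law \<theta>)"
    if A: "A \<in> sets ?B" and B: "B \<in> sets borel" for A B
  proof -
    note A[measurable] B[measurable]
    have E[measurable]: "{z \<in> space (?B \<Otimes>\<^sub>M ?B). fst z \<in> A \<and> masked_sum UNIV (fst z) (snd z) \<in> B} \<in> sets (?B \<Otimes>\<^sub>M ?B)"
      by measurable
    have "emeasure M {\<omega> \<in> space M. ?Y \<omega> \<in> A \<and> Z \<omega> \<in> B}
       = emeasure (step_law \<theta> \<Otimes>\<^sub>M coin_law) {z \<in> space (?B \<Otimes>\<^sub>M ?B). fst z \<in> A \<and> masked_sum UNIV (fst z) (snd z) \<in> B}"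
      unfolding joint using E
      by (subst emeasure_distr) (auto simp: Z' space_pair_measure spB intro!: arg_cong[where f="emeasure M"])
    also have "\<dots> = (\<integral>\<^sup>+z. indicator A (fst z) * indicator B (masked_sum UNIV (fst z) (snd z)) \<partial>(step_law \<theta> \<Otimes>\<^sub>M coin_law))"
    proof (subst nn_integral_indicator[symmetric])
      have "sets (step_law \<theta> \<Otimes>\<^sub>M coin_law) = sets (?B \<Otimes>\<^sub>M ?B)"
        by (intro sets_pair_measure_cong sets_step_law sets_coin_law)
      thus "{z \<in> space (?B \<Otimes>\<^sub>M ?B). fst z \<in> A \<and> masked_sum UNIV (fst z) (snd z) \<in> B} \<in> sets (step_law \<theta> \<Otimes>\<^sub>M coin_law)"
        using E by simp
    qed (auto intro!: nn_integral_cong simp: indicator_def space_pair_measure spB)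
    also have "\<dots> = (\<integral>\<^sup>+y. (\<integral>\<^sup>+c. indicator A y * indicator B (masked_sum UNIV y c) \<partial>coin_law) \<partial>step_law \<theta>)"
      by (subst Q.nn_integral_fst[symmetric]) auto
    also have "\<dots> = (\<integral>\<^sup>+y. emeasure (masked_law UNIV y) B * indicator A y \<partial>step_law \<theta>)"
    proof (rule nn_integral_cong)
      fix y :: "nat \<Rightarrow> real"
      have "(\<integral>\<^sup>+c. indicator B (masked_sum UNIV y c) \<partial>coin_law) = emeasure (masked_law UNIV y) B"
        by (subst nn_integral_masked_law[symmetric]) auto
      thus "(\<integral>\<^sup>+c. indicator A y * indicator B (masked_sum UNIV y c) \<partial>coin_law) = emeasure (masked_law UNIV y) B * indicator A y"
        by (subst nn_integral_cmult) (auto simp: mult.commute)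
    qed
    finally show ?thesis .
  qed
  have ae: "AE y in step_law \<theta>. emeasure (\<nu> y) B = emeasure (masked_law UNIV y) B" if B: "B \<in> sets borel" for B
  proof (rule P.density_unique_finite_measure)
    show "(\<lambda>y. emeasure (\<nu> y) B) \<in> borel_measurable (step_law \<theta>)"
      using measurable_emeasure_kernel[OF measurable_prob_algebraD[OF \<nu>m] B] by simp
    show "(\<lambda>y. emeasure (masked_law UNIV y) B) \<in> borel_measurable (step_law \<theta>)"
      using borel_measurable_emeasure_masked_law[OF B] by simp
    fix A assume "A \<in> sets (step_law \<theta>)"
    hence "A \<in> sets ?B" by (simp add: sets_step_law)
    thus "(\<integral>\<^sup>+y. emeasure (\<nu> y) B * indicator A y \<partial>step_law \<theta>) = (\<integral>\<^sup>+y. emeasure (masked_law UNIV y) B * indicator A y \<partial>step_law \<theta>)"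
      using \<nu>i mi B by simp
  qed auto
  have "AE y in step_law \<theta>. \<forall>q\<in>\<rat>. emeasure (\<nu> y) {q<..} = emeasure (masked_law UNIV y) {q<..}"
    by (intro AE_ball_countable' countable_rat ae) simp
  thus ?thesis
    by eventually_elim (rule real_measure_eqI_rat, auto simp: \<nu>s prob_space_masked_law)
qed

section \<open>The three regimes\<close>

lemma emeasure_subset_sums_pos_of_abs_cont:
  assumes y: "regular_steps y" and ac: "absolutely_continuous lborel (masked_law UNIV y)"
  shows "emeasure lborel (subset_sums y) > 0"
proof (rule ccontr)
  interpret prob_space "masked_law UNIV y" by (rule prob_space_masked_law)
  assume "\<not> ?thesis"
  moreover have S: "subset_sums y \<in> sets borel" using compact_subset_sums[OF y] by (simp add: compact_imp_closed borel_closed)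
  ultimately have "subset_sums y \<in> null_sets lborel" by (simp add: null_sets_def)
  hence "subset_sums y \<in> null_sets (masked_law UNIV y)" using ac by (auto simp: absolutely_continuous_def)
  moreover have "- subset_sums y \<in> null_sets (masked_law UNIV y)"
    using masked_law_subset_sums[OF y] S by (simp add: null_sets_def)
  ultimately have "subset_sums y \<union> - subset_sums y \<in> null_sets (masked_law UNIV y)" by (rule null_sets.Un)
  hence "emeasure (masked_law UNIV y) (space (masked_law UNIV y)) = 0" by (auto simp: null_sets_def)
  thus False using emeasure_space_1 by simp
qed

text \<open>Near a point where a continuous density is positive, every nonempty open set has positive mass.\<close>

lemma topological_support_contains_interval:
  fixes f :: "real \<Rightarrow> real"
  assumes P: "prob_space (density lborel (\<lambda>x. ennreal (f x)))"
    and f: "continuous_on UNIV f" "\<And>x. 0 \<le> f x"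
  shows "\<exists>a b. a < b \<and> {a..b} \<subseteq> topological_support (density lborel (\<lambda>x. ennreal (f x)))"
proof -
  let ?\<mu> = "density lborel (\<lambda>x. ennreal (f x))"
  interpret prob_space ?\<mu> by (rule P)
  have [measurable]: "f \<in> borel_measurable borel" using f(1) by (rule borel_measurable_continuous_onI)
  have "\<exists>x. f x > 0"
  proof (rule ccontr)
    assume "\<not> ?thesis"
    hence "f x \<le> 0" for x by (simp add: not_less)
    hence "f x = 0" for x using f(2)[of x] by (intro antisym)
    hence "emeasure ?\<mu> (space ?\<mu>) = 0" by (simp add: emeasure_density)
    thus False using emeasure_space_1 by simp
  qed
  then obtain x where x: "f x > 0" by blast
  have "open {z. 0 < f z}" using f(1) by (intro open_Collect_less continuous_on_const)
  then obtain d where d: "d > 0" "\<And>z. dist z x < d \<Longrightarrow> 0 < f z" using x unfolding open_dist by blast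
  have "{x - d/2..x + d/2} \<subseteq> topological_support ?\<mu>"
    unfolding topological_support_def
  proof (intro subsetI CollectI allI impI)
    fix z U assume z: "z \<in> {x - d/2..x + d/2}" and U: "open U" "z \<in> U"
    obtain e0 where e0: "e0 > 0" "\<And>w. dist w z < e0 \<Longrightarrow> w \<in> U" using U by (auto simp: open_dist)
    define e where "e = min (e0 / 2) (d / 4)"
    have e: "e > 0" "e < e0" "e \<le> d / 4" using e0 d by (auto simp: e_def)
    have sub: "{z..z + e} \<subseteq> U \<inter> {w. 0 < f w}"
      using z e d e0 by (auto simp: dist_real_def)
    have "\<not> emeasure ?\<mu> U = 0"
    proof
      assume "emeasure ?\<mu> U = 0"
      hence "AE w in lborel. ennreal (f w) * indicator U w = 0"
        using U(1) by (simp add: emeasure_density nn_integral_0_iff_AE)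
      hence "AE w in lborel. w \<notin> {z..z + e}"
        by (rule eventually_mono) (use sub in \<open>auto simp: indicator_def\<close>)
      hence "emeasure lborel {z..z + e} = 0"
        by (subst (asm) AE_iff_measurable[where N="{z..z + e}"]) auto
      thus False using e(1) by simp
    qed
    thus "0 < emeasure ?\<mu> U" by (simp add: zero_less_iff_neq_zero)
  qed
  thus ?thesis using d(1) by (intro exI[of _ "x - d/2"] exI[of _ "x + d/2"]) auto
qed

lemma summable_full_mask:
  assumes "a < ln 2"
  shows "summable (\<lambda>k. (1/2) ^ card (UNIV \<inter> {..<k}) * exp (a * real k))"
proof -
  have "exp a < exp (ln 2)" unfolding exp_less_cancel_iff by (rule assms)
  hence "summable (\<lambda>k. (exp a / 2) ^ k)" by (intro summable_geometric) simp
  moreover have "(exp a / 2) ^ k = (1/2) ^ card (UNIV \<inter> {..<k}) * exp (a * real k)" for k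
    by (simp add: power_divide exp_of_nat_mult[symmetric] mult.commute)
  ultimately show ?thesis by (simp only:)
qed

text \<open>Half of the coins agree up to \<open>k\<close> with probability at most \<open>(1/2) ^ (k div 2)\<close>, and \<open>k div 2 \<ge> k / 2 - 1\<close> costs the
  constant factor 2.\<close>

lemma summable_half_mask:
  assumes a: "a < ln 2 / 2" and I: "\<And>k. k div 2 \<le> card (I \<inter> {..<k})"
  shows "summable (\<lambda>k. (1/2) ^ card (I \<inter> {..<k}) * exp (a * real k))"
proof (rule summable_comparison_test'[where N=0 and g="\<lambda>k. 2 * exp (a - ln 2 / 2) ^ k"])
  have "exp (a - ln 2 / 2) < exp 0" using a by (simp only: exp_less_cancel_iff)
  thus "summable (\<lambda>k. 2 * exp (a - ln 2 / 2) ^ k)" by (intro summable_mult summable_geometric) simp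
  fix k :: nat
  have e2: "(1/2) ^ j = exp (- (ln 2 * real j))" for j
    by (simp add: exp_minus exp_of_nat2_mult power_one_over inverse_eq_divide)
  have "real k / 2 - 1 \<le> real (k div 2)" by linarith
  hence "ln 2 * (real k / 2 - 1) \<le> ln 2 * real (k div 2)" by (intro mult_left_mono) auto
  hence "- (ln 2 * real (k div 2)) \<le> ln 2 - ln 2 / 2 * real k" by (simp add: algebra_simps)
  hence 1: "exp (- (ln 2 * real (k div 2))) \<le> exp (ln 2 - ln 2 / 2 * real k)" by (simp only: exp_le_cancel_iff)
  have "(1/2::real) ^ card (I \<inter> {..<k}) \<le> (1/2) ^ (k div 2)" by (rule power_decreasing[OF I]) auto
  also have "\<dots> \<le> exp (ln 2 - ln 2 / 2 * real k)" unfolding e2 by (rule 1)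
  finally have "(1/2) ^ card (I \<inter> {..<k}) * exp (a * real k) \<le> exp (ln 2 - ln 2 / 2 * real k) * exp (a * real k)"
    by (rule mult_right_mono) simp
  also have "\<dots> = exp (ln 2 + real k * (a - ln 2 / 2))" by (simp add: exp_add[symmetric] algebra_simps)
  also have "\<dots> = 2 * exp (a - ln 2 / 2) ^ k" by (simp only: exp_add exp_of_nat_mult) simp
  finally show "norm ((1/2) ^ card (I \<inter> {..<k}) * exp (a * real k)) \<le> 2 * exp (a - ln 2 / 2) ^ k" by simp
qed

lemma card_parity_class_ge:
  assumes "r < 2"
  shows "k div 2 \<le> card ({i. i mod 2 = r} \<inter> {..<k})"
proof -
  have "card ((\<lambda>j. 2 * j + r) ` {..<k div 2}) \<le> card ({i. i mod 2 = r} \<inter> {..<k})"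
    using assms by (intro card_mono) auto
  thus ?thesis by (subst (asm) card_image) (auto simp: inj_on_def)
qed

proposition AE_masked_law_L2_density:
  assumes \<theta>: "\<theta> > 1 / ln 2"
  shows "AE y in step_law \<theta>. absolutely_continuous lborel (masked_law UNIV y) \<and>
        (\<exists>f :: real \<Rightarrow> real. f \<in> borel_measurable lborel \<and> (\<forall>x. 0 \<le> f x) \<and>
           masked_law UNIV y = density lborel (\<lambda>x. ennreal (f x)) \<and>
           integrable lborel (\<lambda>x. (f x)\<^sup>2)) \<and>
        emeasure lborel (subset_sums y) > 0"
proof -
  have \<theta>0: "\<theta> > 0" using less_trans[OF _ \<theta>, of 0] by simp
  have "1 / \<theta> < ln 2" using \<theta> \<theta>0 by (simp add: field_simps)
  then obtain a where a: "1 / \<theta> < a" "a < ln 2" using dense by blast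
  show ?thesis
    using AE_finite_energy[OF \<theta>0 a(1) summable_full_mask[OF a(2)]] AE_regular_steps[OF \<theta>0]
  proof eventually_elim
    case (elim y)
    note ac = absolutely_continuous_of_finite_energy[OF sets_masked_law prob_space_masked_law elim(1)]
    show ?case
      using ac L2_density_of_finite_energy[OF sets_masked_law prob_space_masked_law elim(1)]
        emeasure_subset_sums_pos_of_abs_cont[OF elim(2) ac] by blast
  qed
qed

text \<open>With the coins split by parity, the characteristic function is a product of two square integrable functions, so
  it is integrable.\<close>

proposition AE_masked_law_continuous_density:
  assumes \<theta>: "\<theta> > 2 / ln 2"
  shows "AE y in step_law \<theta>. absolutely_continuous lborel (masked_law UNIV y) \<and>
        (\<exists>f :: real \<Rightarrow> real. continuous_on UNIV f \<and> (\<forall>x. 0 \<le> f x) \<and>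
           masked_law UNIV y = density lborel (\<lambda>x. ennreal (f x))) \<and>
        (\<exists>a b. a < b \<and> {a..b} \<subseteq> subset_sums y)"
proof -
  have \<theta>0: "\<theta> > 0" using less_trans[OF _ \<theta>, of 0] by simp
  have "1 / ln 2 < 2 / (ln 2 :: real)" by (simp add: divide_strict_right_mono)
  hence \<theta>1: "\<theta> > 1 / ln 2" using \<theta> by linarith
  have "1 / \<theta> < ln 2 / 2" using \<theta> \<theta>0 by (simp add: field_simps)
  then obtain a where a: "1 / \<theta> < a" "a < ln 2 / 2" using dense by blast
  let ?E = "{i::nat. i mod 2 = 0}" and ?O = "{i::nat. i mod 2 = 1}"
  have un: "?E \<union> ?O = UNIV" and dis: "?E \<inter> ?O = {}" by auto
  have sm: "summable (\<lambda>k. (1/2) ^ card (?E \<inter> {..<k}) * exp (a * real k))"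
           "summable (\<lambda>k. (1/2) ^ card (?O \<inter> {..<k}) * exp (a * real k))"
    by (rule summable_half_mask[OF a(2)], rule card_parity_class_ge, simp)+
  show ?thesis
    using AE_finite_energy[OF \<theta>0 a(1) sm(1)] AE_finite_energy[OF \<theta>0 a(1) sm(2)]
      AE_regular_steps[OF \<theta>0] AE_masked_law_L2_density[OF \<theta>1]
  proof eventually_elim
    case (elim y)
    let ?\<mu> = "masked_law UNIV y"
    have rd: "real_distribution (masked_law I y)" for I
      using prob_space_masked_law by (simp add: real_distribution_def real_distribution_axioms_def)
    note cm[measurable] = char_measurable[OF rd]
    have sq: "integrable lborel (\<lambda>t. (cmod (char (masked_law ?E y) t))\<^sup>2)"
             "integrable lborel (\<lambda>t. (cmod (char (masked_law ?O y) t))\<^sup>2)"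
      by (rule char_square_integrable_of_finite_energy[OF sets_masked_law prob_space_masked_law], rule elim)+
    have "integrable lborel (char ?\<mu>)"
    proof (rule Bochner_Integration.integrable_bound[OF Bochner_Integration.integrable_add[OF sq]])
      show "AE t in lborel. norm (char ?\<mu> t) \<le> norm ((cmod (char (masked_law ?E y) t))\<^sup>2 + (cmod (char (masked_law ?O y) t))\<^sup>2)"
      proof (rule AE_I2)
        fix t
        have "char ?\<mu> t = char (masked_law ?E y) t * char (masked_law ?O y) t"
          using char_masked_law_Un[OF elim(3) dis, of t] unfolding un .
        moreover have "u * v \<le> u\<^sup>2 + v\<^sup>2" if "u \<ge> 0" "v \<ge> 0" for u v :: real
          using sum_squares_bound[of u v] mult_nonneg_nonneg[OF that] by simp
        ultimately show "norm (char ?\<mu> t) \<le> norm ((cmod (char (masked_law ?E y) t))\<^sup>2 + (cmod (char (masked_law ?O y) t))\<^sup>2)"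
          by (simp add: norm_mult)
      qed
    qed simp
    moreover have "measure ?\<mu> {x} = 0" for x
    proof -
      have "absolutely_continuous lborel ?\<mu>" using elim(4) by blast
      moreover have "{x} \<in> null_sets lborel" by (simp add: null_sets_def)
      ultimately have "{x} \<in> null_sets ?\<mu>" unfolding absolutely_continuous_def by blast
      thus ?thesis by (simp add: measure_def null_sets_def)
    qed
    ultimately obtain f :: "real \<Rightarrow> real" where f: "continuous_on UNIV f" "\<And>x. 0 \<le> f x" "?\<mu> = density lborel (\<lambda>x. ennreal (f x))"
      using continuous_density_of_integrable_char[OF rd] by blast
    have "\<exists>a b. a < b \<and> {a..b} \<subseteq> topological_support ?\<mu>"
      using topological_support_contains_interval[of f] prob_space_masked_law[of UNIV y] f by simp
    thus ?case using elim(4) f unfolding topological_support_masked_law[OF elim(3)] by blast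
  qed
qed

proposition AE_masked_law_dimension:
  assumes \<theta>: "\<theta> > 0" "\<theta> \<le> 1 / ln 2"
  shows "AE y in step_law \<theta>. subset_sums y \<in> null_sets lborel \<and>
        hausdorff_dim (subset_sums y) = ennreal (\<theta> * ln 2) \<and>
        hausdorff_dim_measure (masked_law UNIV y) = ennreal (\<theta> * ln 2)"
  using AE_null_subset_sums[OF \<theta>] AE_hausdorff_dim_subset_sums_le[OF \<theta>(1)] AE_hausdorff_dim_lower[OF \<theta>]
    AE_regular_steps[OF \<theta>(1)]
proof eventually_elim
  case (elim y)
  have S: "subset_sums y \<in> sets borel" using compact_subset_sums[OF elim(4)] by (simp add: compact_imp_closed borel_closed)
  have full: "- subset_sums y \<in> null_sets (masked_law UNIV y)"
    using masked_law_subset_sums[OF elim(4)] S by (simp add: null_sets_def)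
  have dim: "hausdorff_dim (subset_sums y) = ennreal (\<theta> * ln 2)"
    using elim(2,3) full by (intro antisym) auto
  have "hausdorff_dim_measure (masked_law UNIV y) = ennreal (\<theta> * ln 2)"
    unfolding hausdorff_dim_measure_def
  proof (rule antisym)
    show "(INF A\<in>{A. - A \<in> null_sets (masked_law UNIV y)}. hausdorff_dim A) \<le> ennreal (\<theta> * ln 2)"
      unfolding dim[symmetric] using full by (intro INF_lower) simp
    show "ennreal (\<theta> * ln 2) \<le> (INF A\<in>{A. - A \<in> null_sets (masked_law UNIV y)}. hausdorff_dim A)"
      using elim(3) by (intro INF_greatest) auto
  qed
  thus ?case using dim elim(1) S by (simp add: null_sets_def)
qed

theorem proposition1p2:
  fixes M :: "'a measure"
    and \<theta> :: real
    and Y J :: "nat \<Rightarrow> 'a \<Rightarrow> real"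
    and Z :: "'a \<Rightarrow> real"
    and P :: "(nat \<Rightarrow> real) measure"
    and \<nu> :: "(nat \<Rightarrow> real) \<Rightarrow> real measure"
  assumes "prob_space M"
    and "\<theta> > 0"
    and Y_indep: "prob_space.indep_vars M (\<lambda>_. borel) Y UNIV"
    and Y_distr: "\<And>i. distr M borel (Y i) =
           distr (uniform_measure lborel {0..1}) borel (\<lambda>u. u powr (1 / \<theta>))"
    and J_indep: "prob_space.indep_vars M (\<lambda>_. borel) J UNIV"
    and J_fair: "\<And>i. measure M {\<omega> \<in> space M. J i \<omega> = 0} = 1 / 2"
                "\<And>i. measure M {\<omega> \<in> space M. J i \<omega> = 1} = 1 / 2"
    and Y_J_indep: "prob_space.indep_var M
           (Pi\<^sub>M UNIV (\<lambda>_. borel)) (\<lambda>\<omega> i. Y i \<omega>) (Pi\<^sub>M UNIV (\<lambda>_. borel)) (\<lambda>\<omega> i. J i \<omega>)"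
    and Z: "Z = (\<lambda>\<omega>. \<Sum>i. J i \<omega> * partial_product (\<lambda>j. Y j \<omega>) i)"
    and P: "P = distr M (Pi\<^sub>M UNIV (\<lambda>_. borel)) (\<lambda>\<omega> i. Y i \<omega>)"
    and \<nu>: "is_cond_distr M (Pi\<^sub>M UNIV (\<lambda>_. borel)) (\<lambda>\<omega> i. Y i \<omega>) borel Z \<nu>"
  shows "(AE y in P. topological_support (\<nu> y) = subset_sums y) \<and>
    (\<theta> > 1 / ln 2 \<longrightarrow>
      (AE y in P.
        absolutely_continuous lborel (\<nu> y) \<and>
        (\<exists>f :: real \<Rightarrow> real. f \<in> borel_measurable lborel \<and> (\<forall>x. 0 \<le> f x) \<and>
           \<nu> y = density lborel (\<lambda>x. ennreal (f x)) \<and>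
           integrable lborel (\<lambda>x. (f x)\<^sup>2)) \<and>
        emeasure lborel (subset_sums y) > 0)) \<and>
    (\<theta> > 2 / ln 2 \<longrightarrow>
      (AE y in P.
        absolutely_continuous lborel (\<nu> y) \<and>
        (\<exists>f :: real \<Rightarrow> real. continuous_on UNIV f \<and> (\<forall>x. 0 \<le> f x) \<and>
           \<nu> y = density lborel (\<lambda>x. ennreal (f x))) \<and>
        (\<exists>a b. a < b \<and> {a..b} \<subseteq> subset_sums y))) \<and>
    (\<theta> \<le> 1 / ln 2 \<longrightarrow>
      (AE y in P.
        subset_sums y \<in> null_sets lborel \<and>
        hausdorff_dim (subset_sums y) = ennreal (\<theta> * ln 2) \<and>
        hausdorff_dim_measure (\<nu> y) = ennreal (\<theta> * ln 2)))"
proof -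
  interpret prob_space M by fact
  have P_law: "P = step_law \<theta>"
    unfolding P by (rule distr_sequence_eq_PiM[OF assms(1) Y_indep]) (simp add: Y_distr power_law_def)
  have "distr M borel (J i) = fair_coin" for i
    using J_indep J_fair by (intro distr_eq_fair_coin assms(1)) (auto simp: indep_vars_def)
  hence J_law: "distr M (Pi\<^sub>M UNIV (\<lambda>_. borel)) (\<lambda>\<omega> i. J i \<omega>) = coin_law"
    by (rule distr_sequence_eq_PiM[OF assms(1) J_indep])
  have \<nu>_law: "AE y in step_law \<theta>. \<nu> y = masked_law UNIV y"
    by (rule AE_conditional_law_eq_masked_law[OF assms(1) P_law[unfolded P] J_law Y_J_indep Z \<nu>])
  have "AE y in P. topological_support (\<nu> y) = subset_sums y"
    unfolding P_law using \<nu>_law AE_regular_steps[OF assms(2)]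
    by eventually_elim (simp add: topological_support_masked_law)
  moreover have "AE y in P. absolutely_continuous lborel (\<nu> y) \<and>
        (\<exists>f :: real \<Rightarrow> real. f \<in> borel_measurable lborel \<and> (\<forall>x. 0 \<le> f x) \<and>
           \<nu> y = density lborel (\<lambda>x. ennreal (f x)) \<and> integrable lborel (\<lambda>x. (f x)\<^sup>2)) \<and>
        emeasure lborel (subset_sums y) > 0" if "\<theta> > 1 / ln 2"
    unfolding P_law using \<nu>_law AE_masked_law_L2_density[OF that] by eventually_elim simp
  moreover have "AE y in P. absolutely_continuous lborel (\<nu> y) \<and>
        (\<exists>f :: real \<Rightarrow> real. continuous_on UNIV f \<and> (\<forall>x. 0 \<le> f x) \<and>
           \<nu> y = density lborel (\<lambda>x. ennreal (f x))) \<and>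
        (\<exists>a b. a < b \<and> {a..b} \<subseteq> subset_sums y)" if "\<theta> > 2 / ln 2"
    unfolding P_law using \<nu>_law AE_masked_law_continuous_density[OF that] by eventually_elim simp
  moreover have "AE y in P. subset_sums y \<in> null_sets lborel \<and>
        hausdorff_dim (subset_sums y) = ennreal (\<theta> * ln 2) \<and>
        hausdorff_dim_measure (\<nu> y) = ennreal (\<theta> * ln 2)" if "\<theta> \<le> 1 / ln 2"
    unfolding P_law using \<nu>_law AE_masked_law_dimension[OF assms(2) that] by eventually_elim simp
  ultimately show ?thesis by blast
qed

end
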